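(* Consider the discrete-time dual-queue status update system with freezing parameter $k\ge 1$, discrete phase-type service times $T_m\sim \mathrm{DPH}(\boldsymbol\alpha^{(m)},\boldsymbol B^{(m)})$ of order $N_m$ ($m=1,2$), and a fixed strict priority rule ($S_1$ priority or $S_2$ priority), as described in the context. Let $\{Y_h\}_{h\ge 0}$ be the associated absorbing Markov chain, with transient-to-transient transition matrix $\boldsymbol A$, initial probability (row) vector $\boldsymbol\sigma$ on the transient states, and let $\mathcal C$ be the set of transient states of classes $7,8,\dots,14$ (the non-$P^*$ states). Let $u_\Delta(h)=\lim_{t\to\infty}\Pr(\Delta(t)=h)$ be the probability mass function of the steady-state Age of Information. Then $u_\Delta(h)$ is proportional to the probability that the chain is in $\mathcal C$ after $h$ slots, i.e. there is a constant $\kappa_1>0$ not depending on $h$ such that for all $h=1,2,\dots$ $$u_\Delta(h)=\kappa_1\Pr(Y_h\in\mathcal C),$$ and, explicitly, for all $h=1,2,\dots$ $$u_\Delta(h)=\frac{\boldsymbol\sigma\boldsymbol A^{h}\boldsymbol v}{\boldsymbol\sigma\boldsymbol A(\boldsymbol I-\boldsymbol A)^{-1}\boldsymbol v},$$ where $\boldsymbol v$ is the column vector indexed by the transient states whose entries are $1$ for states in $\mathcal C$ and $0$ otherwise.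
   Context: **Service times.** $\mathrm{DPH}(\boldsymbol\alpha,\boldsymbol B)$ of order $N$ is the law of the absorption time of a discrete-time Markov chain with transient phases $1,\dots,N$, initial probability row vector $\boldsymbol\alpha$ on the phases, sub-stochastic transient transition matrix $\boldsymbol B$, and absorption probability vector $\boldsymbol b=(\boldsymbol I-\boldsymbol B)\boldsymbol 1$. All phases are transient. The service times on server $S_m$ are distributed as $\mathrm{DPH}(\boldsymbol\alpha^{(m)},\boldsymbol B^{(m)})$ of order $N_m$, with $\boldsymbol b^{(m)}=(\boldsymbol I-\boldsymbol B^{(m)})\boldsymbol 1$, and all service times are independent. **System.** Time is slotted, $t=0,1,2,\dots$. Two non-preemptive servers $S_1,S_2$ send packets to a monitor; a packet generated at slot $g$ on a server immediately starts service there and is received at slot $g+T$, $T$ its service time, at which slot that server is available again. A new packet is generated at the earliest slot that is at least $k$ slots after the previous generation slot and at which at least one server is available. If exactly one server is available it is used; if both are available, $S_1$ is used under $S_1$ priority and $S_2$ under $S_2$ priority. A received packet is up to date if it was generated later than every other packet received so far (including packets received in the same slot), otherwise it is obsolete. The Age of Information $\Delta(t)$ is $t$ minus the generation slot of the most recently generated packet among those received by slot $t$. The system is assumed to have a steady state: the recurrent chain $\{W_h\}$ (defined later in this context) has a unique stationary distribution, and the limits $u_\Delta(h)$ exist (AoI process ergodic). **States of $\{Y_h\}$.** The chain starts at the generation of an arbitrary packet $P^*$. Here $i\in\{1,\dots,N_1\}$, $j\in\{1,\dots,N_2\}$ are the service phases on $S_1,S_2$ ($0$ means idle), $l\in\{0,\dots,k-1\}$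 is the freezing clock, and $\tau_1,\tau_2$ are the generation instants of the packets on $S_1,S_2$; in classes 7–14, $P^*$ has been successfully received, and $P_1,P_2$ are the packets on $S_1,S_2$ (up to date/obsolete relative to $P^*$). - $(1,i,j,l)$: $P^*$ on $S_1$, $\tau_1>\tau_2$. - $(2,i,j,l)$: $P^*$ on $S_1$, $\tau_1<\tau_2$. - $(3,i,j,l)$: $P^*$ on $S_2$, $\tau_1>\tau_2$. - $(4,i,j,l)$: $P^*$ on $S_2$, $\tau_1<\tau_2$. - $(5,i,0,l)$: $P^*$ on $S_1$, $S_2$ idle. - $(6,0,j,l)$: $P^*$ on $S_2$, $S_1$ idle. - $(7,0,0,l)$: both idle. - $(8,i,j)$: $P_1,P_2$ up to date. - $(9,i,0,l)$: $P_1$ obsolete, $S_2$ idle. - $(10,0,j,l)$: $P_2$ obsolete, $S_1$ idle. - $(11,i,j,l)$: $P_1$ up to date, $P_2$ obsolete. - $(12,i,j,l)$: $P_2$ up to date, $P_1$ obsolete. - $(13,i,0,l)$: $P_1$ up to date, $S_2$ idle. - $(14,0,j,l)$: $P_2$ up to date, $S_1$ idle. - $15$: successful absorbing state; $16$: unsuccessful absorbing state. The number of transient states is $M=k(6N_1N_2+3(N_1+N_2)+1)+N_1N_2$. **Transitions of $\{Y_h\}$.** Write $B^{(m)}_{xy},b^{(m)}_x,\alpha^{(m)}_x$ for entries. "$[<]$" means the transition applies when $l<k-1$, "$[=]$" when $l=k-1$. "To $F$ with weight $w$" means: $[<]$ to $(7,0,0,l+1)$ with probability $w$; $[=]$ under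 $S_1$ priority to $(13,i',0,0)$ with probability $w\,\alpha^{(1)}_{i'}$, under $S_2$ priority to $(14,0,j',0)$ with probability $w\,\alpha^{(2)}_{j'}$. "Stay in class $c$ with both busy" means: to $(c,i',j',\min(l+1,k-1))$ with probability $B^{(1)}_{ii'}B^{(2)}_{jj'}$. Primed indices range over all phases. Unlisted transitions have probability $0$. - From $(1,i,j,l)$: $[<]$ $(10,0,j',l+1)$: $b^{(1)}_iB^{(2)}_{jj'}$; $[=]$ $(11,i',j',0)$: $b^{(1)}_iB^{(2)}_{jj'}\alpha^{(1)}_{i'}$; to $F$ with weight $b^{(1)}_ib^{(2)}_j$; $[<]$ $(5,i',0,l+1)$: $b^{(2)}_jB^{(1)}_{ii'}$; $[=]$ $(2,i',j',0)$: $b^{(2)}_jB^{(1)}_{ii'}\alpha^{(2)}_{j'}$; stay in class 1 with both busy. - From $(2,i,j,l)$: $[<]$ $(14,0,j',l+1)$: $b^{(1)}_iB^{(2)}_{jj'}$; $[=]$ $(8,i',j')$: $b^{(1)}_iB^{(2)}_{jj'}\alpha^{(1)}_{i'}$; stay in class 2 with both busy; $16$: $b^{(2)}_j$. - From $(3,i,j,l)$: $[<]$ $(13,i',0,l+1)$: $b^{(2)}_jB^{(1)}_{ii'}$; $[=]$ $(8,i',j')$: $b^{(2)}_jB^{(1)}_{ii'}\alpha^{(2)}_{j'}$; stay in class 3 with both busy; $16$: $b^{(1)}_i$. - From $(4,i,j,l)$: $[<]$ $(6,0,j',l+1)$: $b^{(1)}_iB^{(2)}_{jj'}$; $[=]$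 $(3,i',j',0)$: $b^{(1)}_iB^{(2)}_{jj'}\alpha^{(1)}_{i'}$; to $F$ with weight $b^{(1)}_ib^{(2)}_j$; $[<]$ $(9,i',0,l+1)$: $b^{(2)}_jB^{(1)}_{ii'}$; $[=]$ $(12,i',j',0)$: $b^{(2)}_jB^{(1)}_{ii'}\alpha^{(2)}_{j'}$; stay in class 4 with both busy. - From $(5,i,0,l)$: to $F$ with weight $b^{(1)}_i$; $[<]$ $(5,i',0,l+1)$: $B^{(1)}_{ii'}$; $[=]$ $(2,i',j',0)$: $B^{(1)}_{ii'}\alpha^{(2)}_{j'}$. - From $(6,0,j,l)$: to $F$ with weight $b^{(2)}_j$; $[<]$ $(6,0,j',l+1)$: $B^{(2)}_{jj'}$; $[=]$ $(3,i',j',0)$: $B^{(2)}_{jj'}\alpha^{(1)}_{i'}$. - From $(7,0,0,l)$: to $F$ with weight $1$. - From $(8,i,j)$: $15$: $b^{(1)}_i+b^{(2)}_j-b^{(1)}_ib^{(2)}_j$; $(8,i',j')$: $B^{(1)}_{ii'}B^{(2)}_{jj'}$. - From $(9,i,0,l)$: to $F$ with weight $b^{(1)}_i$; $[<]$ $(9,i',0,l+1)$: $B^{(1)}_{ii'}$; $[=]$ $(12,i',j',0)$: $B^{(1)}_{ii'}\alpha^{(2)}_{j'}$. - From $(10,0,j,l)$: to $F$ with weight $b^{(2)}_j$; $[<]$ $(10,0,j',l+1)$: $B^{(2)}_{jj'}$; $[=]$ $(11,i',j',0)$: $B^{(2)}_{jj'}\alpha^{(1)}_{i'}$. - From $(11,i,j,l)$: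 $15$: $b^{(1)}_i$; $[<]$ $(13,i',0,l+1)$: $b^{(2)}_jB^{(1)}_{ii'}$; $[=]$ $(8,i',j')$: $b^{(2)}_jB^{(1)}_{ii'}\alpha^{(2)}_{j'}$; stay in class 11 with both busy. - From $(12,i,j,l)$: $15$: $b^{(2)}_j$; $[<]$ $(14,0,j',l+1)$: $b^{(1)}_iB^{(2)}_{jj'}$; $[=]$ $(8,i',j')$: $b^{(1)}_iB^{(2)}_{jj'}\alpha^{(1)}_{i'}$; stay in class 12 with both busy. - From $(13,i,0,l)$: $15$: $b^{(1)}_i$; $[<]$ $(13,i',0,l+1)$: $B^{(1)}_{ii'}$; $[=]$ $(8,i',j')$: $B^{(1)}_{ii'}\alpha^{(2)}_{j'}$. - From $(14,0,j,l)$: $15$: $b^{(2)}_j$; $[<]$ $(14,0,j',l+1)$: $B^{(2)}_{jj'}$; $[=]$ $(8,i',j')$: $B^{(2)}_{jj'}\alpha^{(1)}_{i'}$. - $15$ and $16$ are absorbing. $\boldsymbol A$ is the $M\times M$ matrix of transition probabilities among transient states. **Recurrent chain $\{W_h\}$.** States: $(1,0,0,l)_R$ (both idle), $(2,i,0,l)_R$ (only $S_1$ busy), $(3,0,j,l)_R$ (only $S_2$ busy), $(4,i,j,l)_R$ (both busy), with service phases $i\in\{1,\dots,N_1\}$, $j\in\{1,\dots,N_2\}$ and freezing clock $l\in\{0,\dots,k-1\}$. "To $F_R$ with weight $w$" means: $[<]$ to $(1,0,0,l+1)_R$ with probability $w$; $[=]$ under $S_1$ priority to $(2,i',0,0)_R$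 with probability $w\alpha^{(1)}_{i'}$, under $S_2$ priority to $(3,0,j',0)_R$ with probability $w\alpha^{(2)}_{j'}$. Transitions (probabilities of several listed transitions to the same state are added): - From $(1,0,0,l)_R$: to $F_R$ with weight $1$. - From $(2,i,0,l)_R$: to $F_R$ with weight $b^{(1)}_i$; $[<]$ $(2,i',0,l+1)_R$: $B^{(1)}_{ii'}$; $[=]$ $(4,i',j',0)_R$: $B^{(1)}_{ii'}\alpha^{(2)}_{j'}$. - From $(3,0,j,l)_R$: to $F_R$ with weight $b^{(2)}_j$; $[<]$ $(3,0,j',l+1)_R$: $B^{(2)}_{jj'}$; $[=]$ $(4,i',j',0)_R$: $B^{(2)}_{jj'}\alpha^{(1)}_{i'}$. - From $(4,i,j,l)_R$: $[<]$ $(3,0,j',l+1)_R$: $b^{(1)}_iB^{(2)}_{jj'}$; $[=]$ $(4,i',j',0)_R$: $b^{(1)}_iB^{(2)}_{jj'}\alpha^{(1)}_{i'}$; to $F_R$ with weight $b^{(1)}_ib^{(2)}_j$; $[<]$ $(2,i',0,l+1)_R$: $b^{(2)}_jB^{(1)}_{ii'}$; $[=]$ $(4,i',j',0)_R$: $b^{(2)}_jB^{(1)}_{ii'}\alpha^{(2)}_{j'}$; $(4,i',j',\min(l+1,k-1))_R$: $B^{(1)}_{ii'}B^{(2)}_{jj'}$. Let $p(\cdot)_R$ be its stationary probabilities. **Initial vector $\boldsymbol\sigma$.** Put $$q(1,i',j',0)=\sum_{j}B^{(2)}_{jj'}\alpha^{(1)}_{i'}p(3,0,j,k-1)_R+\sum_{i,j}b^{(1)}_iB^{(2)}_{jj'}\alpha^{(1)}_{i'}p(4,i,j,k-1)_R,$$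 $$q(4,i',j',0)=\sum_{i}B^{(1)}_{ii'}\alpha^{(2)}_{j'}p(2,i,0,k-1)_R+\sum_{i,j}b^{(2)}_jB^{(1)}_{ii'}\alpha^{(2)}_{j'}p(4,i,j,k-1)_R,$$ $$\omega=p(1,0,0,k-1)_R+\sum_i b^{(1)}_ip(2,i,0,k-1)_R+\sum_j b^{(2)}_jp(3,0,j,k-1)_R+\sum_{i,j}b^{(1)}_ib^{(2)}_jp(4,i,j,k-1)_R,$$ and, under $S_1$ priority, $q(5,i',0,0)=\alpha^{(1)}_{i'}\omega$; under $S_2$ priority, $q(6,0,j',0)=\alpha^{(2)}_{j'}\omega$. All other states have $q=0$. Then $\boldsymbol\sigma$ is $q$ divided by the sum of all its entries, and $\Pr(Y_0=s)=\boldsymbol\sigma_s$. *)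

theory Defs
  imports
    "HOL-Probability.Probability"
    "Jordan_Normal_Form.Gauss_Jordan_Elimination"
begin

unbundle no vec_syntax and no inner_syntax

definition markov_chain ::
    "'w measure \<Rightarrow> (nat \<Rightarrow> 'w \<Rightarrow> 's) \<Rightarrow> ('s \<Rightarrow> real) \<Rightarrow> ('s \<Rightarrow> 's \<Rightarrow> real) \<Rightarrow> bool" where
  "markov_chain Q X init P \<longleftrightarrow>
     prob_space Q \<and>
     (\<forall>n. X n \<in> measurable Q (count_space UNIV)) \<and>
     (\<forall>n x. measure Q {\<omega> \<in> space Q. \<forall>i\<le>n. X i \<omega> = x i} =
        init (x 0) * (\<Prod>i<n. P (x i) (x (Suc i))))"

definition stationary :: "'s set \<Rightarrow> ('s \<Rightarrow> 's \<Rightarrow> real) \<Rightarrow> ('s \<Rightarrow> real) \<Rightarrow> bool" where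
  "stationary S P p \<longleftrightarrow>
     (\<forall>s\<in>S. 0 \<le> p s) \<and> (\<Sum>s\<in>S. p s) = 1 \<and> (\<forall>s\<in>S. p s = (\<Sum>r\<in>S. p r * P r s))"

text \<open>Phases are numbered \<open>0, \<dots>, n - 1\<close> (matching matrix indices), so that phase \<open>i\<close> here is
  phase \<open>i + 1\<close> in the usual numbering \<open>1, \<dots>, n\<close>.\<close>

definition exit_vec :: "real mat \<Rightarrow> real Matrix.vec" where
  "exit_vec B = (1\<^sub>m (dim_row B) - B) *\<^sub>v Matrix.vec (dim_row B) (\<lambda>_. 1)"

text \<open>The last conjunct is transience of every phase: the expected number of visits to a phase
  by the chain started in that phase is finite.\<close>

definition DPH_rep :: "nat \<Rightarrow> real Matrix.vec \<Rightarrow> real mat \<Rightarrow> bool" where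
  "DPH_rep n \<alpha> B \<longleftrightarrow>
     \<alpha> \<in> carrier_vec n \<and> B \<in> carrier_mat n n \<and>
     (\<forall>i<n. 0 \<le> \<alpha> $ i) \<and> (\<Sum>i<n. \<alpha> $ i) = 1 \<and>
     (\<forall>i<n. \<forall>j<n. 0 \<le> B $$ (i, j)) \<and> (\<forall>i<n. (\<Sum>j<n. B $$ (i, j)) \<le> 1) \<and>
     (\<forall>i<n. summable (\<lambda>h. (B ^\<^sub>m h) $$ (i, i)))"

text \<open>The absorbing chain of a representation; \<open>None\<close> is the absorbing state.\<close>

definition dph_init :: "nat \<Rightarrow> real Matrix.vec \<Rightarrow> nat option \<Rightarrow> real" where
  "dph_init n \<alpha> x = (case x of Some i \<Rightarrow> (if i < n then \<alpha> $ i else 0) | None \<Rightarrow> 0)"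

definition dph_trans :: "nat \<Rightarrow> real mat \<Rightarrow> nat option \<Rightarrow> nat option \<Rightarrow> real" where
  "dph_trans n B x y =
     (case x of
        None \<Rightarrow> (if y = None then 1 else 0)
      | Some i \<Rightarrow>
          (if i < n
           then (case y of None \<Rightarrow> exit_vec B $ i | Some j \<Rightarrow> (if j < n then B $$ (i, j) else 0))
           else 0))"

text \<open>\<open>T\<close> has the law of the absorption time of that chain. The type chosen for the sample
  space of the chain is no restriction, since it can carry the path space.\<close>

definition DPH_distributed ::
    "'a measure \<Rightarrow> ('a \<Rightarrow> nat) \<Rightarrow> nat \<Rightarrow> real Matrix.vec \<Rightarrow> real mat \<Rightarrow> bool" where
  "DPH_distributed M T n \<alpha> B \<longleftrightarrow>
     T \<in> measurable M (count_space UNIV) \<and>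
     (\<exists>(Q :: (nat \<Rightarrow> nat option) measure) X.
        markov_chain Q X (dph_init n \<alpha>) (dph_trans n B) \<and>
        (\<forall>t. measure M {\<omega> \<in> space M. T \<omega> = t} =
             measure Q {\<omega> \<in> space Q. X t \<omega> = None \<and> (\<forall>s<t. X s \<omega> \<noteq> None)}))"

datatype server = S1 | S2

text \<open>\<open>T m n\<close> is the service time that packet \<open>n\<close> has on server \<open>m\<close>. After packet \<open>n\<close> has been
  generated, \<open>dispatch k pr T n = (g, m, f)\<close>: packet \<open>n\<close> was generated at slot \<open>g\<close> on server \<open>m\<close>,
  and \<open>f m'\<close> is the slot from which server \<open>m'\<close> is available again. The system starts empty, with
  packet \<open>0\<close> generated at slot \<open>0\<close> on the priority server \<open>pr\<close>.\<close>

primrec dispatch ::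
    "nat \<Rightarrow> server \<Rightarrow> (server \<Rightarrow> nat \<Rightarrow> nat) \<Rightarrow> nat \<Rightarrow> nat \<times> server \<times> (server \<Rightarrow> nat)" where
  "dispatch k pr T 0 = (0, pr, (\<lambda>_. 0)(pr := T pr 0))"
| "dispatch k pr T (Suc n) =
     (let (g, _, f) = dispatch k pr T n;
          g' = (LEAST t. g + k \<le> t \<and> (\<exists>m. f m \<le> t));
          m' = (if \<forall>m. f m \<le> g' then pr else if f S1 \<le> g' then S1 else S2)
      in (g', m', f(m' := g' + T m' (Suc n))))"

definition gen_slot :: "nat \<Rightarrow> server \<Rightarrow> (server \<Rightarrow> nat \<Rightarrow> nat) \<Rightarrow> nat \<Rightarrow> nat" where
  "gen_slot k pr T n = fst (dispatch k pr T n)"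

definition server_of :: "nat \<Rightarrow> server \<Rightarrow> (server \<Rightarrow> nat \<Rightarrow> nat) \<Rightarrow> nat \<Rightarrow> server" where
  "server_of k pr T n = fst (snd (dispatch k pr T n))"

definition reception_slot :: "nat \<Rightarrow> server \<Rightarrow> (server \<Rightarrow> nat \<Rightarrow> nat) \<Rightarrow> nat \<Rightarrow> nat" where
  "reception_slot k pr T n = gen_slot k pr T n + T (server_of k pr T n) n"

text \<open>The age of information at slot \<open>t\<close>; \<open>None\<close> as long as nothing has been received.\<close>

definition AoI :: "nat \<Rightarrow> server \<Rightarrow> (server \<Rightarrow> nat \<Rightarrow> nat) \<Rightarrow> nat \<Rightarrow> nat option" where
  "AoI k pr T t =
     (let R = {n. reception_slot k pr T n \<le> t}
      in if R = {} then None else Some (t - Max (gen_slot k pr T ` R)))"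

text \<open>State \<open>Y\<^sub>c\<close> is class \<open>c\<close> with the entries that are fixed to \<open>0\<close> (idle server) dropped;
  the remaining arguments are the service phases on the busy servers, then the freezing clock.
  Likewise for \<open>W\<close>.\<close>

datatype ystate =
    Y1 nat nat nat | Y2 nat nat nat | Y3 nat nat nat | Y4 nat nat nat
  | Y5 nat nat | Y6 nat nat | Y7 nat | Y8 nat nat | Y9 nat nat | Y10 nat nat
  | Y11 nat nat nat | Y12 nat nat nat | Y13 nat nat | Y14 nat nat | Y15 | Y16

datatype wstate = W1 nat | W2 nat nat | W3 nat nat | W4 nat nat nat

text \<open>Rows of transition matrices are given as lists of (target, probability) pairs, in which a
  target may occur more than once.\<close>

definition entry :: "('s \<times> real) list \<Rightarrow> 's \<Rightarrow> real" where
  "entry xs s = (\<Sum>(t, w)\<leftarrow>xs. if t = s then w else 0)"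

fun non_P_star :: "ystate \<Rightarrow> bool" where
  "non_P_star (Y7 l) = True"
| "non_P_star (Y8 i j) = True"
| "non_P_star (Y9 i l) = True"
| "non_P_star (Y10 j l) = True"
| "non_P_star (Y11 i j l) = True"
| "non_P_star (Y12 i j l) = True"
| "non_P_star (Y13 i l) = True"
| "non_P_star (Y14 j l) = True"
| "non_P_star _ = False"

lemma distinct_concat_map:
  assumes "distinct xs"
    and "\<And>x. x \<in> set xs \<Longrightarrow> distinct (f x)"
    and "\<And>x y. x \<in> set xs \<Longrightarrow> y \<in> set xs \<Longrightarrow> x \<noteq> y \<Longrightarrow> set (f x) \<inter> set (f y) = {}"
  shows "distinct (concat (map f xs))"
  using assms by (induction xs) auto

context
  fixes N :: "server \<Rightarrow> nat"
    and \<alpha> :: "server \<Rightarrow> real Matrix.vec"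
    and B :: "server \<Rightarrow> real mat"
    and k :: nat
    and pr :: server
begin

private abbreviation (input) "ph1 \<equiv> [0..<N S1]"
private abbreviation (input) "ph2 \<equiv> [0..<N S2]"
private abbreviation (input) "a1 i \<equiv> \<alpha> S1 $ i"
private abbreviation (input) "a2 j \<equiv> \<alpha> S2 $ j"
private abbreviation (input) "B1 i i' \<equiv> B S1 $$ (i, i')"
private abbreviation (input) "B2 j j' \<equiv> B S2 $$ (j, j')"
private abbreviation (input) "b1 i \<equiv> exit_vec (B S1) $ i"
private abbreviation (input) "b2 j \<equiv> exit_vec (B S2) $ j"

definition frozen :: "nat \<Rightarrow> 'b list \<Rightarrow> 'b list" where
  "frozen l xs = (if l < k - 1 then xs else [])"

definition unfrozen :: "nat \<Rightarrow> 'b list \<Rightarrow> 'b list" where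
  "unfrozen l xs = (if l = k - 1 then xs else [])"

definition Y_to_F :: "nat \<Rightarrow> real \<Rightarrow> (ystate \<times> real) list" where
  "Y_to_F l w =
     frozen l [(Y7 (l + 1), w)] @
     unfrozen l
       (case pr of
          S1 \<Rightarrow> [(Y13 i' 0, w * a1 i'). i' \<leftarrow> ph1]
        | S2 \<Rightarrow> [(Y14 j' 0, w * a2 j'). j' \<leftarrow> ph2])"

definition Y_stay :: "(nat \<Rightarrow> nat \<Rightarrow> nat \<Rightarrow> ystate) \<Rightarrow> nat \<Rightarrow> nat \<Rightarrow> nat \<Rightarrow> (ystate \<times> real) list" where
  "Y_stay c i j l =
     [(c i' j' (min (l + 1) (k - 1)), B1 i i' * B2 j j'). i' \<leftarrow> ph1, j' \<leftarrow> ph2]"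

fun Y_row :: "ystate \<Rightarrow> (ystate \<times> real) list" where
  "Y_row (Y1 i j l) =
     frozen l [(Y10 j' (l + 1), b1 i * B2 j j'). j' \<leftarrow> ph2] @
     unfrozen l [(Y11 i' j' 0, b1 i * B2 j j' * a1 i'). i' \<leftarrow> ph1, j' \<leftarrow> ph2] @
     Y_to_F l (b1 i * b2 j) @
     frozen l [(Y5 i' (l + 1), b2 j * B1 i i'). i' \<leftarrow> ph1] @
     unfrozen l [(Y2 i' j' 0, b2 j * B1 i i' * a2 j'). i' \<leftarrow> ph1, j' \<leftarrow> ph2] @
     Y_stay Y1 i j l"
| "Y_row (Y2 i j l) =
     frozen l [(Y14 j' (l + 1), b1 i * B2 j j'). j' \<leftarrow> ph2] @
     unfrozen l [(Y8 i' j', b1 i * B2 j j' * a1 i'). i' \<leftarrow> ph1, j' \<leftarrow> ph2] @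
     Y_stay Y2 i j l @
     [(Y16, b2 j)]"
| "Y_row (Y3 i j l) =
     frozen l [(Y13 i' (l + 1), b2 j * B1 i i'). i' \<leftarrow> ph1] @
     unfrozen l [(Y8 i' j', b2 j * B1 i i' * a2 j'). i' \<leftarrow> ph1, j' \<leftarrow> ph2] @
     Y_stay Y3 i j l @
     [(Y16, b1 i)]"
| "Y_row (Y4 i j l) =
     frozen l [(Y6 j' (l + 1), b1 i * B2 j j'). j' \<leftarrow> ph2] @
     unfrozen l [(Y3 i' j' 0, b1 i * B2 j j' * a1 i'). i' \<leftarrow> ph1, j' \<leftarrow> ph2] @
     Y_to_F l (b1 i * b2 j) @
     frozen l [(Y9 i' (l + 1), b2 j * B1 i i'). i' \<leftarrow> ph1] @
     unfrozen l [(Y12 i' j' 0, b2 j * B1 i i' * a2 j'). i' \<leftarrow> ph1, j' \<leftarrow> ph2] @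
     Y_stay Y4 i j l"
| "Y_row (Y5 i l) =
     Y_to_F l (b1 i) @
     frozen l [(Y5 i' (l + 1), B1 i i'). i' \<leftarrow> ph1] @
     unfrozen l [(Y2 i' j' 0, B1 i i' * a2 j'). i' \<leftarrow> ph1, j' \<leftarrow> ph2]"
| "Y_row (Y6 j l) =
     Y_to_F l (b2 j) @
     frozen l [(Y6 j' (l + 1), B2 j j'). j' \<leftarrow> ph2] @
     unfrozen l [(Y3 i' j' 0, B2 j j' * a1 i'). i' \<leftarrow> ph1, j' \<leftarrow> ph2]"
| "Y_row (Y7 l) = Y_to_F l 1"
| "Y_row (Y8 i j) =
     [(Y15, b1 i + b2 j - b1 i * b2 j)] @
     [(Y8 i' j', B1 i i' * B2 j j'). i' \<leftarrow> ph1, j' \<leftarrow> ph2]"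
| "Y_row (Y9 i l) =
     Y_to_F l (b1 i) @
     frozen l [(Y9 i' (l + 1), B1 i i'). i' \<leftarrow> ph1] @
     unfrozen l [(Y12 i' j' 0, B1 i i' * a2 j'). i' \<leftarrow> ph1, j' \<leftarrow> ph2]"
| "Y_row (Y10 j l) =
     Y_to_F l (b2 j) @
     frozen l [(Y10 j' (l + 1), B2 j j'). j' \<leftarrow> ph2] @
     unfrozen l [(Y11 i' j' 0, B2 j j' * a1 i'). i' \<leftarrow> ph1, j' \<leftarrow> ph2]"
| "Y_row (Y11 i j l) =
     [(Y15, b1 i)] @
     frozen l [(Y13 i' (l + 1), b2 j * B1 i i'). i' \<leftarrow> ph1] @
     unfrozen l [(Y8 i' j', b2 j * B1 i i' * a2 j'). i' \<leftarrow> ph1, j' \<leftarrow> ph2] @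
     Y_stay Y11 i j l"
| "Y_row (Y12 i j l) =
     [(Y15, b2 j)] @
     frozen l [(Y14 j' (l + 1), b1 i * B2 j j'). j' \<leftarrow> ph2] @
     unfrozen l [(Y8 i' j', b1 i * B2 j j' * a1 i'). i' \<leftarrow> ph1, j' \<leftarrow> ph2] @
     Y_stay Y12 i j l"
| "Y_row (Y13 i l) =
     [(Y15, b1 i)] @
     frozen l [(Y13 i' (l + 1), B1 i i'). i' \<leftarrow> ph1] @
     unfrozen l [(Y8 i' j', B1 i i' * a2 j'). i' \<leftarrow> ph1, j' \<leftarrow> ph2]"
| "Y_row (Y14 j l) =
     [(Y15, b2 j)] @
     frozen l [(Y14 j' (l + 1), B2 j j'). j' \<leftarrow> ph2] @
     unfrozen l [(Y8 i' j', B2 j j' * a1 i'). i' \<leftarrow> ph1, j' \<leftarrow> ph2]"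
| "Y_row Y15 = [(Y15, 1)]"
| "Y_row Y16 = [(Y16, 1)]"

definition Y_trans :: "ystate \<Rightarrow> ystate \<Rightarrow> real" where
  "Y_trans s s' = entry (Y_row s) s'"

definition Y_transient :: "ystate list" where
  "Y_transient =
     [Y1 i j l. i \<leftarrow> ph1, j \<leftarrow> ph2, l \<leftarrow> [0..<k]] @
     [Y2 i j l. i \<leftarrow> ph1, j \<leftarrow> ph2, l \<leftarrow> [0..<k]] @
     [Y3 i j l. i \<leftarrow> ph1, j \<leftarrow> ph2, l \<leftarrow> [0..<k]] @
     [Y4 i j l. i \<leftarrow> ph1, j \<leftarrow> ph2, l \<leftarrow> [0..<k]] @
     [Y5 i l. i \<leftarrow> ph1, l \<leftarrow> [0..<k]] @
     [Y6 j l. j \<leftarrow> ph2, l \<leftarrow> [0..<k]] @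
     [Y7 l. l \<leftarrow> [0..<k]] @
     [Y8 i j. i \<leftarrow> ph1, j \<leftarrow> ph2] @
     [Y9 i l. i \<leftarrow> ph1, l \<leftarrow> [0..<k]] @
     [Y10 j l. j \<leftarrow> ph2, l \<leftarrow> [0..<k]] @
     [Y11 i j l. i \<leftarrow> ph1, j \<leftarrow> ph2, l \<leftarrow> [0..<k]] @
     [Y12 i j l. i \<leftarrow> ph1, j \<leftarrow> ph2, l \<leftarrow> [0..<k]] @
     [Y13 i l. i \<leftarrow> ph1, l \<leftarrow> [0..<k]] @
     [Y14 j l. j \<leftarrow> ph2, l \<leftarrow> [0..<k]]"

definition Y_C :: "ystate set" where
  "Y_C = {s \<in> set Y_transient. non_P_star s}"

definition num_transient :: nat where
  "num_transient = k * (6 * N S1 * N S2 + 3 * (N S1 + N S2) + 1) + N S1 * N S2"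

text \<open>The list \<open>Y_transient\<close> fixes the order of rows and columns.\<close>

definition A_mat :: "real mat" where
  "A_mat = Matrix.mat num_transient num_transient
     (\<lambda>(r, c). Y_trans (Y_transient ! r) (Y_transient ! c))"

definition v_vec :: "real Matrix.vec" where
  "v_vec = Matrix.vec num_transient (\<lambda>r. if Y_transient ! r \<in> Y_C then 1 else 0)"

definition W_to_F :: "nat \<Rightarrow> real \<Rightarrow> (wstate \<times> real) list" where
  "W_to_F l w =
     frozen l [(W1 (l + 1), w)] @
     unfrozen l
       (case pr of
          S1 \<Rightarrow> [(W2 i' 0, w * a1 i'). i' \<leftarrow> ph1]
        | S2 \<Rightarrow> [(W3 j' 0, w * a2 j'). j' \<leftarrow> ph2])"

fun W_row :: "wstate \<Rightarrow> (wstate \<times> real) list" where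
  "W_row (W1 l) = W_to_F l 1"
| "W_row (W2 i l) =
     W_to_F l (b1 i) @
     frozen l [(W2 i' (l + 1), B1 i i'). i' \<leftarrow> ph1] @
     unfrozen l [(W4 i' j' 0, B1 i i' * a2 j'). i' \<leftarrow> ph1, j' \<leftarrow> ph2]"
| "W_row (W3 j l) =
     W_to_F l (b2 j) @
     frozen l [(W3 j' (l + 1), B2 j j'). j' \<leftarrow> ph2] @
     unfrozen l [(W4 i' j' 0, B2 j j' * a1 i'). i' \<leftarrow> ph1, j' \<leftarrow> ph2]"
| "W_row (W4 i j l) =
     frozen l [(W3 j' (l + 1), b1 i * B2 j j'). j' \<leftarrow> ph2] @
     unfrozen l [(W4 i' j' 0, b1 i * B2 j j' * a1 i'). i' \<leftarrow> ph1, j' \<leftarrow> ph2] @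
     W_to_F l (b1 i * b2 j) @
     frozen l [(W2 i' (l + 1), b2 j * B1 i i'). i' \<leftarrow> ph1] @
     unfrozen l [(W4 i' j' 0, b2 j * B1 i i' * a2 j'). i' \<leftarrow> ph1, j' \<leftarrow> ph2] @
     [(W4 i' j' (min (l + 1) (k - 1)), B1 i i' * B2 j j'). i' \<leftarrow> ph1, j' \<leftarrow> ph2]"

definition W_trans :: "wstate \<Rightarrow> wstate \<Rightarrow> real" where
  "W_trans s s' = entry (W_row s) s'"

definition W_states :: "wstate set" where
  "W_states =
     {W1 l | l. l < k} \<union>
     {W2 i l | i l. i < N S1 \<and> l < k} \<union>
     {W3 j l | j l. j < N S2 \<and> l < k} \<union>
     {W4 i j l | i j l. i < N S1 \<and> j < N S2 \<and> l < k}"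

definition omega :: "(wstate \<Rightarrow> real) \<Rightarrow> real" where
  "omega p =
     p (W1 (k - 1)) +
     (\<Sum>i<N S1. b1 i * p (W2 i (k - 1))) +
     (\<Sum>j<N S2. b2 j * p (W3 j (k - 1))) +
     (\<Sum>i<N S1. \<Sum>j<N S2. b1 i * b2 j * p (W4 i j (k - 1)))"

fun q_init :: "(wstate \<Rightarrow> real) \<Rightarrow> ystate \<Rightarrow> real" where
  "q_init p (Y1 i' j' l) =
     (if l = 0
      then (\<Sum>j<N S2. B2 j j' * a1 i' * p (W3 j (k - 1))) +
           (\<Sum>i<N S1. \<Sum>j<N S2. b1 i * B2 j j' * a1 i' * p (W4 i j (k - 1)))
      else 0)"
| "q_init p (Y4 i' j' l) =
     (if l = 0
      then (\<Sum>i<N S1. B1 i i' * a2 j' * p (W2 i (k - 1))) +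
           (\<Sum>i<N S1. \<Sum>j<N S2. b2 j * B1 i i' * a2 j' * p (W4 i j (k - 1)))
      else 0)"
| "q_init p (Y5 i' l) = (if pr = S1 \<and> l = 0 then a1 i' * omega p else 0)"
| "q_init p (Y6 j' l) = (if pr = S2 \<and> l = 0 then a2 j' * omega p else 0)"
| "q_init p _ = 0"

definition Y_init :: "(wstate \<Rightarrow> real) \<Rightarrow> ystate \<Rightarrow> real" where
  "Y_init p s =
     (if s \<in> set Y_transient then q_init p s / (\<Sum>r\<in>set Y_transient. q_init p r) else 0)"

definition sigma_vec :: "(wstate \<Rightarrow> real) \<Rightarrow> real Matrix.vec" where
  "sigma_vec p = Matrix.vec num_transient (\<lambda>r. Y_init p (Y_transient ! r))"

lemma length_Y_transient: "length Y_transient = num_transient"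
  by (simp add: Y_transient_def num_transient_def length_concat comp_def sum_list_triv
      algebra_simps)

lemma distinct_Y_transient: "distinct Y_transient"
  unfolding Y_transient_def by (auto simp: distinct_map intro!: distinct_concat_map inj_onI)

end

end

theory Submission
  imports Defs "Jordan_Normal_Form.Determinant"
begin

text \<open>Fix a slot \<open>g\<close> and call a packet old, starred or new if it is generated before, at or after
  \<open>g\<close>. The age at slot \<open>g + h\<close> is \<open>h\<close> iff the starred packet exists and has been received while no
  new packet has. Keeping track of the residual service times on the two servers turns this into a
  deterministic system that consumes one fresh service time per generated packet. Replacing
  residual times by phases is an intertwining of Markov kernels, so the probability of age \<open>h\<close> at
  slot \<open>g + h\<close> is a linear functional \<open>q (\<nu> g) A^h v\<close> of the law \<open>\<nu> g\<close> of the recurrent chain.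
  Averages of \<open>\<nu>\<close> over long windows accumulate only at stationary vectors, which identifies the
  limit \<open>u h\<close> as \<open>q p A^h v\<close> although \<open>\<nu>\<close> itself need not converge. A Lyapunov function makes
  \<open>A^h v\<close> summable, hence \<open>I - A\<close> invertible, and dominated convergence shows that \<open>u\<close> sums to
  \<open>1\<close>, which is the normalisation.\<close>

text \<open>The sample space carries service times but no phases, so a path of the system cannot be
  matched with a path of the phase chain; only laws can be compared, and this is why the detour over
  residual times and an intertwining is taken. A second obstacle is that \<open>dispatch\<close> is
  indexed by packets and the chains by slots. Tags relative to one fixed slot \<open>g\<close> turn
  the packet recursion into a finite-control machine that moves slot by slot. A third one is that
  uniqueness of the stationary law does not exclude periodicity, so the hypothesis controls only
  certain linear functionals of the law of the recurrent chain. The constant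
  \<open>\<kappa>\<^sub>1\<close> is the sum of all entries of \<open>q\<close>, the stationary
  probability that a slot sees a generation. It is never computed: \<open>u\<close> sums to 1 and
  \<open>u 0 = 0\<close>, so the total weight of the terms with h at least 1 fixes it, and the
  denominator of the explicit formula is its reciprocal. The domination in h is uniform in t because
  it bounds all occupation probabilities by 1; no mass can escape to large ages.\<close>

section \<open>Cylinder probabilities of Markov chains on finite closed sets\<close>

primrec cylinder_weight :: "('s \<Rightarrow> 's \<Rightarrow> real) \<Rightarrow> 's set \<Rightarrow> nat \<Rightarrow> (nat \<Rightarrow> 's set) \<Rightarrow> 's \<Rightarrow> real" where
  "cylinder_weight P S 0 V x = indicator (V 0) x"
| "cylinder_weight P S (Suc j) V x =
     indicator (V 0) x * (\<Sum>y\<in>S. P x y * cylinder_weight P S j (\<lambda>i. V (Suc i)) y)"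

text \<open>Markov property after a fixed prefix, with \<open>cylinder_weight\<close> as the
  conditional probability of the future. The prefix and its length stay general in the induction,
  since a step forward lengthens the prefix by one state. Countability of the state type makes
  leaving \<open>S\<close> a countable union of null events.\<close>

lemma markov_chain_cylinder_from:
  fixes X :: "nat \<Rightarrow> 'w \<Rightarrow> 's :: countable"
  assumes mc: "markov_chain Q X init P" and fin: "finite S"
    and closed: "\<And>x y. x \<in> S \<Longrightarrow> y \<notin> S \<Longrightarrow> P x y = 0"
    and x: "x n \<in> S"
  shows "measure Q {\<omega> \<in> space Q. (\<forall>i\<le>n. X i \<omega> = x i) \<and> (\<forall>i\<le>j. X (n + i) \<omega> \<in> V i)} =
    measure Q {\<omega> \<in> space Q. \<forall>i\<le>n. X i \<omega> = x i} * cylinder_weight P S j V (x n)"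
  using x
proof (induction j arbitrary: n x V)
  case 0
  show ?case
  proof (cases "x n \<in> V 0")
    case True
    then have "{\<omega> \<in> space Q. (\<forall>i\<le>n. X i \<omega> = x i) \<and> (\<forall>i\<le>0. X (n + i) \<omega> \<in> V i)} =
      {\<omega> \<in> space Q. \<forall>i\<le>n. X i \<omega> = x i}" by auto
    then show ?thesis using True by simp
  next
    case False
    then have "{\<omega> \<in> space Q. (\<forall>i\<le>n. X i \<omega> = x i) \<and> (\<forall>i\<le>0. X (n + i) \<omega> \<in> V i)} = {}" by auto
    then show ?thesis using False by (simp only: measure_empty) simp
  qed
next
  case (Suc j)
  interpret prob_space Q using mc by (simp add: markov_chain_def)
  have [measurable]: "\<And>n. X n \<in> measurable Q (count_space UNIV)"
    using mc by (simp add: markov_chain_def)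
  let ?A = "{\<omega> \<in> space Q. \<forall>i\<le>n. X i \<omega> = x i}"
  have path: "prob {\<omega> \<in> space Q. \<forall>i\<le>n. X i \<omega> = x i} = init (x 0) * (\<Prod>i<n. P (x i) (x (Suc i)))" for n x
    using mc by (simp add: markov_chain_def)
  have step: "prob {\<omega> \<in> space Q. \<forall>i\<le>Suc n. X i \<omega> = (x(Suc n := y)) i} = prob ?A * P (x n) y" for y
    unfolding path by simp
  show ?case
  proof (cases "x n \<in> V 0")
    case False
    then have "{\<omega> \<in> space Q. (\<forall>i\<le>n. X i \<omega> = x i) \<and> (\<forall>i\<le>Suc j. X (n + i) \<omega> \<in> V i)} = {}" by auto
    then show ?thesis using False by (simp only: measure_empty) simp
  next
    case True
    let ?E = "\<lambda>y. {\<omega> \<in> space Q. (\<forall>i\<le>Suc n. X i \<omega> = (x(Suc n := y)) i) \<and>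
      (\<forall>i\<le>j. X (Suc n + i) \<omega> \<in> V (Suc i))}"
    let ?B = "{\<omega> \<in> space Q. (\<forall>i\<le>n. X i \<omega> = x i) \<and> (\<forall>i\<le>Suc j. X (n + i) \<omega> \<in> V i)}"
    let ?N = "{\<omega> \<in> ?A. X (Suc n) \<omega> \<notin> S}"
    have null: "prob ?N = 0"
    proof -
      have "?N = (\<Union>y\<in>-S. {\<omega> \<in> space Q. \<forall>i\<le>Suc n. X i \<omega> = (x(Suc n := y)) i})"
        by (auto simp: le_Suc_eq)
      moreover have "(\<Union>y\<in>-S. {\<omega> \<in> space Q. \<forall>i\<le>Suc n. X i \<omega> = (x(Suc n := y)) i}) \<in> null_sets Q"
      proof (rule null_sets_UN')
        show "countable (- S)" by simp
        fix y assume "y \<in> - S"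
        then have "prob {\<omega> \<in> space Q. \<forall>i\<le>Suc n. X i \<omega> = (x(Suc n := y)) i} = 0"
          unfolding step using closed[OF Suc.prems] by simp
        then show "{\<omega> \<in> space Q. \<forall>i\<le>Suc n. X i \<omega> = (x(Suc n := y)) i} \<in> null_sets Q"
          by (intro null_setsI) (auto simp: emeasure_eq_measure simp del: fun_upd_apply)
      qed
      ultimately show ?thesis by (simp add: null_sets_def measure_def)
    qed
    \<comment> \<open>Split by the state at time \<open>Suc n\<close>. All paths that leave
      \<open>S\<close> are collected in the null event \<open>?N\<close>, so a finite disjoint union
      remains.\<close>
    have "?B = (\<Union>y\<in>S. ?E y) \<union> (?B \<inter> ?N)"
    proof (intro equalityI subsetI)
      fix \<omega> assume w: "\<omega> \<in> ?B"
      then have "X (Suc n + i) \<omega> \<in> V (Suc i)" if "i \<le> j" for i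
        using that by (auto dest!: spec[of _ "Suc i"])
      then show "\<omega> \<in> (\<Union>y\<in>S. ?E y) \<union> (?B \<inter> ?N)"
        using w by (cases "X (Suc n) \<omega> \<in> S") (auto simp: le_Suc_eq)
    next
      fix \<omega> assume "\<omega> \<in> (\<Union>y\<in>S. ?E y) \<union> (?B \<inter> ?N)"
      then consider (a) y where "\<omega> \<in> ?E y" | (b) "\<omega> \<in> ?B" by blast
      then show "\<omega> \<in> ?B"
      proof cases
        case a
        have eq: "X i \<omega> = x i" if "i \<le> n" for i using a that by (auto split: if_splits)
        moreover have "X (n + i) \<omega> \<in> V i" if "i \<le> Suc j" for i
          using a that eq[of n] True by (cases i) auto
        ultimately show ?thesis using a by auto
      qed
    qed
    then have "prob ?B = prob ((\<Union>y\<in>S. ?E y) \<union> (?B \<inter> ?N))" by simp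
    also have "\<dots> = prob (\<Union>y\<in>S. ?E y)"
    proof (rule antisym)
      have "prob (?B \<inter> ?N) \<le> prob ?N" by (rule finite_measure_mono) auto
      then have "prob (?B \<inter> ?N) = 0" using null by (simp add: measure_le_0_iff)
      then show "prob ((\<Union>y\<in>S. ?E y) \<union> (?B \<inter> ?N)) \<le> prob (\<Union>y\<in>S. ?E y)"
        using fin by (intro order.trans[OF measure_Un_le]) (auto intro!: sets.finite_UN)
    qed (use fin in \<open>auto intro!: finite_measure_mono sets.finite_UN\<close>)
    also have "\<dots> = (\<Sum>y\<in>S. prob (?E y))"
      using fin by (intro finite_measure_finite_Union) (auto simp: disjoint_family_on_def)
    also have "\<dots> = (\<Sum>y\<in>S. prob ?A * P (x n) y * cylinder_weight P S j (\<lambda>i. V (Suc i)) y)"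
    proof (intro sum.cong refl)
      fix y assume "y \<in> S"
      then have "prob (?E y) = prob {\<omega> \<in> space Q. \<forall>i\<le>Suc n. X i \<omega> = (x(Suc n := y)) i} *
        cylinder_weight P S j (\<lambda>i. V (Suc i)) ((x(Suc n := y)) (Suc n))"
        by (intro Suc.IH) simp
      then show "prob (?E y) = prob ?A * P (x n) y * cylinder_weight P S j (\<lambda>i. V (Suc i)) y"
        by (simp only: step) simp
    qed
    finally show ?thesis using True by (simp add: sum_distrib_left mult.assoc)
  qed
qed

lemma markov_chain_cylinder:
  fixes X :: "nat \<Rightarrow> 'w \<Rightarrow> 's :: countable"
  assumes mc: "markov_chain Q X init P" and fin: "finite S"
    and closed: "\<And>x y. x \<in> S \<Longrightarrow> y \<notin> S \<Longrightarrow> P x y = 0"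
    and init: "\<And>x. x \<notin> S \<Longrightarrow> init x = 0"
  shows "measure Q {\<omega> \<in> space Q. \<forall>i\<le>j. X i \<omega> \<in> V i} = (\<Sum>x\<in>S. init x * cylinder_weight P S j V x)"
proof -
  interpret prob_space Q using mc by (simp add: markov_chain_def)
  have [measurable]: "\<And>n. X n \<in> measurable Q (count_space UNIV)"
    using mc by (simp add: markov_chain_def)
  have start: "prob {\<omega> \<in> space Q. X 0 \<omega> = x} = init x" for x
    using mc[unfolded markov_chain_def, THEN conjunct2, THEN conjunct2, rule_format, of 0 "\<lambda>_. x"] by simp
  let ?E = "\<lambda>x. {\<omega> \<in> space Q. X 0 \<omega> = x \<and> (\<forall>i\<le>j. X i \<omega> \<in> V i)}"
  let ?B = "{\<omega> \<in> space Q. \<forall>i\<le>j. X i \<omega> \<in> V i}"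
  have "(\<Union>x\<in>-S. {\<omega> \<in> space Q. X 0 \<omega> = x}) \<in> null_sets Q"
    by (rule null_sets_UN') (auto simp: null_sets_def emeasure_eq_measure start init)
  then have ae: "AE \<omega> in Q. X 0 \<omega> \<in> S" by (rule AE_I') auto
  have "prob ?B = prob (\<Union>x\<in>S. ?E x)"
    using ae fin by (intro finite_measure_eq_AE) (auto intro!: sets.finite_UN)
  also have "\<dots> = (\<Sum>x\<in>S. prob (?E x))"
    using fin by (intro finite_measure_finite_Union) (auto simp: disjoint_family_on_def)
  also have "\<dots> = (\<Sum>x\<in>S. init x * cylinder_weight P S j V x)"
  proof (intro sum.cong refl)
    fix x assume "x \<in> S"
    then show "prob (?E x) = init x * cylinder_weight P S j V x"
      using markov_chain_cylinder_from[OF mc fin closed, of "\<lambda>_. x" 0 j V] by (simp add: start)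
  qed
  finally show ?thesis .
qed

subsection \<open>Discrete phase-type distributions\<close>

lemma exit_vec_eq:
  assumes "B \<in> carrier_mat n n" "i < n"
  shows "exit_vec B $ i = 1 - (\<Sum>j<n. B $$ (i, j))"
proof -
  have "exit_vec B $ i = (\<Sum>j = 0..<n. (if i = j then 1 else 0) - B $$ (i, j))"
    using assms unfolding exit_vec_def by (auto simp: scalar_prod_def intro!: sum.cong)
  also have "\<dots> = 1 - (\<Sum>j<n. B $$ (i, j))"
    using assms(2) by (simp add: sum_subtractf atLeast0LessThan)
  finally show ?thesis .
qed

locale DPH =
  fixes n :: nat and \<alpha> :: "real Matrix.vec" and B :: "real mat"
  assumes rep: "DPH_rep n \<alpha> B"
begin

lemma carrier: "B \<in> carrier_mat n n" and init_nonneg: "i < n \<Longrightarrow> 0 \<le> \<alpha> $ i"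
  and sum_init: "(\<Sum>i<n. \<alpha> $ i) = 1"
  and B_nonneg: "i < n \<Longrightarrow> j < n \<Longrightarrow> 0 \<le> B $$ (i, j)"
  and B_row_le: "i < n \<Longrightarrow> (\<Sum>j<n. B $$ (i, j)) \<le> 1"
  and summable_visits: "i < n \<Longrightarrow> summable (\<lambda>h. (B ^\<^sub>m h) $$ (i, i))"
  using rep by (auto simp: DPH_rep_def)

lemma exit_eq: "i < n \<Longrightarrow> exit_vec B $ i = 1 - (\<Sum>j<n. B $$ (i, j))"
  by (rule exit_vec_eq[OF carrier])

lemma exit_nonneg: "i < n \<Longrightarrow> 0 \<le> exit_vec B $ i"
  using exit_eq B_row_le by simp

text \<open>\<open>rlaw r i\<close> is the probability of absorption in exactly \<open>r + 1\<close> steps from phase \<open>i\<close>, and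
  \<open>surv h i\<close> that of no absorption within \<open>h\<close> steps.\<close>

primrec rlaw :: "nat \<Rightarrow> nat \<Rightarrow> real" where
  "rlaw 0 i = exit_vec B $ i"
| "rlaw (Suc r) i = (\<Sum>j<n. B $$ (i, j) * rlaw r j)"

primrec surv :: "nat \<Rightarrow> nat \<Rightarrow> real" where
  "surv 0 i = 1"
| "surv (Suc h) i = (\<Sum>j<n. B $$ (i, j) * surv h j)"

lemma rlaw_nonneg: "i < n \<Longrightarrow> 0 \<le> rlaw r i"
  by (induction r arbitrary: i) (auto intro!: sum_nonneg mult_nonneg_nonneg B_nonneg exit_nonneg)

lemma surv_nonneg: "i < n \<Longrightarrow> 0 \<le> surv h i"
  by (induction h arbitrary: i) (auto intro!: sum_nonneg mult_nonneg_nonneg B_nonneg)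

lemma rlaw_eq_surv: "i < n \<Longrightarrow> rlaw r i = surv r i - surv (Suc r) i"
proof (induction r arbitrary: i)
  case (Suc r)
  have "rlaw (Suc r) i = (\<Sum>j<n. B $$ (i, j) * (surv r j - surv (Suc r) j))"
    by (simp only: rlaw.simps) (intro sum.cong refl, simp add: Suc.IH del: surv.simps)
  also have "\<dots> = surv (Suc r) i - surv (Suc (Suc r)) i"
    by (simp add: right_diff_distrib sum_subtractf)
  finally show ?case .
qed (simp add: exit_eq)

lemma pow_Suc_entry:
  assumes "i < n" "j < n"
  shows "(B ^\<^sub>m Suc h) $$ (i, j) = (\<Sum>l<n. B $$ (i, l) * (B ^\<^sub>m h) $$ (l, j))"
proof -
  have "B ^\<^sub>m Suc h = B * B ^\<^sub>m h"
    by (induction h) (use carrier in \<open>simp_all add: assoc_mult_mat[of _ n n _ n _ n]\<close>)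
  then show ?thesis
    using assms carrier by (simp add: scalar_prod_def atLeast0LessThan pow_carrier_mat)
qed

lemma pow_nonneg: "i < n \<Longrightarrow> j < n \<Longrightarrow> 0 \<le> (B ^\<^sub>m h) $$ (i, j)"
proof (induction h arbitrary: i)
  case 0
  then show ?case using carrier by simp
next
  case (Suc h)
  then show ?case
    by (subst pow_Suc_entry) (auto intro!: sum_nonneg mult_nonneg_nonneg B_nonneg)
qed

lemma surv_eq_pow: "i < n \<Longrightarrow> surv h i = (\<Sum>j<n. (B ^\<^sub>m h) $$ (i, j))"
proof (induction h arbitrary: i)
  case 0
  have "(\<Sum>j<n. (B ^\<^sub>m 0) $$ (i, j)) = (\<Sum>j<n. if i = j then 1 else 0)"
    using 0 carrier by (intro sum.cong) auto
  then show ?case using 0 by simp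
next
  case (Suc h)
  have "surv (Suc h) i = (\<Sum>l<n. \<Sum>j<n. B $$ (i, l) * (B ^\<^sub>m h) $$ (l, j))"
    using Suc by (simp add: sum_distrib_left)
  also have "\<dots> = (\<Sum>j<n. (B ^\<^sub>m Suc h) $$ (i, j))"
    by (subst sum.swap, intro sum.cong refl) (use Suc.prems in \<open>simp add: pow_Suc_entry del: pow_mat.simps\<close>)
  finally show ?case .
qed

text \<open>A phase must be reached before it can be revisited, so starting elsewhere never
  increases the expected number of visits. This extends the summability hypothesis, which concerns
  only diagonal entries, to all entries and hence to \<open>surv\<close>.\<close>

lemma visits_le_diagonal:
  assumes "i < n" "j < n"
  shows "(\<Sum>h<m. (B ^\<^sub>m h) $$ (i, j)) \<le> (\<Sum>h<m. (B ^\<^sub>m h) $$ (j, j))"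
  using assms(1)
proof (induction m arbitrary: i)
  case (Suc m)
  show ?case
  proof (cases "i = j")
    case False
    have "(\<Sum>h<Suc m. (B ^\<^sub>m h) $$ (i, j)) = (\<Sum>h<m. (B ^\<^sub>m Suc h) $$ (i, j))"
      using False Suc.prems assms(2) carrier by (subst sum.lessThan_Suc_shift) simp
    also have "\<dots> = (\<Sum>l<n. B $$ (i, l) * (\<Sum>h<m. (B ^\<^sub>m h) $$ (l, j)))"
      using Suc.prems assms(2)
      by (simp add: pow_Suc_entry sum_distrib_left del: pow_mat.simps) (rule sum.swap)
    also have "\<dots> \<le> (\<Sum>l<n. B $$ (i, l) * (\<Sum>h<m. (B ^\<^sub>m h) $$ (j, j)))"
      using Suc by (intro sum_mono mult_left_mono Suc.IH B_nonneg) auto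
    also have "\<dots> = (\<Sum>l<n. B $$ (i, l)) * (\<Sum>h<m. (B ^\<^sub>m h) $$ (j, j))"
      by (simp add: sum_distrib_right)
    also have "\<dots> \<le> 1 * (\<Sum>h<m. (B ^\<^sub>m h) $$ (j, j))"
      using Suc.prems assms(2) by (intro mult_right_mono B_row_le sum_nonneg pow_nonneg)
    also have "\<dots> \<le> (\<Sum>h<Suc m. (B ^\<^sub>m h) $$ (j, j))"
      using assms(2) pow_nonneg by simp
    finally show ?thesis .
  qed simp
qed simp

lemma summable_surv:
  assumes "i < n"
  shows "summable (\<lambda>h. surv h i)"
proof -
  have "summable (\<lambda>h. (B ^\<^sub>m h) $$ (i, j))" if j: "j < n" for j
  proof (rule summableI_nonneg_bounded[where x = "\<Sum>h. (B ^\<^sub>m h) $$ (j, j)"])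
    fix m
    have "(\<Sum>h<m. (B ^\<^sub>m h) $$ (i, j)) \<le> (\<Sum>h<m. (B ^\<^sub>m h) $$ (j, j))"
      using assms j by (rule visits_le_diagonal)
    also have "\<dots> \<le> (\<Sum>h. (B ^\<^sub>m h) $$ (j, j))"
      using j by (intro sum_le_suminf summable_visits pow_nonneg) auto
    finally show "(\<Sum>h<m. (B ^\<^sub>m h) $$ (i, j)) \<le> (\<Sum>h. (B ^\<^sub>m h) $$ (j, j))" .
  qed (use assms j pow_nonneg in auto)
  then have "summable (\<lambda>h. \<Sum>j<n. (B ^\<^sub>m h) $$ (i, j))"
    by (intro summable_sum) auto
  then show ?thesis using assms by (simp add: surv_eq_pow)
qed

text \<open>Mean time to absorption, by the tail sum formula.\<close>

definition mean_residual :: "nat \<Rightarrow> real" where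
  "mean_residual i = (\<Sum>h. surv h i)"

text \<open>First-step analysis: one transition shifts the tail sum by one index, and the lost term
  \<open>surv 0 i\<close> is 1.\<close>

lemma mean_residual_step:
  assumes "i < n"
  shows "(\<Sum>j<n. B $$ (i, j) * mean_residual j) = mean_residual i - 1"
proof -
  have "(\<Sum>j<n. B $$ (i, j) * mean_residual j) = (\<Sum>j<n. \<Sum>h. B $$ (i, j) * surv h j)"
    unfolding mean_residual_def by (intro sum.cong refl suminf_mult[symmetric]) (auto intro: summable_surv)
  also have "\<dots> = (\<Sum>h. \<Sum>j<n. B $$ (i, j) * surv h j)"
    by (rule suminf_sum[symmetric]) (auto intro!: summable_mult summable_surv)
  also have "\<dots> = (\<Sum>h. surv (Suc h) i)" by simp
  also have "\<dots> = mean_residual i - 1"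
    unfolding mean_residual_def using suminf_split_head[OF summable_surv[OF assms]] by simp
  finally show ?thesis .
qed

lemma mean_residual_ge_1:
  assumes "i < n"
  shows "1 \<le> mean_residual i"
proof -
  have "(\<Sum>h<1. surv h i) \<le> mean_residual i"
    unfolding mean_residual_def using assms
    by (intro sum_le_suminf summable_surv surv_nonneg) auto
  then show ?thesis by simp
qed

text \<open>The masses telescope, and the survival probabilities tend to 0 because they are
  summable: absorption is almost sure.\<close>

lemma rlaw_sums: "i < n \<Longrightarrow> (\<lambda>r. rlaw r i) sums 1"
  using telescope_sums'[OF summable_LIMSEQ_zero[OF summable_surv]]
  by (simp add: rlaw_eq_surv del: surv.simps(2))

subsection \<open>Phases and residual service times as probability mass functions\<close>

lemma finite_pmf_ex:
  fixes w :: "'x \<Rightarrow> real"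
  assumes "finite S" "\<And>x. x \<in> S \<Longrightarrow> 0 \<le> w x" "\<And>x. x \<notin> S \<Longrightarrow> w x = 0" "sum w S = 1"
  shows "\<exists>q. \<forall>x. pmf q x = w x"
proof -
  have nonneg: "0 \<le> w x" for x using assms by (cases "x \<in> S") auto
  have "(\<integral>\<^sup>+x. ennreal (w x) \<partial>count_space UNIV) = (\<Sum>x\<in>S. ennreal (w x))"
    using assms by (intro nn_integral_count_space') auto
  also have "\<dots> = 1" using assms by (simp add: sum_ennreal)
  finally show ?thesis using pmf_embed_pmf[of w] nonneg by blast
qed

definition fresh_phase :: "nat pmf" where
  "fresh_phase = (SOME q. \<forall>i. pmf q i = (if i < n then \<alpha> $ i else 0))"

text \<open>The value outside the phase range is matched with that of \<open>residual\<close>, so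
  that \<open>residual_unfold\<close> holds for every index without a side condition.\<close>

definition next_phase :: "nat \<Rightarrow> nat option pmf" where
  "next_phase i = (if i < n then SOME q. \<forall>y. pmf q y = dph_trans n B (Some i) y else return_pmf None)"

definition residual :: "nat \<Rightarrow> nat pmf" where
  "residual i = (if i < n then SOME q. \<forall>r. pmf q r = (case r of 0 \<Rightarrow> 0 | Suc r' \<Rightarrow> rlaw r' i)
     else return_pmf 1)"

definition service :: "nat pmf" where
  "service = bind_pmf fresh_phase residual"

lemma pmf_fresh_phase: "pmf fresh_phase i = (if i < n then \<alpha> $ i else 0)"
proof -
  have "\<exists>q. \<forall>i. pmf q i = (if i < n then \<alpha> $ i else 0)"
    by (rule finite_pmf_ex[where S = "{..<n}"]) (auto simp: init_nonneg sum_init)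
  from someI_ex[OF this] show ?thesis unfolding fresh_phase_def by simp
qed

lemma sum_option: "(\<Sum>y\<in>insert None (Some ` {..<n}). f y) = f None + (\<Sum>j<n. f (Some j) :: real)"
  by (subst sum.insert) (auto simp: sum.reindex)

lemma pmf_next_phase: "i < n \<Longrightarrow> pmf (next_phase i) y = dph_trans n B (Some i) y"
proof -
  assume i: "i < n"
  have "\<exists>q. \<forall>y. pmf q y = dph_trans n B (Some i) y"
  proof (rule finite_pmf_ex[where S = "insert None (Some ` {..<n})"])
    show "sum (dph_trans n B (Some i)) (insert None (Some ` {..<n})) = 1"
      unfolding sum_option using i by (simp add: dph_trans_def exit_eq)
    show "dph_trans n B (Some i) y = 0" if "y \<notin> insert None (Some ` {..<n})" for y
      using that i by (cases y) (auto simp: dph_trans_def)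
    show "0 \<le> dph_trans n B (Some i) y" for y
      using i by (auto simp: dph_trans_def B_nonneg exit_nonneg split: option.splits)
  qed simp
  from someI_ex[OF this] show ?thesis unfolding next_phase_def using i by simp
qed

lemma pmf_residual: "i < n \<Longrightarrow> pmf (residual i) r = (case r of 0 \<Rightarrow> 0 | Suc r' \<Rightarrow> rlaw r' i)"
proof -
  assume i: "i < n"
  let ?w = "\<lambda>r. (case r of 0 \<Rightarrow> 0 | Suc r' \<Rightarrow> rlaw r' i)"
  have nonneg: "0 \<le> ?w r" for r using i by (auto simp: rlaw_nonneg split: nat.splits)
  have "?w sums 1" using sums_Suc[of ?w 1] rlaw_sums[OF i] by simp
  then have "(\<integral>\<^sup>+r. ennreal (?w r) \<partial>count_space UNIV) = 1"
    using nonneg by (simp add: nn_integral_count_space_nat suminf_ennreal2 sums_iff)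
  then have "\<exists>q. \<forall>r. pmf q r = ?w r" using pmf_embed_pmf[of ?w] nonneg by blast
  from someI_ex[OF this] show ?thesis unfolding residual_def using i by simp
qed

lemma set_fresh_phase: "set_pmf fresh_phase \<subseteq> {..<n}"
  by (auto simp: set_pmf_eq pmf_fresh_phase split: if_splits)

lemma set_next_phase: "set_pmf (next_phase i) \<subseteq> insert None (Some ` {..<n})"
proof (cases "i < n")
  case True
  have "y \<in> insert None (Some ` {..<n})" if "y \<in> set_pmf (next_phase i)" for y
    using that True
    by (cases y) (auto simp: set_pmf_eq pmf_next_phase dph_trans_def split: if_splits)
  then show ?thesis by blast
qed (simp add: next_phase_def)

lemma finite_fresh_phase [simp]: "finite (set_pmf fresh_phase)"
  using set_fresh_phase finite_subset by blast

lemma finite_next_phase [simp]: "finite (set_pmf (next_phase i))"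
  by (rule finite_subset[OF set_next_phase]) simp

lemma expectation_fresh_phase:
  "measure_pmf.expectation fresh_phase f = (\<Sum>i<n. \<alpha> $ i * f i :: real)"
  by (subst integral_measure_pmf[where A = "{..<n}"])
     (use set_fresh_phase in \<open>auto simp: pmf_fresh_phase\<close>)

lemma expectation_next_phase:
  "i < n \<Longrightarrow> measure_pmf.expectation (next_phase i) f =
     exit_vec B $ i * f None + (\<Sum>j<n. B $$ (i, j) * f (Some j) :: real)"
  by (subst integral_measure_pmf[where A = "insert None (Some ` {..<n})"])
     (use set_next_phase in \<open>auto simp: sum_option pmf_next_phase dph_trans_def\<close>)

text \<open>First-step analysis on the level of laws; the intertwining of phases and residual times
  rests on this recursion.\<close>

lemma residual_unfold:
  "residual i = bind_pmf (next_phase i)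
     (\<lambda>y. case y of None \<Rightarrow> return_pmf 1 | Some j \<Rightarrow> map_pmf Suc (residual j))"
proof (cases "i < n")
  case True
  have zero: "pmf (map_pmf Suc q) 0 = 0" for q :: "nat pmf"
    by (simp add: pmf_eq_0_set_pmf)
  have Suc: "pmf (map_pmf Suc q) (Suc r) = pmf q r" for q r
    by (rule pmf_map_inj') simp
  show ?thesis
  proof (rule pmf_eqI)
    fix r
    show "pmf (residual i) r = pmf (bind_pmf (next_phase i)
      (\<lambda>y. case y of None \<Rightarrow> return_pmf 1 | Some j \<Rightarrow> map_pmf Suc (residual j))) r"
      using True unfolding pmf_bind expectation_next_phase[OF True]
      by (cases r; cases "r - 1") (simp_all add: pmf_residual zero Suc)
  qed
qed (simp add: residual_def next_phase_def bind_return_pmf)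

lemma pmf_service: "pmf service r = (case r of 0 \<Rightarrow> 0 | Suc r' \<Rightarrow> (\<Sum>i<n. \<alpha> $ i * rlaw r' i))"
  unfolding service_def pmf_bind expectation_fresh_phase by (cases r) (simp_all add: pmf_residual)

text \<open>The definition realises the law on some unspecified path space; a cylinder computation
  replaces it by the concrete \<open>service\<close>.\<close>

lemma DPH_distributed_prob:
  assumes "DPH_distributed M T n \<alpha> B"
  shows "measure M {\<omega> \<in> space M. T \<omega> = t} = pmf service t"
proof -
  obtain Q X where mc: "markov_chain (Q :: (nat \<Rightarrow> nat option) measure) X (dph_init n \<alpha>) (dph_trans n B)"
    and law: "\<And>t. measure M {\<omega> \<in> space M. T \<omega> = t} =
      measure Q {\<omega> \<in> space Q. X t \<omega> = None \<and> (\<forall>s<t. X s \<omega> \<noteq> None)}"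
    using assms unfolding DPH_distributed_def by blast
  let ?S = "insert None (Some ` {..<n})"
  \<comment> \<open>Absorption exactly at time \<open>t\<close> is a cylinder event with these
    sides. Dropping the first coordinate lowers the target time by one, which is what drives the
    induction for \<open>weight\<close>.\<close>
  let ?V = "\<lambda>t i. if i = t then {None} else UNIV - {None :: nat option}"
  have V_shift: "(\<lambda>i. ?V (Suc t) (Suc i)) = ?V t" for t by auto
  have weight: "cylinder_weight (dph_trans n B) ?S (Suc t) (?V (Suc t)) (Some i) = rlaw t i"
    if "i < n" for t i
    using that
  proof (induction t arbitrary: i)
    case 0
    then show ?case unfolding cylinder_weight.simps V_shift sum_option by (simp add: dph_trans_def)
  next
    case (Suc t)
    have "cylinder_weight (dph_trans n B) ?S (Suc (Suc t)) (?V (Suc (Suc t))) (Some i) =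
      (\<Sum>y\<in>?S. dph_trans n B (Some i) y * cylinder_weight (dph_trans n B) ?S (Suc t) (?V (Suc t)) y)"
      by (subst cylinder_weight.simps(2), subst V_shift) simp
    also have "\<dots> = (\<Sum>j<n. B $$ (i, j) * rlaw t j)"
      proof -
      have "cylinder_weight (dph_trans n B) ?S (Suc t) (?V (Suc t)) None = 0" by simp
      moreover have "dph_trans n B (Some i) (Some j) = B $$ (i, j)" if "j < n" for j
        using that Suc.prems by (simp add: dph_trans_def)
      ultimately show ?thesis
        unfolding sum_option using Suc.IH by (simp del: cylinder_weight.simps(2))
    qed
    finally show ?case by simp
  qed
  have "measure M {\<omega> \<in> space M. T \<omega> = t} = measure Q {\<omega> \<in> space Q. \<forall>i\<le>t. X i \<omega> \<in> ?V t i}"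
    unfolding law by (intro arg_cong[where f = "measure Q"]) (auto simp: le_less)
  also have "\<dots> = (\<Sum>x\<in>?S. dph_init n \<alpha> x * cylinder_weight (dph_trans n B) ?S t (?V t) x)"
    by (rule markov_chain_cylinder[OF mc])
       (auto simp: dph_trans_def dph_init_def split: option.splits)
  also have "\<dots> = pmf service t"
    unfolding sum_option by (cases t) (simp_all add: dph_init_def weight pmf_service del: cylinder_weight.simps(2))
  finally show ?thesis .
qed

end

subsection \<open>The tagged two-server system\<close>

text \<open>A tag records whether a packet was generated before, at or after the reference slot. \<open>Dead\<close>
  means that no packet was generated at the reference slot or that a newer one has been received;
  it stands for both absorbing states. The type variable is instantiated both with phases and with
  residual service times.\<close>

datatype tag = Old | Star | New

type_synonym 'x slot = "(tag \<times> 'x) option"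

datatype 'x sys = Sys "'x slot" "'x slot" nat | Dead

text \<open>Separates the decision to generate from the draw of the new service time, so that one
  \<open>settle\<close> serves the deterministic \<open>exec\<close>, the law of residual times and
  the phase chain.\<close>

datatype 'x action = Go "'x sys" | Gen server "'x \<Rightarrow> 'x sys"

instance tag :: countable by countable_datatype
instance sys :: (countable) countable by countable_datatype

text \<open>A packet newer than the starred one has been received. The two contents may have
  different types because \<open>settle_scatter\<close> compares phases before the slot with
  residual times after it.\<close>

definition lost :: "'y slot \<Rightarrow> 'x slot \<Rightarrow> bool" where
  "lost s s' \<longleftrightarrow> (\<exists>x. s = Some (New, x)) \<and> s' = None"

definition both_new :: "'x slot \<Rightarrow> 'x slot \<Rightarrow> bool" where
  "both_new s1 s2 \<longleftrightarrow> (\<exists>x. s1 = Some (New, x)) \<and> (\<exists>x. s2 = Some (New, x))"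

definition target :: "server \<Rightarrow> 'x slot \<Rightarrow> 'x slot \<Rightarrow> server" where
  "target pr s1 s2 = (if s1 = None \<and> s2 = None then pr else if s1 = None then S1 else S2)"

definition put :: "tag \<Rightarrow> server \<Rightarrow> 'x slot \<Rightarrow> 'x slot \<Rightarrow> 'x \<Rightarrow> 'x sys" where
  "put c m s1 s2 x = (case m of S1 \<Rightarrow> Sys (Some (c, x)) s2 0 | S2 \<Rightarrow> Sys s1 (Some (c, x)) 0)"

text \<open>The clock stops while both packets are new: class 8 has no clock component.\<close>

definition settle ::
    "nat \<Rightarrow> server \<Rightarrow> tag \<Rightarrow> 'y slot \<Rightarrow> 'y slot \<Rightarrow> 'x slot \<Rightarrow> 'x slot \<Rightarrow> nat \<Rightarrow> 'x action" where
  "settle k pr c s1 s2 s1' s2' l =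
     (if lost s1 s1' \<or> lost s2 s2' then Go Dead
      else if l < k - 1 \<or> (s1' \<noteq> None \<and> s2' \<noteq> None)
      then Go (if c = Star then Dead
               else Sys s1' s2' (if both_new s1' s2' then l else min (l + 1) (k - 1)))
      else Gen (target pr s1' s2') (put c (target pr s1' s2') s1' s2'))"

primrec perform :: "(server \<Rightarrow> 'x pmf) \<Rightarrow> 'x action \<Rightarrow> 'x sys pmf" where
  "perform fr (Go z) = return_pmf z"
| "perform fr (Gen m f) = map_pmf f (fr m)"

definition tick :: "nat slot \<Rightarrow> nat slot" where
  "tick s = (case s of None \<Rightarrow> None | Some (c, r) \<Rightarrow> if r \<le> 1 then None else Some (c, r - 1))"

primrec residual_action :: "nat \<Rightarrow> server \<Rightarrow> tag \<Rightarrow> nat sys \<Rightarrow> nat action" where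
  "residual_action k pr c Dead = Go Dead"
| "residual_action k pr c (Sys s1 s2 l) = settle k pr c s1 s2 (tick s1) (tick s2) l"

primrec exec :: "'x action \<Rightarrow> (server \<Rightarrow> nat \<Rightarrow> 'x) \<Rightarrow> nat \<Rightarrow> 'x sys \<times> nat" where
  "exec (Go z) T n = (z, n)"
| "exec (Gen m f) T n = (f (T m n), Suc n)"

text \<open>The initial state is that of a fictitious slot \<open>-1\<close>, so \<open>Suc t\<close> steps lead to slot \<open>t\<close>. The
  second component counts the generated packets and is the index of the next service time.\<close>

primrec run :: "nat \<Rightarrow> server \<Rightarrow> (nat \<Rightarrow> tag) \<Rightarrow> (server \<Rightarrow> nat \<Rightarrow> nat) \<Rightarrow> nat \<Rightarrow> nat sys \<times> nat" where
  "run k pr c T 0 = (Sys None None (k - 1), 0)"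
| "run k pr c T (Suc j) =
     exec (residual_action k pr (c j) (fst (run k pr c T j))) T (snd (run k pr c T j))"

primrec residual_law ::
    "nat \<Rightarrow> server \<Rightarrow> (server \<Rightarrow> nat pmf) \<Rightarrow> (nat \<Rightarrow> tag) \<Rightarrow> nat \<Rightarrow> nat sys pmf" where
  "residual_law k pr fr c 0 = return_pmf (Sys None None (k - 1))"
| "residual_law k pr fr c (Suc j) =
     bind_pmf (residual_law k pr fr c j) (\<lambda>z. perform fr (residual_action k pr (c j) z))"

lemma snd_exec_mono: "n \<le> snd (exec a T n)"
  by (cases a) auto

text \<open>The run reads only service times whose index lies below its packet counter. This is what
  makes the next service time independent of the past.\<close>

lemma run_cong:
  assumes "\<And>m i. i < snd (run k pr c T j) \<Longrightarrow> T m i = T' m i"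
  shows "run k pr c T' j = run k pr c T j"
  using assms
proof (induction j)
  case (Suc j)
  let ?a = "residual_action k pr (c j) (fst (run k pr c T j))"
  let ?n = "snd (run k pr c T j)"
  have "run k pr c T' j = run k pr c T j"
    using Suc.prems snd_exec_mono[of ?n ?a T] by (intro Suc.IH) (auto intro: less_le_trans)
  moreover have "exec ?a T' ?n = exec ?a T ?n"
    using Suc.prems by (cases ?a) auto
  ultimately show ?case by simp
qed simp

section \<open>Law of the residual system under independent service times\<close>

lemma UNIV_server: "(UNIV :: server set) = {S1, S2}"
  using server.exhaust by auto

text \<open>Stands in for conditioning on a discrete random variable.\<close>

lemma nn_integral_eq_on_fibres:
  fixes X :: "'a \<Rightarrow> 'b :: countable"
  assumes [measurable]: "X \<in> measurable M (count_space UNIV)"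
    "f \<in> borel_measurable M" "g \<in> borel_measurable M"
    and eq: "\<And>x. (\<integral>\<^sup>+\<omega>. f \<omega> * indicator {x} (X \<omega>) \<partial>M) = (\<integral>\<^sup>+\<omega>. g \<omega> * indicator {x} (X \<omega>) \<partial>M)"
  shows "(\<integral>\<^sup>+\<omega>. f \<omega> \<partial>M) = (\<integral>\<^sup>+\<omega>. g \<omega> \<partial>M)"
proof -
  have split: "(\<integral>\<^sup>+\<omega>. h \<omega> \<partial>M) =
      (\<integral>\<^sup>+x. \<integral>\<^sup>+\<omega>. h \<omega> * indicator {x} (X \<omega>) \<partial>M \<partial>count_space UNIV)"
    if [measurable]: "h \<in> borel_measurable M" for h :: "'a \<Rightarrow> ennreal"
  proof -
    have "(\<integral>\<^sup>+\<omega>. h \<omega> \<partial>M) = (\<integral>\<^sup>+\<omega>. \<integral>\<^sup>+x. h \<omega> * indicator {x} (X \<omega>) \<partial>count_space UNIV \<partial>M)"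
    proof (rule nn_integral_cong)
      fix \<omega>
      have "(\<integral>\<^sup>+x. h \<omega> * indicator {x} (X \<omega>) \<partial>count_space UNIV) =
        (\<integral>\<^sup>+x. h \<omega> * indicator {X \<omega>} x \<partial>count_space UNIV)"
        by (intro nn_integral_cong) (auto simp: indicator_def)
      then show "h \<omega> = (\<integral>\<^sup>+x. h \<omega> * indicator {x} (X \<omega>) \<partial>count_space UNIV)"
        by (simp add: nn_integral_cmult)
    qed
    also have "\<dots> = (\<integral>\<^sup>+x. \<integral>\<^sup>+\<omega>. h \<omega> * indicator {x} (X \<omega>) \<partial>M \<partial>count_space UNIV)"
      by (rule nn_integral_count_space_nn_integral) auto
    finally show ?thesis .
  qed
  show ?thesis by (subst (1 2) split) (simp_all only: assms eq)
qed

lemma nn_integral_indicator_comp: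
  assumes "{\<omega> \<in> space M. X \<omega> \<in> A} \<in> sets M"
  shows "(\<integral>\<^sup>+\<omega>. indicator A (X \<omega>) \<partial>M) = emeasure M {\<omega> \<in> space M. X \<omega> \<in> A}"
proof -
  have "(\<integral>\<^sup>+\<omega>. indicator A (X \<omega>) \<partial>M) = (\<integral>\<^sup>+\<omega>. indicator {\<omega> \<in> space M. X \<omega> \<in> A} \<omega> \<partial>M)"
    by (intro nn_integral_cong) (simp add: indicator_def)
  then show ?thesis using assms by simp
qed

locale service_family = prob_space M for M :: "'a measure" +
  fixes T :: "server \<Rightarrow> nat \<Rightarrow> 'a \<Rightarrow> nat" and fr :: "server \<Rightarrow> nat pmf"
    and k :: nat and pr :: server
  assumes indep: "indep_vars (\<lambda>_. count_space UNIV) (\<lambda>(m, n). T m n) UNIV"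
    and law: "\<And>m n t. prob {\<omega> \<in> space M. T m n \<omega> = t} = pmf (fr m) t"
begin

lemma T_measurable [measurable]: "T m n \<in> measurable M (count_space UNIV)"
  using indep by (auto simp: indep_vars_def)

lemma run_measurable [measurable]:
  "(\<lambda>\<omega>. run k pr c (\<lambda>m n. T m n \<omega>) j) \<in> measurable M (count_space UNIV)"
proof (induction j)
  case (Suc j)
  have exec: "(\<lambda>\<omega>. exec a (\<lambda>m n. T m n \<omega>) n) \<in> measurable M (count_space UNIV)" for a n
  proof (cases a)
    case (Gen m h)
    have "(\<lambda>\<omega>. (h (T m n \<omega>), Suc n)) \<in> measurable M (count_space UNIV)"
      by (rule measurable_compose[OF T_measurable, of "\<lambda>r. (h r, Suc n)" "count_space UNIV"]) simp
    then show ?thesis by (simp add: Gen)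
  qed simp
  have "(\<lambda>\<omega>. exec (residual_action k pr (c j) (fst (run k pr c (\<lambda>m n. T m n \<omega>) j)))
      (\<lambda>m n. T m n \<omega>) (snd (run k pr c (\<lambda>m n. T m n \<omega>) j))) \<in> measurable M (count_space UNIV)"
    by (rule measurable_compose_countable[where g = "\<lambda>\<omega>. run k pr c (\<lambda>m n. T m n \<omega>) j"
          and f = "\<lambda>x \<omega>. exec (residual_action k pr (c j) (fst x)) (\<lambda>m n. T m n \<omega>) (snd x)",
          OF exec Suc])
  then show ?case by simp
qed simp

lemma run_sets [measurable]: "{\<omega> \<in> space M. run k pr c (\<lambda>m n. T m n \<omega>) j \<in> A} \<in> sets M"
  using measurable_sets[OF run_measurable, of A c j] by (simp add: vimage_def Int_def conj_commute)

lemma nn_integral_indicator_run: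
  "(\<integral>\<^sup>+\<omega>. indicator {x} (run k pr c (\<lambda>m n. T m n \<omega>) j) \<partial>M) =
   emeasure M {\<omega> \<in> space M. run k pr c (\<lambda>m n. T m n \<omega>) j = x}"
  using nn_integral_indicator_comp[OF run_sets[of c j "{x}"]] by simp

lemma nn_integral_service:
  "(\<integral>\<^sup>+\<omega>. f (T m n \<omega>) \<partial>M) = (\<integral>\<^sup>+r. f r \<partial>fr m)"
proof -
  have "distr M (count_space UNIV) (T m n) = measure_pmf (fr m)"
  proof (rule measure_eqI_countable[where A = UNIV])
    fix r :: nat
    show "emeasure (distr M (count_space UNIV) (T m n)) {r} = emeasure (measure_pmf (fr m)) {r}"
      using law[of m n r]
      by (simp add: emeasure_distr emeasure_pmf_single emeasure_eq_measure vimage_def Int_def conj_commute)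
  qed auto
  then have "(\<integral>\<^sup>+r. f r \<partial>fr m) = (\<integral>\<^sup>+r. f r \<partial>distr M (count_space UNIV) (T m n))" by simp
  then show ?thesis by (simp add: nn_integral_distr)
qed

text \<open>On the event that the counter is \<open>n\<close>, the run is a function of service
  times with index below \<open>n\<close>, and these are independent of the one with index
  \<open>n\<close>.\<close>

lemma nn_integral_fresh_times_past:
  "(\<integral>\<^sup>+\<omega>. f (T m n \<omega>) * indicator {(z, n)} (run k pr c (\<lambda>m n. T m n \<omega>) j) \<partial>M) =
   (\<integral>\<^sup>+r. f r \<partial>fr m) * emeasure M {\<omega> \<in> space M. run k pr c (\<lambda>m n. T m n \<omega>) j = (z, n)}"
proof -
  \<comment> \<open>This index set is finite, so the product space over it is discrete and every
    function of the past is measurable.\<close>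
  define J where "J = {x :: server \<times> nat. snd x < n}"
  have J: "finite J"
  proof (rule finite_subset)
    show "J \<subseteq> UNIV \<times> {..<n}" by (auto simp: J_def)
    show "finite ((UNIV :: server set) \<times> {..<n})" by (simp add: UNIV_server)
  qed
  define past where "past = (\<lambda>\<omega>. restrict (\<lambda>i. (\<lambda>(m, n). T m n) i \<omega>) J)"
  define fresh where "fresh = (\<lambda>\<omega>. restrict (\<lambda>i. (\<lambda>(m, n). T m n) i \<omega>) {(m, n)})"
  have Pi_count: "PiM I (\<lambda>_. count_space (UNIV :: nat set)) = count_space (PiE I (\<lambda>_. UNIV))"
    if "finite I" for I :: "(server \<times> nat) set"
    using that by (intro count_space_PiM_finite) auto
  have "indep_var (PiM J (\<lambda>_. count_space UNIV)) past (PiM {(m, n)} (\<lambda>_. count_space UNIV)) fresh"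
    unfolding past_def fresh_def by (rule indep_var_restrict[OF indep]) (auto simp: J_def)
  then have iv: "indep_var borel ((\<lambda>u. indicator {(z, n)} (run k pr c (curry u) j) :: ennreal) \<circ> past)
      borel ((\<lambda>u. f (u (m, n))) \<circ> fresh)"
    by (rule indep_var_compose) (use J in \<open>auto simp: Pi_count\<close>)
  \<comment> \<open>On either event the counter is \<open>n\<close>, so the arbitrary values that
    \<open>restrict\<close> leaves outside \<open>J\<close> are never read. Each direction applies
    \<open>run_cong\<close> to the run whose counter is already known.\<close>
  have past_run: "run k pr c (curry (past \<omega>)) j = (z, n) \<longleftrightarrow> run k pr c (\<lambda>m n. T m n \<omega>) j = (z, n)" for \<omega>
  proof -
    have eq: "curry (past \<omega>) m' i = T m' i \<omega>" if "i < n" for m' i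
      using that by (simp add: past_def J_def)
    show ?thesis
    proof
      assume r: "run k pr c (curry (past \<omega>)) j = (z, n)"
      then have "run k pr c (\<lambda>m n. T m n \<omega>) j = run k pr c (curry (past \<omega>)) j"
        by (intro run_cong eq) simp
      then show "run k pr c (\<lambda>m n. T m n \<omega>) j = (z, n)" using r by simp
    next
      assume r: "run k pr c (\<lambda>m n. T m n \<omega>) j = (z, n)"
      then have "run k pr c (curry (past \<omega>)) j = run k pr c (\<lambda>m n. T m n \<omega>) j"
        by (intro run_cong eq[symmetric]) simp
      then show "run k pr c (curry (past \<omega>)) j = (z, n)" using r by simp
    qed
  qed
  let ?F = "case_bool ((\<lambda>u. indicator {(z, n)} (run k pr c (curry u) j) :: ennreal) \<circ> past)
    ((\<lambda>u. f (u (m, n))) \<circ> fresh)"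
  have "case_bool borel borel = (\<lambda>_. borel :: ennreal measure)" by (auto split: bool.splits)
  then have "indep_vars (\<lambda>_. borel) ?F UNIV" using iv unfolding indep_var_def by simp
  then have "(\<integral>\<^sup>+\<omega>. (\<Prod>b\<in>UNIV. ?F b \<omega>) \<partial>M) = (\<Prod>b\<in>UNIV. \<integral>\<^sup>+\<omega>. ?F b \<omega> \<partial>M)"
    by (intro indep_vars_nn_integral) simp_all
  moreover have "(\<Prod>b\<in>UNIV. ?F b \<omega>) =
      f (fresh \<omega> (m, n)) * indicator {(z, n)} (run k pr c (curry (past \<omega>)) j)" for \<omega>
    unfolding UNIV_bool by (simp add: mult.commute)
  moreover have "(\<Prod>b\<in>UNIV. \<integral>\<^sup>+\<omega>. ?F b \<omega> \<partial>M) = (\<integral>\<^sup>+\<omega>. f (fresh \<omega> (m, n)) \<partial>M) *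
      (\<integral>\<^sup>+\<omega>. indicator {(z, n)} (run k pr c (curry (past \<omega>)) j) \<partial>M)"
    unfolding UNIV_bool comp_def by (simp add: mult.commute)
  moreover have "indicator {(z, n)} (run k pr c (curry (past \<omega>)) j) =
      (indicator {(z, n)} (run k pr c (\<lambda>m n. T m n \<omega>) j) :: ennreal)" for \<omega>
    using past_run[of \<omega>] by (simp add: indicator_def)
  moreover have "fresh \<omega> (m, n) = T m n \<omega>" for \<omega> by (simp add: fresh_def)
  ultimately show ?thesis by (simp only: nn_integral_service[of f m n] nn_integral_indicator_run)
qed

text \<open>The index of the next service time is itself random. Splitting along the fibres of the
  run fixes it, so that independence can be applied to a deterministic index.\<close>

lemma nn_integral_run:
  "(\<integral>\<^sup>+\<omega>. f (fst (run k pr c (\<lambda>m n. T m n \<omega>) j)) \<partial>M) = (\<integral>\<^sup>+z. f z \<partial>residual_law k pr fr c j)"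
proof (induction j arbitrary: f)
  case 0
  show ?case by (simp add: emeasure_space_1)
next
  case (Suc j)
  let ?run = "\<lambda>\<omega>. run k pr c (\<lambda>m n. T m n \<omega>) j"
  let ?act = "residual_action k pr (c j)"
  let ?g = "\<lambda>z. \<integral>\<^sup>+z'. f z' \<partial>perform fr (?act z)"
  have "(\<integral>\<^sup>+\<omega>. f (fst (run k pr c (\<lambda>m n. T m n \<omega>) (Suc j))) \<partial>M) = (\<integral>\<^sup>+\<omega>. ?g (fst (?run \<omega>)) \<partial>M)"
  proof (rule nn_integral_eq_on_fibres[where X = ?run])
    fix x :: "nat sys \<times> nat"
    obtain z n where x: "x = (z, n)" by (cases x)
    have "(\<integral>\<^sup>+\<omega>. f (fst (run k pr c (\<lambda>m n. T m n \<omega>) (Suc j))) * indicator {x} (?run \<omega>) \<partial>M) =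
      (\<integral>\<^sup>+\<omega>. f (fst (exec (?act z) (\<lambda>m n. T m n \<omega>) n)) * indicator {(z, n)} (?run \<omega>) \<partial>M)"
    proof (rule nn_integral_cong)
      fix \<omega>
      show "f (fst (run k pr c (\<lambda>m n. T m n \<omega>) (Suc j))) * indicator {x} (?run \<omega>) =
        f (fst (exec (?act z) (\<lambda>m n. T m n \<omega>) n)) * indicator {(z, n)} (?run \<omega>)"
        by (cases "?run \<omega> = (z, n)") (simp_all add: x)
    qed
    also have "\<dots> = ?g z * emeasure M {\<omega> \<in> space M. ?run \<omega> = (z, n)}"
    proof (cases "?act z")
      case (Go z')
      have "(\<lambda>\<omega>. indicator {(z, n)} (?run \<omega>) :: ennreal) \<in> borel_measurable M"
        by (rule measurable_compose[OF run_measurable, of "indicator {(z, n)}" borel c j]) simp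
      then show ?thesis
        by (simp only: Go exec.simps fst_conv perform.simps nn_integral_cmult nn_integral_indicator_run)
          simp
    next
      case (Gen m h)
      show ?thesis
        using nn_integral_fresh_times_past[of "\<lambda>r. f (h r)" m n z c j]
        by (simp only: Gen exec.simps fst_conv perform.simps nn_integral_map_pmf)
    qed
    also have "\<dots> = (\<integral>\<^sup>+\<omega>. ?g z * indicator {\<omega> \<in> space M. ?run \<omega> = (z, n)} \<omega> \<partial>M)"
      using run_sets[of c j "{(z, n)}"] by (simp only: singleton_iff nn_integral_cmult_indicator)
    also have "\<dots> = (\<integral>\<^sup>+\<omega>. ?g (fst (?run \<omega>)) * indicator {x} (?run \<omega>) \<partial>M)"
    proof (rule nn_integral_cong)
      fix \<omega> assume "\<omega> \<in> space M"
      then show "?g z * indicator {\<omega> \<in> space M. ?run \<omega> = (z, n)} \<omega> = ?g (fst (?run \<omega>)) * indicator {x} (?run \<omega>)"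
        by (cases "?run \<omega> = (z, n)") (simp_all add: x)
    qed
    finally show "(\<integral>\<^sup>+\<omega>. f (fst (run k pr c (\<lambda>m n. T m n \<omega>) (Suc j))) * indicator {x} (?run \<omega>) \<partial>M) =
      (\<integral>\<^sup>+\<omega>. ?g (fst (?run \<omega>)) * indicator {x} (?run \<omega>) \<partial>M)" .
  next
    show "(\<lambda>\<omega>. f (fst (run k pr c (\<lambda>m n. T m n \<omega>) (Suc j)))) \<in> borel_measurable M"
      by (rule measurable_compose[OF run_measurable, of "\<lambda>x. f (fst x)" borel c "Suc j"]) simp
    show "(\<lambda>\<omega>. ?g (fst (?run \<omega>))) \<in> borel_measurable M"
      by (rule measurable_compose[OF run_measurable, of "\<lambda>x. ?g (fst x)" borel c j]) simp
  qed (rule run_measurable)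
  also have "\<dots> = (\<integral>\<^sup>+z. ?g z \<partial>residual_law k pr fr c j)"
    by (rule Suc.IH[of ?g])
  finally show ?case unfolding residual_law.simps nn_integral_bind_pmf .
qed

lemma prob_run:
  "prob {\<omega> \<in> space M. fst (run k pr c (\<lambda>m n. T m n \<omega>) j) \<in> A} = measure_pmf.prob (residual_law k pr fr c j) A"
proof -
  have [measurable]: "{\<omega> \<in> space M. fst (run k pr c (\<lambda>m n. T m n \<omega>) j) \<in> A} \<in> sets M"
    using run_sets[of c j "{x. fst x \<in> A}"] by simp
  have "emeasure M {\<omega> \<in> space M. fst (run k pr c (\<lambda>m n. T m n \<omega>) j) \<in> A} =
    (\<integral>\<^sup>+\<omega>. indicator A (fst (run k pr c (\<lambda>m n. T m n \<omega>) j)) \<partial>M)"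
    by (subst nn_integral_indicator_comp) simp_all
  also have "\<dots> = emeasure (measure_pmf (residual_law k pr fr c j)) A"
    using nn_integral_run[of "indicator A" c j] by simp
  finally show ?thesis by (simp add: measure_def)
qed

end

lemma lost_iff: "lost s s' \<longleftrightarrow> map_option fst s = Some New \<and> s' = None"
  by (cases s) (auto simp: lost_def)

lemma (in DPH) residual_pos: "r \<in> set_pmf (residual i) \<Longrightarrow> 1 \<le> r"
proof (cases "i < n")
  case True
  then show "r \<in> set_pmf (residual i) \<Longrightarrow> 1 \<le> r" by (cases r) (auto simp: set_pmf_eq pmf_residual)
qed (simp add: residual_def)

section \<open>Intertwining of residual times and phases\<close>

locale queue =
  fixes N :: "server \<Rightarrow> nat" and \<alpha> :: "server \<Rightarrow> real Matrix.vec" and B :: "server \<Rightarrow> real mat"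
    and k :: nat and pr :: server
  assumes k_pos: "k \<ge> 1" and representation: "\<And>m. DPH_rep (N m) (\<alpha> m) (B m)"

sublocale queue \<subseteq> srv: DPH "N m" "\<alpha> m" "B m" for m
  by unfold_locales (rule representation)

context queue
begin

definition advance :: "server \<Rightarrow> nat slot \<Rightarrow> nat slot pmf" where
  "advance m s = (case s of None \<Rightarrow> return_pmf None
     | Some (c, i) \<Rightarrow> map_pmf (map_option (Pair c)) (srv.next_phase m i))"

definition scatter :: "server \<Rightarrow> nat slot \<Rightarrow> nat slot pmf" where
  "scatter m s = (case s of None \<Rightarrow> return_pmf None
     | Some (c, i) \<Rightarrow> map_pmf (\<lambda>r. Some (c, r)) (srv.residual m i))"

primrec phase_step :: "tag \<Rightarrow> nat sys \<Rightarrow> nat sys pmf" where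
  "phase_step c Dead = return_pmf Dead"
| "phase_step c (Sys s1 s2 l) =
     bind_pmf (advance S1 s1) (\<lambda>s1'. bind_pmf (advance S2 s2) (\<lambda>s2'.
       perform srv.fresh_phase (settle k pr c s1 s2 s1' s2' l)))"

primrec spread :: "nat sys \<Rightarrow> nat sys pmf" where
  "spread Dead = return_pmf Dead"
| "spread (Sys s1 s2 l) =
     bind_pmf (scatter S1 s1) (\<lambda>r1. bind_pmf (scatter S2 s2) (\<lambda>r2. return_pmf (Sys r1 r2 l)))"

primrec phase_law :: "(nat \<Rightarrow> tag) \<Rightarrow> nat \<Rightarrow> nat sys pmf" where
  "phase_law c 0 = return_pmf (Sys None None (k - 1))"
| "phase_law c (Suc j) = bind_pmf (phase_law c j) (phase_step (c j))"

lemma scatter_simps [simp]: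
  "scatter m None = return_pmf None"
  "scatter m (Some (c, i)) = map_pmf (\<lambda>r. Some (c, r)) (srv.residual m i)"
  by (simp_all add: scatter_def)

lemma scatter_tag: "r \<in> set_pmf (scatter m s) \<Longrightarrow> map_option fst r = map_option fst s"
  by (auto simp: scatter_def split: option.splits)

text \<open>The intertwining for a single server. By \<open>residual_unfold\<close> the residual
  time is 1 on absorption and otherwise \<open>Suc r\<close>, with \<open>r\<close> drawn from the
  next phase; \<open>tick\<close> empties the slot in the first case. Positivity of \<open>r\<close>
  ensures that it does not do so in the second.\<close>

lemma scatter_tick:
  "bind_pmf (scatter m s) (\<lambda>r. f (tick r)) = bind_pmf (advance m s) (\<lambda>s'. bind_pmf (scatter m s') f)"
proof (cases s)
  case None
  then show ?thesis by (simp add: advance_def tick_def bind_return_pmf)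
next
  case (Some x)
  obtain c i where x: "x = (c, i)" by (cases x)
  have "bind_pmf (scatter m s) (\<lambda>r. f (tick r)) =
    bind_pmf (srv.residual m i) (\<lambda>r. f (tick (Some (c, r))))"
    by (simp add: Some x bind_map_pmf)
  also have "\<dots> = bind_pmf (srv.next_phase m i) (\<lambda>y. case y of None \<Rightarrow> f None
      | Some j \<Rightarrow> bind_pmf (srv.residual m j) (\<lambda>r. f (tick (Some (c, Suc r)))))"
    by (subst srv.residual_unfold)
       (auto simp: bind_assoc_pmf bind_return_pmf bind_map_pmf tick_def intro!: bind_pmf_cong split: option.split)
  also have "\<dots> = bind_pmf (srv.next_phase m i) (\<lambda>y. bind_pmf (scatter m (map_option (Pair c) y)) f)"
    by (intro bind_pmf_cong refl)
       (auto simp: bind_return_pmf bind_map_pmf tick_def dest!: srv.residual_pos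
         intro!: bind_pmf_cong split: option.split)
  also have "\<dots> = bind_pmf (advance m s) (\<lambda>s'. bind_pmf (scatter m s') f)"
    by (simp add: Some x advance_def bind_map_pmf)
  finally show ?thesis .
qed

lemma bind_pmf_const_cong: "(\<And>x. x \<in> set_pmf p \<Longrightarrow> f x = q) \<Longrightarrow> bind_pmf p f = q"
  by (metis bind_pmf_cong bind_pmf_const)

text \<open>Every branch of \<open>settle\<close> is decided by tags, by emptiness of the slots and
  by the clock, and sampling residual times changes none of these. It therefore commutes with the
  decision, and a fresh service time is by definition a fresh phase followed by its residual
  time.\<close>

lemma settle_scatter:
  "bind_pmf (scatter S1 o1) (\<lambda>t1. bind_pmf (scatter S2 o2) (\<lambda>t2.
      perform srv.service (settle k pr c s1 s2 t1 t2 l))) =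
   bind_pmf (perform srv.fresh_phase (settle k pr c s1 s2 o1 o2 l)) spread"
proof -
  have inv: "lost s1 t1 = lost s1 o1 \<and> lost s2 t2 = lost s2 o2 \<and> (t1 = None) = (o1 = None) \<and>
      (t2 = None) = (o2 = None) \<and> both_new t1 t2 = both_new o1 o2"
    if "t1 \<in> set_pmf (scatter S1 o1)" "t2 \<in> set_pmf (scatter S2 o2)" for t1 t2
    using that by (cases o1; cases o2) (auto simp: lost_def both_new_def)
  consider (dead) "lost s1 o1 \<or> lost s2 o2 \<or> c = Star \<and> (l < k - 1 \<or> (o1 \<noteq> None \<and> o2 \<noteq> None))"
    | (stay) "\<not> (lost s1 o1 \<or> lost s2 o2)" "c \<noteq> Star" "l < k - 1 \<or> (o1 \<noteq> None \<and> o2 \<noteq> None)"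
    | (gen) "\<not> (lost s1 o1 \<or> lost s2 o2)" "\<not> (l < k - 1 \<or> (o1 \<noteq> None \<and> o2 \<noteq> None))" by blast
  then show ?thesis
  proof cases
    case dead
    then have "perform srv.service (settle k pr c s1 s2 t1 t2 l) = return_pmf Dead"
      if "t1 \<in> set_pmf (scatter S1 o1)" "t2 \<in> set_pmf (scatter S2 o2)" for t1 t2
      using inv[OF that] by (auto simp: settle_def)
    then have "bind_pmf (scatter S1 o1) (\<lambda>t1. bind_pmf (scatter S2 o2) (\<lambda>t2.
      perform srv.service (settle k pr c s1 s2 t1 t2 l))) = return_pmf Dead"
      by (intro bind_pmf_const_cong)
    moreover have "perform srv.fresh_phase (settle k pr c s1 s2 o1 o2 l) = return_pmf Dead"
      using dead by (auto simp: settle_def)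
    ultimately show ?thesis by (simp add: bind_return_pmf)
  next
    case stay
    let ?l = "if both_new o1 o2 then l else min (l + 1) (k - 1)"
    have "perform srv.service (settle k pr c s1 s2 t1 t2 l) = return_pmf (Sys t1 t2 ?l)"
      if "t1 \<in> set_pmf (scatter S1 o1)" "t2 \<in> set_pmf (scatter S2 o2)" for t1 t2
      using inv[OF that] stay by (auto simp: settle_def)
    then have "bind_pmf (scatter S1 o1) (\<lambda>t1. bind_pmf (scatter S2 o2) (\<lambda>t2.
      perform srv.service (settle k pr c s1 s2 t1 t2 l))) = spread (Sys o1 o2 ?l)"
      by (auto intro!: bind_pmf_cong)
    moreover have "perform srv.fresh_phase (settle k pr c s1 s2 o1 o2 l) = return_pmf (Sys o1 o2 ?l)"
      using stay by (auto simp: settle_def)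
    ultimately show ?thesis by (simp add: bind_return_pmf)
  next
    case gen
    let ?t = "target pr o1 o2"
    have t: "target pr t1 t2 = ?t"
      if "t1 \<in> set_pmf (scatter S1 o1)" "t2 \<in> set_pmf (scatter S2 o2)" for t1 t2
      using inv[OF that] by (auto simp: target_def)
    have "perform srv.service (settle k pr c s1 s2 t1 t2 l) =
        bind_pmf (srv.service ?t) (\<lambda>x. return_pmf (put c ?t t1 t2 x))"
      if "t1 \<in> set_pmf (scatter S1 o1)" "t2 \<in> set_pmf (scatter S2 o2)" for t1 t2
      using inv[OF that] t[OF that] gen by (auto simp: settle_def map_pmf_def)
    then have "bind_pmf (scatter S1 o1) (\<lambda>t1. bind_pmf (scatter S2 o2) (\<lambda>t2.
        perform srv.service (settle k pr c s1 s2 t1 t2 l))) =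
      bind_pmf (scatter S1 o1) (\<lambda>t1. bind_pmf (scatter S2 o2) (\<lambda>t2.
        bind_pmf (srv.service ?t) (\<lambda>x. return_pmf (put c ?t t1 t2 x))))"
      by (auto intro!: bind_pmf_cong)
    \<comment> \<open>The target slot is empty, so its own sampling is trivial; the remaining
      independent draws only have to be reordered.\<close>
    also have "\<dots> = bind_pmf (srv.fresh_phase ?t) (\<lambda>i. spread (put c ?t o1 o2 i))"
    proof (cases ?t)
      case S1
      then have "o1 = None" using gen by (auto simp: target_def split: if_splits)
      then show ?thesis
        unfolding S1 by (simp add: put_def bind_return_pmf bind_map_pmf srv.service_def bind_assoc_pmf)
          (subst bind_commute_pmf, intro bind_pmf_cong refl bind_commute_pmf)
    next
      case S2
      then have "o2 = None" using gen by (cases o2) (auto simp: target_def split: if_splits)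
      then show ?thesis
        unfolding S2 by (simp add: put_def bind_return_pmf bind_map_pmf srv.service_def bind_assoc_pmf)
          (subst bind_commute_pmf, rule refl)
    qed
    also have "\<dots> = bind_pmf (perform srv.fresh_phase (settle k pr c s1 s2 o1 o2 l)) spread"
      by (simp only: settle_def gen if_False perform.simps bind_map_pmf)
    finally show ?thesis .
  qed
qed

text \<open>Sampling the residual service times and then letting a slot elapse amounts to making a
  phase transition first and sampling the residual service times afterwards.\<close>

lemma spread_residual_step:
  "bind_pmf (spread z) (\<lambda>z. perform srv.service (residual_action k pr c z)) =
   bind_pmf (phase_step c z) spread"
proof (cases z)
  case Dead
  then show ?thesis by (simp add: bind_return_pmf)
next
  case (Sys s1 s2 l)
  let ?F = "\<lambda>t1 t2. perform srv.service (settle k pr c s1 s2 t1 t2 l)"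
  have "bind_pmf (spread z) (\<lambda>z. perform srv.service (residual_action k pr c z)) =
    bind_pmf (scatter S1 s1) (\<lambda>r1. bind_pmf (scatter S2 s2) (\<lambda>r2.
      perform srv.service (settle k pr c r1 r2 (tick r1) (tick r2) l)))"
    by (simp add: Sys bind_assoc_pmf bind_return_pmf)
  also have "\<dots> = bind_pmf (scatter S1 s1) (\<lambda>r1. bind_pmf (scatter S2 s2) (\<lambda>r2. ?F (tick r1) (tick r2)))"
  proof (intro bind_pmf_cong refl)
    fix r1 r2 assume "r1 \<in> set_pmf (scatter S1 s1)" "r2 \<in> set_pmf (scatter S2 s2)"
    then have "lost r1 (tick r1) = lost s1 (tick r1)" "lost r2 (tick r2) = lost s2 (tick r2)"
      by (simp_all add: lost_iff scatter_tag)
    then show "perform srv.service (settle k pr c r1 r2 (tick r1) (tick r2) l) = ?F (tick r1) (tick r2)"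
      by (simp add: settle_def)
  qed
  also have "\<dots> = bind_pmf (advance S1 s1) (\<lambda>o1. bind_pmf (scatter S1 o1) (\<lambda>t1.
      bind_pmf (scatter S2 s2) (\<lambda>r2. ?F t1 (tick r2))))"
    by (rule scatter_tick)
  also have "\<dots> = bind_pmf (advance S1 s1) (\<lambda>o1. bind_pmf (scatter S1 o1) (\<lambda>t1.
      bind_pmf (advance S2 s2) (\<lambda>o2. bind_pmf (scatter S2 o2) (\<lambda>t2. ?F t1 t2))))"
    by (intro bind_pmf_cong refl scatter_tick)
  also have "\<dots> = bind_pmf (advance S1 s1) (\<lambda>o1. bind_pmf (advance S2 s2) (\<lambda>o2.
      bind_pmf (scatter S1 o1) (\<lambda>t1. bind_pmf (scatter S2 o2) (\<lambda>t2. ?F t1 t2))))"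
    by (intro bind_pmf_cong refl bind_commute_pmf)
  also have "\<dots> = bind_pmf (phase_step c z) spread"
    by (simp add: Sys settle_scatter bind_assoc_pmf)
  finally show ?thesis .
qed

lemma residual_law_eq: "residual_law k pr srv.service c j = bind_pmf (phase_law c j) spread"
  by (induction j) (simp_all add: bind_return_pmf bind_assoc_pmf spread_residual_step)

end

text \<open>From the reference slot on, a state other than \<open>Dead\<close> certifies that the
  starred packet was generated; its absence from both servers then means that it has been
  received.\<close>

primrec delivered :: "'x sys \<Rightarrow> bool" where
  "delivered Dead = False"
| "delivered (Sys s1 s2 l) \<longleftrightarrow> map_option fst s1 \<noteq> Some Star \<and> map_option fst s2 \<noteq> Some Star"

context queue
begin

text \<open>Delivery is a property of the tags, which \<open>spread\<close> preserves.\<close>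

lemma prob_residual_law_delivered:
  "measure_pmf.prob (residual_law k pr srv.service c j) {z. delivered z} =
   measure_pmf.prob (phase_law c j) {z. delivered z}"
proof -
  have spread: "map_pmf delivered (spread z) = return_pmf (delivered z)" for z :: "nat sys"
  proof (cases z)
    case (Sys s1 s2 l)
    have "bind_pmf (scatter S1 s1) (\<lambda>r1. bind_pmf (scatter S2 s2) (\<lambda>r2. return_pmf (delivered (Sys r1 r2 l)))) =
      return_pmf (delivered z)"
    proof (intro bind_pmf_const_cong)
      fix r1 r2 assume "r1 \<in> set_pmf (scatter S1 s1)" "r2 \<in> set_pmf (scatter S2 s2)"
      from this[THEN scatter_tag] show "return_pmf (delivered (Sys r1 r2 l)) = return_pmf (delivered z)"
        by (simp only: Sys delivered.simps)
    qed
    then show ?thesis by (simp add: Sys map_bind_pmf)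
  qed simp
  have "map_pmf delivered (residual_law k pr srv.service c j) = map_pmf delivered (phase_law c j)"
    by (simp add: residual_law_eq map_bind_pmf spread map_pmf_def[symmetric])
  then have "measure_pmf.prob (map_pmf delivered (residual_law k pr srv.service c j)) {True} =
    measure_pmf.prob (map_pmf delivered (phase_law c j)) {True}" by simp
  then show ?thesis by (simp add: vimage_def)
qed

end

subsection \<open>The dispatch process slot by slot\<close>

definition slot_tag :: "nat \<Rightarrow> nat \<Rightarrow> tag" where
  "slot_tag g t = (if t < g then Old else if t = g then Star else New)"

definition lookup :: "'x slot \<Rightarrow> 'x slot \<Rightarrow> server \<Rightarrow> 'x slot" where
  "lookup s1 s2 m = (case m of S1 \<Rightarrow> s1 | S2 \<Rightarrow> s2)"

locale dispatch_process =
  fixes k :: nat and pr :: server and T :: "server \<Rightarrow> nat \<Rightarrow> nat"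
  assumes k_pos: "k \<ge> 1"
begin

abbreviation "gen \<equiv> gen_slot k pr T"
abbreviation "rec \<equiv> reception_slot k pr T"
abbreviation "srv \<equiv> server_of k pr T"

definition avail :: "nat \<Rightarrow> server \<Rightarrow> nat" where
  "avail n = snd (snd (dispatch k pr T n))"

lemma gen_0: "gen 0 = 0" and srv_0: "srv 0 = pr" and avail_0: "avail 0 = (\<lambda>_. 0)(pr := T pr 0)"
  by (simp_all add: gen_slot_def server_of_def avail_def)

lemma gen_Suc: "gen (Suc n) = (LEAST t. gen n + k \<le> t \<and> (\<exists>m. avail n m \<le> t))"
  and srv_Suc: "srv (Suc n) = (if \<forall>m. avail n m \<le> gen (Suc n) then pr
      else if avail n S1 \<le> gen (Suc n) then S1 else S2)"
  and avail_Suc: "avail (Suc n) =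
      (avail n)(srv (Suc n) := gen (Suc n) + T (srv (Suc n)) (Suc n))"
  by (simp_all add: gen_slot_def server_of_def avail_def Let_def split: prod.split)

lemma gen_Suc_le: "gen (Suc n) \<le> t \<longleftrightarrow> (\<exists>m. max (gen n + k) (avail n m) \<le> t)"
proof -
  let ?P = "\<lambda>t. gen n + k \<le> t \<and> (\<exists>m. avail n m \<le> t)"
  have P: "?P (max (gen n + k) (avail n S1))" by (intro conjI exI[of _ S1]) simp_all
  have LE: "?P (gen (Suc n))" unfolding gen_Suc by (rule LeastI[of ?P, OF P])
  have le: "gen (Suc n) \<le> t" if "?P t" for t unfolding gen_Suc by (rule Least_le[of ?P, OF that])
  show ?thesis
  proof
    assume t: "gen (Suc n) \<le> t"
    obtain m where "avail n m \<le> gen (Suc n)" using LE by blast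
    then show "\<exists>m. max (gen n + k) (avail n m) \<le> t" using t LE by (intro exI[of _ m]) simp
  next
    assume "\<exists>m. max (gen n + k) (avail n m) \<le> t"
    then show "gen (Suc n) \<le> t" by (intro le) auto
  qed
qed

lemma gen_strict_mono: "strict_mono gen"
proof (rule strict_mono_Suc_iff[THEN iffD2], rule allI)
  fix n
  show "gen n < gen (Suc n)" using gen_Suc_le[of n "gen (Suc n)"] k_pos by auto
qed

lemma gen_less_iff [simp]: "gen i < gen j \<longleftrightarrow> i < j" and gen_le_iff [simp]: "gen i \<le> gen j \<longleftrightarrow> i \<le> j"
  and gen_eq_iff [simp]: "gen i = gen j \<longleftrightarrow> i = j"
  using gen_strict_mono by (simp_all add: strict_mono_less strict_mono_less_eq strict_mono_eq)

lemma rec_eq: "rec n = gen n + T (srv n) n"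
  by (simp add: reception_slot_def)

lemma rec_ge: "n \<le> rec n"
  using strict_mono_imp_increasing[OF gen_strict_mono, of n] by (simp add: rec_eq)

lemma finite_received: "finite {n. rec n \<le> t}"
  by (rule finite_subset[of _ "{..t}"]) (auto intro: order.trans[OF rec_ge])

text \<open>Trades the maximum for quantifiers over packets, the form that suits both the
  measurability proof and the pathwise characterisation.\<close>

lemma AoI_eq_Some_ex:
  "AoI k pr T t = Some h \<longleftrightarrow>
     (\<exists>n. rec n \<le> t \<and> (\<forall>m. rec m \<le> t \<longrightarrow> gen m \<le> gen n) \<and> t - gen n = h)"
proof (cases "{n. rec n \<le> t} = {}")
  case True
  then show ?thesis by (auto simp: AoI_def)
next
  case False
  let ?G = "gen ` {n. rec n \<le> t}"
  have fin: "finite ?G" and ne: "?G \<noteq> {}" using finite_received False by auto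
  have "AoI k pr T t = Some h \<longleftrightarrow> t - Max ?G = h"
    using False unfolding AoI_def Let_def by (simp only: if_False option.inject)
  also have "\<dots> \<longleftrightarrow> (\<exists>x. Max ?G = x \<and> t - x = h)" by simp
  also have "\<dots> \<longleftrightarrow> (\<exists>x. (x \<in> ?G \<and> (\<forall>a\<in>?G. a \<le> x)) \<and> t - x = h)"
    unfolding Max_eq_iff[OF fin ne] ..
  finally show ?thesis by blast
qed

lemma AoI_eq_None_imp: "AoI k pr T t = None \<Longrightarrow> t < T pr 0"
  by (auto simp: AoI_def rec_eq gen_0 srv_0 not_le[symmetric] split: if_splits dest!: spec[of _ 0])

end

locale dispatching = dispatch_process +
  assumes T_pos: "\<And>m n. 1 \<le> T m n"
begin

lemma rec_gt: "gen n < rec n"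
  using T_pos[of "srv n" n] by (simp add: rec_eq)

lemma lookup_simps [simp]: "lookup s1 s2 S1 = s1" "lookup s1 s2 S2 = s2"
  by (simp_all add: lookup_def)

lemma server_all: "(\<forall>m. P m) \<longleftrightarrow> P S1 \<and> P S2"
  by (auto intro: server.induct)

text \<open>\<open>u\<close> is the state of the servers at slot \<open>t\<close> and \<open>n\<close> the last packet generated so far.\<close>

definition alive :: "nat \<Rightarrow> nat \<Rightarrow> nat \<Rightarrow> (server \<Rightarrow> nat slot) \<Rightarrow> nat \<Rightarrow> bool" where
  "alive g t n u l \<longleftrightarrow>
     gen n \<le> t \<and> t < gen (Suc n) \<and>
     (\<not> (\<forall>m. \<exists>r. u m = Some (New, r)) \<longrightarrow> l = min (t - gen n) (k - 1)) \<and>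
     (\<forall>m. u m = None \<longrightarrow> avail n m \<le> t) \<and>
     (\<forall>m c r. u m = Some (c, r) \<longrightarrow> 1 \<le> r \<and> avail n m = t + r \<and>
        (\<exists>q\<le>n. srv q = m \<and> rec q = t + r \<and> c = slot_tag g (gen q))) \<and>
     (\<forall>q\<le>n. t < rec q \<longrightarrow> u (srv q) = Some (slot_tag g (gen q), rec q - t)) \<and>
     (\<forall>q\<le>n. g < gen q \<longrightarrow> t < rec q) \<and>
     (g \<le> t \<longrightarrow> (\<exists>q\<le>n. gen q = g))"

definition superseded :: "nat \<Rightarrow> nat \<Rightarrow> bool" where
  "superseded g t \<longleftrightarrow> (g \<le> t \<and> (\<forall>q. gen q \<noteq> g)) \<or> (\<exists>q. g < gen q \<and> rec q \<le> t)"

definition tracks :: "nat \<Rightarrow> nat \<Rightarrow> nat \<Rightarrow> nat sys \<Rightarrow> bool" where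
  "tracks g t n z = (case z of Dead \<Rightarrow> superseded g t | Sys s1 s2 l \<Rightarrow> alive g t n (lookup s1 s2) l)"

lemma aliveD:
  assumes "alive g t n u l"
  shows "gen n \<le> t" "t < gen (Suc n)"
    and "\<not> (\<forall>m. \<exists>r. u m = Some (New, r)) \<Longrightarrow> l = min (t - gen n) (k - 1)"
    and "u m = None \<Longrightarrow> avail n m \<le> t"
    and "u m = Some (c, r) \<Longrightarrow> 1 \<le> r"
    and "u m = Some (c, r) \<Longrightarrow> avail n m = t + r"
    and "u m = Some (c, r) \<Longrightarrow> \<exists>q\<le>n. srv q = m \<and> rec q = t + r \<and> c = slot_tag g (gen q)"
    and "q \<le> n \<Longrightarrow> t < rec q \<Longrightarrow> u (srv q) = Some (slot_tag g (gen q), rec q - t)"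
    and "q \<le> n \<Longrightarrow> g < gen q \<Longrightarrow> t < rec q"
    and "g \<le> t \<Longrightarrow> \<exists>q\<le>n. gen q = g"
  using assms unfolding alive_def by blast+

lemma slot_tag_New [simp]: "slot_tag g t = New \<longleftrightarrow> g < t" "New = slot_tag g t \<longleftrightarrow> g < t"
  and slot_tag_Star [simp]: "slot_tag g t = Star \<longleftrightarrow> t = g" "Star = slot_tag g t \<longleftrightarrow> t = g"
  by (auto simp: slot_tag_def)

lemma tick_None [simp]: "tick None = None"
  and tick_Some: "tick (Some (c, r)) = (if r \<le> 1 then None else Some (c, r - 1))"
  by (simp_all add: tick_def)

lemma tick_eq_None: "alive g t n u l \<Longrightarrow> tick (u m) = None \<longleftrightarrow> avail n m \<le> Suc t"
proof (cases "u m")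
  case (Some x)
  assume a: "alive g t n u l"
  obtain c r where x: "x = (c, r)" by (cases x)
  show ?thesis
    using aliveD(5,6)[OF a Some[unfolded x]] by (simp add: Some x tick_Some)
qed (auto dest: aliveD(4)[where m = m])

lemma tick_eq_Some: "tick s = Some (c, r) \<longleftrightarrow> s = Some (c, Suc r) \<and> 1 \<le> r"
  by (cases s) (auto simp: tick_Some split: if_splits)

lemma alive_lost:
  assumes a: "alive g t n u l" and lost: "lost (u m) (tick (u m))"
  shows "superseded g (Suc t)"
proof -
  obtain r where r: "u m = Some (New, r)" "tick (u m) = None" using lost by (auto simp: lost_def)
  have "1 \<le> r" using a r(1) by (rule aliveD(5))
  then have "r = 1" using r by (simp add: tick_Some split: if_splits)
  then show ?thesis using aliveD(7)[OF a r(1)] by (auto simp: superseded_def)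
qed

lemma alive_tick:
  assumes a: "alive g t n u l" and nl: "\<And>m. \<not> lost (u m) (tick (u m))"
  shows "tick (u m) = Some (c, r) \<Longrightarrow> 1 \<le> r \<and> avail n m = Suc t + r \<and>
      (\<exists>q\<le>n. srv q = m \<and> rec q = Suc t + r \<and> c = slot_tag g (gen q))"
    and "q \<le> n \<Longrightarrow> Suc t < rec q \<Longrightarrow> tick (u (srv q)) = Some (slot_tag g (gen q), rec q - Suc t)"
    and "q \<le> n \<Longrightarrow> g < gen q \<Longrightarrow> Suc t < rec q"
    and "(\<forall>m. \<exists>r. u m = Some (New, r)) \<Longrightarrow> \<exists>r. tick (u m) = Some (New, r)"
proof -
  show "tick (u m) = Some (c, r) \<Longrightarrow> 1 \<le> r \<and> avail n m = Suc t + r \<and>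
      (\<exists>q\<le>n. srv q = m \<and> rec q = Suc t + r \<and> c = slot_tag g (gen q))"
    using aliveD(6,7)[OF a, of m c "Suc r"] by (auto simp: tick_eq_Some)
  show "q \<le> n \<Longrightarrow> Suc t < rec q \<Longrightarrow> tick (u (srv q)) = Some (slot_tag g (gen q), rec q - Suc t)"
    using aliveD(8)[OF a, of q] by (auto simp: tick_eq_Some)
  show "Suc t < rec q" if "q \<le> n" "g < gen q"
  proof (rule ccontr)
    assume "\<not> Suc t < rec q"
    then have "rec q = Suc t" using aliveD(9)[OF a that] by simp
    then have "u (srv q) = Some (New, 1)" using aliveD(8)[OF a, of q] that by simp
    then show False using nl[of "srv q"] by (simp add: lost_def tick_Some)
  qed
  show "\<exists>r. tick (u m) = Some (New, r)" if all: "\<forall>m. \<exists>r. u m = Some (New, r)"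
  proof -
    obtain r where "u m = Some (New, r)" using all by blast
    then show ?thesis using nl[of m] by (cases "r \<le> 1") (simp_all add: lost_def tick_Some)
  qed
qed

text \<open>Either both servers are still busy, or one is idle. In the second case not both packets
  were new, so the clock is exact and shows that fewer than \<open>k\<close> slots have passed since
  the last generation.\<close>

lemma alive_no_generation:
  assumes a: "alive g t n u l" and nl: "\<And>m. \<not> lost (u m) (tick (u m))"
    and no: "l < k - 1 \<or> (\<forall>m. tick (u m) \<noteq> None)"
  shows "Suc t < gen (Suc n)"
proof (cases "\<forall>m. tick (u m) \<noteq> None")
  case True
  then have "\<not> avail n m \<le> Suc t" for m using tick_eq_None[OF a, of m] by blast
  then show ?thesis using gen_Suc_le[of n "Suc t"] by (auto simp: not_le[symmetric])
next
  case False
  then have "\<not> (\<forall>m. \<exists>r. u m = Some (New, r))" using alive_tick(4)[OF a nl] by fastforce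
  then have "l = min (t - gen n) (k - 1)" by (rule aliveD(3)[OF a])
  moreover have "l < k - 1" using False no by blast
  ultimately have "Suc t < gen n + k" using aliveD(1)[OF a] by auto
  then show ?thesis using gen_Suc_le[of n "Suc t"] by (force simp: not_le)
qed

lemma alive_stay:
  assumes a: "alive g t n u l" and nl: "\<And>m. \<not> lost (u m) (tick (u m))"
    and no: "l < k - 1 \<or> (\<forall>m. tick (u m) \<noteq> None)" and g: "Suc t \<noteq> g"
    and l': "\<not> (\<forall>m. \<exists>r. tick (u m) = Some (New, r)) \<Longrightarrow> l' = min (l + 1) (k - 1)"
  shows "alive g (Suc t) n (\<lambda>m. tick (u m)) l'"
  unfolding alive_def
proof (intro conjI allI impI)
  show "gen n \<le> Suc t" using aliveD(1)[OF a] by simp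
  show "Suc t < gen (Suc n)" by (rule alive_no_generation[OF a nl no])
  show "l' = min (Suc t - gen n) (k - 1)" if "\<not> (\<forall>m. \<exists>r. tick (u m) = Some (New, r))"
  proof -
    have "\<not> (\<forall>m. \<exists>r. u m = Some (New, r))" using that alive_tick(4)[OF a nl] by blast
    then have "l = min (t - gen n) (k - 1)" by (rule aliveD(3)[OF a])
    then show ?thesis using l'[OF that] aliveD(1)[OF a] by (auto simp: Suc_diff_le min_def)
  qed
  show "avail n m \<le> Suc t" if "tick (u m) = None" for m
    using that tick_eq_None[OF a] by simp
  show "1 \<le> r" "avail n m = Suc t + r" "\<exists>q\<le>n. srv q = m \<and> rec q = Suc t + r \<and> c = slot_tag g (gen q)"
    if "tick (u m) = Some (c, r)" for m c r
    using alive_tick(1)[OF a nl that] by auto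
  show "\<exists>q\<le>n. gen q = g" if "g \<le> Suc t"
    using that g aliveD(10)[OF a] by simp
qed (use alive_tick(2,3)[OF a nl] in auto)

text \<open>The invariant leaves the clock unspecified while both packets are new, but a server that
  becomes idle without a loss did not hold a new packet. Hence the clock is exact, and its final
  value \<open>k - 1\<close> means that the freezing period ends at slot
  \<open>Suc t\<close>.\<close>

lemma alive_generation:
  assumes a: "alive g t n u l" and nl: "\<And>m. \<not> lost (u m) (tick (u m))"
    and yes: "\<not> l < k - 1" and idle: "tick (u m0) = None"
  shows "gen (Suc n) = Suc t"
proof -
  have "\<not> (\<forall>m. \<exists>r. u m = Some (New, r))" using alive_tick(4)[OF a nl, of m0] idle by auto
  then have "l = min (t - gen n) (k - 1)" by (rule aliveD(3)[OF a])
  then have "gen n + k \<le> Suc t" using yes k_pos aliveD(1)[OF a] by auto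
  moreover have "avail n m0 \<le> Suc t" using idle tick_eq_None[OF a] by simp
  ultimately have "gen (Suc n) \<le> Suc t" unfolding gen_Suc_le by (intro exI[of _ m0]) simp
  then show ?thesis using aliveD(2)[OF a] by simp
qed

lemma alive_put:
  assumes a: "alive g t n u l" and nl: "\<And>m. \<not> lost (u m) (tick (u m))"
    and gen: "gen (Suc n) = Suc t" and m: "srv (Suc n) = m" "tick (u m) = None"
    and u': "u' = (\<lambda>m. tick (u m))(m := Some (slot_tag g (Suc t), T m (Suc n)))"
  shows "alive g (Suc t) (Suc n) u' 0"
proof -
  have rec: "rec (Suc n) = Suc t + T m (Suc n)" by (simp add: rec_eq m gen)
  have avail: "avail (Suc n) m' = (if m' = m then Suc t + T m (Suc n) else avail n m')" for m'
    by (simp add: avail_Suc m gen)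
  show ?thesis
    unfolding alive_def
  proof (intro conjI allI impI)
    show "gen (Suc n) \<le> Suc t" "Suc t < gen (Suc (Suc n))"
      unfolding gen[symmetric] by (simp_all only: gen_less_iff order_refl lessI)
    show "0 = min (Suc t - gen (Suc n)) (k - 1)" by (simp add: gen)
    show "avail (Suc n) m' \<le> Suc t" if "u' m' = None" for m'
      using that tick_eq_None[OF a, of m'] by (auto simp: u' avail split: if_splits)
    show "1 \<le> r" if "u' m' = Some (c, r)" for m' c r
      using that alive_tick(1)[OF a nl, of m' c r] T_pos[of m "Suc n"] by (auto simp: u' split: if_splits)
    show "avail (Suc n) m' = Suc t + r" if "u' m' = Some (c, r)" for m' c r
      using that alive_tick(1)[OF a nl, of m' c r] by (auto simp: u' avail split: if_splits)
    show "\<exists>q\<le>Suc n. srv q = m' \<and> rec q = Suc t + r \<and> c = slot_tag g (gen q)"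
      if "u' m' = Some (c, r)" for m' c r
    proof (cases "m' = m")
      case True
      then show ?thesis using that by (intro exI[of _ "Suc n"]) (auto simp: u' m gen rec)
    next
      case False
      then show ?thesis
        using that alive_tick(1)[OF a nl, of m' c r] by (auto simp: u' intro: le_SucI)
    qed
    show "u' (srv q) = Some (slot_tag g (gen q), rec q - Suc t)" if "q \<le> Suc n" "Suc t < rec q" for q
    proof (cases "q = Suc n")
      case True
      then show ?thesis by (simp add: u' m rec gen)
    next
      case False
      then show ?thesis using that alive_tick(2)[OF a nl, of q] m(2) by (auto simp: u')
    qed
    show "Suc t < rec q" if "q \<le> Suc n" "g < gen q" for q
      using that alive_tick(3)[OF a nl, of q] rec_gt[of "Suc n"] gen by (cases "q = Suc n") auto
    show "\<exists>q\<le>Suc n. gen q = g" if "g \<le> Suc t"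
      using that aliveD(10)[OF a] gen by (cases "g = Suc t") (auto intro: le_SucI)
  qed
qed

lemma lookup_put: "put c m s1 s2 x = Sys t1 t2 l \<Longrightarrow>
    l = 0 \<and> lookup t1 t2 = (lookup s1 s2)(m := Some (c, x))"
  by (auto simp: put_def fun_eq_iff lookup_def split: server.splits)

lemma lookup_tick: "lookup (tick s1) (tick s2) = (\<lambda>m. tick (lookup s1 s2 m))"
  by (auto simp: fun_eq_iff lookup_def split: server.splits)

lemma both_new_lookup: "both_new s1 s2 \<longleftrightarrow> (\<forall>m. \<exists>r. lookup s1 s2 m = Some (New, r))"
  by (auto simp: both_new_def server_all)

lemma tracks_step:
  assumes tr: "tracks g t n z"
  shows "\<exists>n'. exec (residual_action k pr (slot_tag g (Suc t)) z) T (Suc n) =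
      (fst (exec (residual_action k pr (slot_tag g (Suc t)) z) T (Suc n)), Suc n') \<and>
    tracks g (Suc t) n' (fst (exec (residual_action k pr (slot_tag g (Suc t)) z) T (Suc n)))"
proof (cases z)
  case Dead
  then show ?thesis using tr by (auto simp: tracks_def superseded_def)
next
  case (Sys s1 s2 l)
  let ?u = "lookup s1 s2" and ?c = "slot_tag g (Suc t)"
  have a: "alive g t n ?u l" using tr by (simp add: tracks_def Sys)
  consider (lost) m where "lost (?u m) (tick (?u m))"
    | (stay) "\<And>m. \<not> lost (?u m) (tick (?u m))" "l < k - 1 \<or> (\<forall>m. tick (?u m) \<noteq> None)"
    | (gen) m where "\<And>m. \<not> lost (?u m) (tick (?u m))" "\<not> l < k - 1" "tick (?u m) = None" by blast
  then show ?thesis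
  proof cases
    case lost
    then have "residual_action k pr ?c z = Go Dead"
      by (cases m) (simp_all add: Sys settle_def)
    then show ?thesis using alive_lost[OF a lost] by (simp add: tracks_def)
  next
    case stay
    have nl: "\<not> (lost s1 (tick s1) \<or> lost s2 (tick s2))" using stay(1)[of S1] stay(1)[of S2] by simp
    have no: "l < k - 1 \<or> (tick s1 \<noteq> None \<and> tick s2 \<noteq> None)" using stay(2) by (simp add: server_all)
    let ?l = "if both_new (tick s1) (tick s2) then l else min (l + 1) (k - 1)"
    have act: "residual_action k pr ?c z = Go (if ?c = Star then Dead else Sys (tick s1) (tick s2) ?l)"
      unfolding Sys residual_action.simps settle_def if_not_P[OF nl] if_P[OF no] ..
    show ?thesis
    proof (cases "Suc t = g")
      case True
      \<comment> \<open>A packet generated at \<open>g\<close> would have an index strictly between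
        \<open>n\<close> and \<open>Suc n\<close>.\<close>
      have "superseded g (Suc t)"
        unfolding superseded_def
      proof (intro disjI1 conjI allI)
        fix q show "gen q \<noteq> g"
        proof
          assume q: "gen q = g"
          then have "gen n < gen q" "gen q < gen (Suc n)"
            using aliveD(1)[OF a] alive_no_generation[OF a stay] True by auto
          then show False by simp
        qed
      qed (use True in simp)
      then show ?thesis unfolding act using True by (simp add: tracks_def)
    next
      case False
      have "alive g (Suc t) n (lookup (tick s1) (tick s2)) ?l"
        unfolding lookup_tick using False
        by (intro alive_stay[OF a stay]) (auto simp: both_new_lookup lookup_tick)
      then show ?thesis using False by (simp add: act tracks_def)
    qed
  next
    case gen
    note nl = gen(1)
    let ?m = "target pr (tick s1) (tick s2)"
    have gen_eq: "gen (Suc n) = Suc t" by (rule alive_generation[OF a gen])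
    have idle: "tick s1 = None \<or> tick s2 = None" using gen(3) by (cases m) auto
    have act: "residual_action k pr ?c z = Gen ?m (put ?c ?m (tick s1) (tick s2))"
    proof -
      have "\<not> (lost s1 (tick s1) \<or> lost s2 (tick s2))" using nl[of S1] nl[of S2] by simp
      moreover have "\<not> (l < k - 1 \<or> (tick s1 \<noteq> None \<and> tick s2 \<noteq> None))" using gen(2) idle by auto
      ultimately show ?thesis unfolding Sys residual_action.simps settle_def by (simp only: if_False)
    qed
    \<comment> \<open>Availability at slot \<open>Suc t\<close> is emptiness after the tick, so
      \<open>target\<close> repeats the server choice made by \<open>dispatch\<close>.\<close>
    have av: "avail n m \<le> Suc t \<longleftrightarrow> tick (?u m) = None" for m using tick_eq_None[OF a] by simp
    have srv: "srv (Suc n) = ?m"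
      using idle by (auto simp: srv_Suc gen_eq av server_all target_def)
    have m: "tick (?u ?m) = None" using idle by (cases pr) (auto simp: target_def)
    obtain t1 t2 l' where put: "put ?c ?m (tick s1) (tick s2) (T ?m (Suc n)) = Sys t1 t2 l'"
      by (cases ?m) (auto simp: put_def)
    have "alive g (Suc t) (Suc n) (lookup t1 t2) 0"
      using lookup_put[OF put] by (intro alive_put[OF a nl gen_eq srv m]) (simp add: lookup_tick)
    then show ?thesis using lookup_put[OF put] by (simp add: act put tracks_def)
  qed
qed

lemma tracks_run: "\<exists>n. snd (run k pr (slot_tag g) T (Suc t)) = Suc n \<and>
    tracks g t n (fst (run k pr (slot_tag g) T (Suc t)))"
proof (induction t)
  case 0
  \<comment> \<open>In the fictitious state both servers are idle and the clock has expired, so the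
    first step is forced to generate packet 0 at slot 0 on the priority server.\<close>
  let ?z = "put (slot_tag g 0) pr None None (T pr 0)"
  obtain t1 t2 l' where put: "?z = Sys t1 t2 l'" by (cases pr) (auto simp: put_def)
  have u: "lookup t1 t2 = (\<lambda>_. None)(pr := Some (slot_tag g 0, T pr 0))" "l' = 0"
    using lookup_put[OF put] by (auto simp: fun_eq_iff lookup_def split: server.splits)
  have "rec 0 = T pr 0" by (simp add: rec_eq gen_0 srv_0)
  then have "alive g 0 0 (lookup t1 t2) l'"
    using T_pos[of pr 0] gen_less_iff[of 0 "Suc 0"]
    unfolding alive_def u by (auto simp: gen_0 srv_0 avail_0 simp del: gen_less_iff)
  then have "tracks g 0 0 ?z" by (simp add: tracks_def put)
  then show ?case by (simp add: settle_def lost_def target_def)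
next
  case (Suc t)
  then obtain n where "snd (run k pr (slot_tag g) T (Suc t)) = Suc n"
    "tracks g t n (fst (run k pr (slot_tag g) T (Suc t)))" by blast
  moreover have "run k pr (slot_tag g) T (Suc (Suc t)) =
      exec (residual_action k pr (slot_tag g (Suc t)) (fst (run k pr (slot_tag g) T (Suc t))))
        T (snd (run k pr (slot_tag g) T (Suc t)))"
    by (rule run.simps(2))
  ultimately show ?case
    using tracks_step[of g t n "fst (run k pr (slot_tag g) T (Suc t))"]
    by (metis snd_conv)
qed

lemma AoI_eq_Some_iff:
  "AoI k pr T (g + h) = Some h \<longleftrightarrow>
     (\<exists>q. gen q = g \<and> rec q \<le> g + h) \<and> (\<forall>q. g < gen q \<longrightarrow> g + h < rec q)"
proof -
  \<comment> \<open>A received packet was generated strictly before its reception, so the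
    subtraction is not truncated here.\<close>
  have "g + h - gen n = h \<longleftrightarrow> gen n = g" if "rec n \<le> g + h" for n
    using that rec_gt[of n] by auto
  then have "AoI k pr T (g + h) = Some h \<longleftrightarrow>
      (\<exists>n. rec n \<le> g + h \<and> (\<forall>m. rec m \<le> g + h \<longrightarrow> gen m \<le> gen n) \<and> gen n = g)"
    unfolding AoI_eq_Some_ex by blast
  also have "\<dots> \<longleftrightarrow> (\<exists>q. gen q = g \<and> rec q \<le> g + h) \<and> (\<forall>q. g < gen q \<longrightarrow> g + h < rec q)"
    by (metis not_le)
  finally show ?thesis .
qed

lemma delivered_iff_AoI:
  "delivered (fst (run k pr (slot_tag g) T (Suc (g + h)))) \<longleftrightarrow> AoI k pr T (g + h) = Some h"
proof -
  define t where "t = g + h"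
  define z where "z = fst (run k pr (slot_tag g) T (Suc t))"
  obtain n where tr: "tracks g t n z" using tracks_run unfolding z_def by blast
  have "delivered z \<longleftrightarrow> (\<exists>q. gen q = g \<and> rec q \<le> t) \<and> (\<forall>q. g < gen q \<longrightarrow> t < rec q)"
  proof (cases z)
    case Dead
    then show ?thesis using tr by (auto simp: tracks_def superseded_def not_le)
  next
    case (Sys s1 s2 l)
    let ?u = "lookup s1 s2"
    have a: "alive g t n ?u l" using tr by (simp add: tracks_def Sys)
    obtain q where q: "q \<le> n" "gen q = g" using aliveD(10)[OF a] by (auto simp: t_def)
    have del: "delivered z \<longleftrightarrow> (\<forall>m. map_option fst (?u m) \<noteq> Some Star)"
      by (simp add: Sys server_all)
    show ?thesis
    proof
      assume d: "delivered z"
      have "rec q \<le> t"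
      proof (rule ccontr)
        assume "\<not> rec q \<le> t"
        then show False using d aliveD(8)[OF a q(1)] q(2) unfolding del by (auto dest: spec[of _ "srv q"])
      qed
      moreover have "t < rec q'" if "g < gen q'" for q'
      proof (cases "q' \<le> n")
        case True
        then show ?thesis using aliveD(9)[OF a] that by simp
      next
        case False
        then have "gen (Suc n) \<le> gen q'" by simp
        then show ?thesis using aliveD(2)[OF a] rec_gt[of q'] by linarith
      qed
      ultimately show "(\<exists>q. gen q = g \<and> rec q \<le> t) \<and> (\<forall>q. g < gen q \<longrightarrow> t < rec q)"
        using q by blast
    next
      assume r: "(\<exists>q. gen q = g \<and> rec q \<le> t) \<and> (\<forall>q. g < gen q \<longrightarrow> t < rec q)"
      show "delivered z" unfolding del
      proof (intro allI notI)
        fix m assume "map_option fst (?u m) = Some Star"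
        then obtain r' where u: "?u m = Some (Star, r')" by auto
        obtain q' where "rec q' = t + r'" "gen q' = g" using aliveD(7)[OF a u] by auto
        moreover from this r have "rec q' \<le> t" by (metis gen_eq_iff)
        ultimately show False using aliveD(5)[OF a u] by simp
      qed
    qed
  qed
  then show ?thesis unfolding z_def t_def AoI_eq_Some_iff .
qed

end

subsection \<open>The rows of the transition matrices\<close>

lemma expectation_bind_finite:
  fixes f :: "'b \<Rightarrow> real"
  assumes "finite (set_pmf p)" "\<And>x. x \<in> set_pmf p \<Longrightarrow> finite (set_pmf (q x))"
  shows "measure_pmf.expectation (bind_pmf p q) f =
    measure_pmf.expectation p (\<lambda>x. measure_pmf.expectation (q x) f)"
  using assms by (subst pmf_expectation_bind[where A = "set_pmf p"])
    (auto simp: integral_measure_pmf[where A = "set_pmf p"])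

text \<open>The action of a row on a function, evaluated on the list itself; repeated targets add up
  just as in \<open>entry\<close>, and no sum over the state set has to be expanded.\<close>

definition row_sum :: "('s \<times> real) list \<Rightarrow> ('s \<Rightarrow> real) \<Rightarrow> real" where
  "row_sum xs f = (\<Sum>(t, w)\<leftarrow>xs. w * f t)"

lemma row_sum_simps [simp]:
  "row_sum [] f = 0" "row_sum ((t, w) # xs) f = w * f t + row_sum xs f"
  "row_sum (xs @ ys) f = row_sum xs f + row_sum ys f"
  by (simp_all add: row_sum_def)

lemma row_sum_map [simp]: "row_sum (map (\<lambda>i. (t i, w i)) [0..<n]) f = (\<Sum>i<n. w i * f (t i))"
  by (simp add: row_sum_def comp_def interv_sum_list_conv_sum_set_nat atLeast0LessThan)

lemma row_sum_concat [simp]: "row_sum (concat (map xs [0..<n])) f = (\<Sum>i<n. row_sum (xs i) f)"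
proof -
  have "row_sum (concat (map xs js)) f = (\<Sum>j\<leftarrow>js. row_sum (xs j) f)" for js :: "nat list"
    by (induction js) simp_all
  then show ?thesis by (simp add: interv_sum_list_conv_sum_set_nat atLeast0LessThan)
qed

lemma row_sum_entry:
  assumes "finite S" "fst ` set xs \<subseteq> S"
  shows "(\<Sum>s\<in>S. entry xs s * f s) = row_sum xs f"
  using assms(2)
proof (induction xs)
  case Nil
  then show ?case by (simp add: entry_def)
next
  case (Cons x xs)
  obtain t w where x: "x = (t, w)" by (cases x)
  have "(\<Sum>s\<in>S. entry (x # xs) s * f s) = (\<Sum>s\<in>S. (if t = s then w * f s else 0)) + (\<Sum>s\<in>S. entry xs s * f s)"
    by (simp add: x entry_def distrib_right sum.distrib if_distrib[where f = "\<lambda>a. a * _"] cong: if_cong)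
  also have "(\<Sum>s\<in>S. (if t = s then w * f s else 0)) = w * f t"
    using Cons.prems assms(1) by (simp add: x)
  finally show ?case using Cons by (simp add: x)
qed

lemma lost_simps [simp]:
  "\<not> lost s (Some y)" "\<not> lost None s'" "lost (Some (c, x)) None \<longleftrightarrow> c = New"
  by (auto simp: lost_def)

lemma both_new_simps [simp]:
  "\<not> both_new None s" "\<not> both_new s None"
  "both_new (Some (c, x)) (Some (c', y)) \<longleftrightarrow> c = New \<and> c' = New"
  by (auto simp: both_new_def)

lemma set_concat_upt3: "set (concat (map (\<lambda>i. concat (map (\<lambda>j. map (f i j) [0..<k]) [0..<n])) [0..<m])) =
    {f i j l | i j l. i < m \<and> j < n \<and> l < (k :: nat)}"
  by force

lemma set_concat_upt2: "set (concat (map (\<lambda>i. map (f i) [0..<k]) [0..<m])) = {f i l | i l. i < m \<and> l < (k :: nat)}"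
  by force

lemma set_map_upt: "set (map f [0..<k]) = {f l | l. l < (k :: nat)}"
  by force

lemma Y_transient_iff [simp]:
  "Y1 i j l \<in> set (Y_transient N k) \<longleftrightarrow> i < N S1 \<and> j < N S2 \<and> l < k"
  "Y2 i j l \<in> set (Y_transient N k) \<longleftrightarrow> i < N S1 \<and> j < N S2 \<and> l < k"
  "Y3 i j l \<in> set (Y_transient N k) \<longleftrightarrow> i < N S1 \<and> j < N S2 \<and> l < k"
  "Y4 i j l \<in> set (Y_transient N k) \<longleftrightarrow> i < N S1 \<and> j < N S2 \<and> l < k"
  "Y5 i l \<in> set (Y_transient N k) \<longleftrightarrow> i < N S1 \<and> l < k"
  "Y6 j l \<in> set (Y_transient N k) \<longleftrightarrow> j < N S2 \<and> l < k"
  "Y7 l \<in> set (Y_transient N k) \<longleftrightarrow> l < k"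
  "Y8 i j \<in> set (Y_transient N k) \<longleftrightarrow> i < N S1 \<and> j < N S2"
  "Y9 i l \<in> set (Y_transient N k) \<longleftrightarrow> i < N S1 \<and> l < k"
  "Y10 j l \<in> set (Y_transient N k) \<longleftrightarrow> j < N S2 \<and> l < k"
  "Y11 i j l \<in> set (Y_transient N k) \<longleftrightarrow> i < N S1 \<and> j < N S2 \<and> l < k"
  "Y12 i j l \<in> set (Y_transient N k) \<longleftrightarrow> i < N S1 \<and> j < N S2 \<and> l < k"
  "Y13 i l \<in> set (Y_transient N k) \<longleftrightarrow> i < N S1 \<and> l < k"
  "Y14 j l \<in> set (Y_transient N k) \<longleftrightarrow> j < N S2 \<and> l < k"
  "Y15 \<notin> set (Y_transient N k)" "Y16 \<notin> set (Y_transient N k)"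
  unfolding Y_transient_def set_append set_concat_upt3 set_concat_upt2 set_map_upt Un_iff mem_Collect_eq
  by simp_all

lemma W_states_iff [simp]:
  "W1 l \<in> W_states N k \<longleftrightarrow> l < k"
  "W2 i l \<in> W_states N k \<longleftrightarrow> i < N S1 \<and> l < k"
  "W3 j l \<in> W_states N k \<longleftrightarrow> j < N S2 \<and> l < k"
  "W4 i j l \<in> W_states N k \<longleftrightarrow> i < N S1 \<and> j < N S2 \<and> l < k"
  by (simp_all add: W_states_def)

text \<open>After the reception of the starred packet, obsolete means \<open>Old\<close> and up to
  date means \<open>New\<close>. Class 8 is entered only through a generation, which resets the
  clock to 0, and the clock then stands still; hence the value 0.\<close>

primrec sys_of_Y :: "ystate \<Rightarrow> nat sys" where
  "sys_of_Y (Y1 i j l) = Sys (Some (Star, i)) (Some (Old, j)) l"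
| "sys_of_Y (Y2 i j l) = Sys (Some (Star, i)) (Some (New, j)) l"
| "sys_of_Y (Y3 i j l) = Sys (Some (New, i)) (Some (Star, j)) l"
| "sys_of_Y (Y4 i j l) = Sys (Some (Old, i)) (Some (Star, j)) l"
| "sys_of_Y (Y5 i l) = Sys (Some (Star, i)) None l"
| "sys_of_Y (Y6 j l) = Sys None (Some (Star, j)) l"
| "sys_of_Y (Y7 l) = Sys None None l"
| "sys_of_Y (Y8 i j) = Sys (Some (New, i)) (Some (New, j)) 0"
| "sys_of_Y (Y9 i l) = Sys (Some (Old, i)) None l"
| "sys_of_Y (Y10 j l) = Sys None (Some (Old, j)) l"
| "sys_of_Y (Y11 i j l) = Sys (Some (New, i)) (Some (Old, j)) l"
| "sys_of_Y (Y12 i j l) = Sys (Some (Old, i)) (Some (New, j)) l"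
| "sys_of_Y (Y13 i l) = Sys (Some (New, i)) None l"
| "sys_of_Y (Y14 j l) = Sys None (Some (New, j)) l"
| "sys_of_Y Y15 = Dead"
| "sys_of_Y Y16 = Dead"

primrec sys_of_W :: "wstate \<Rightarrow> nat sys" where
  "sys_of_W (W1 l) = Sys None None l"
| "sys_of_W (W2 i l) = Sys (Some (Old, i)) None l"
| "sys_of_W (W3 j l) = Sys None (Some (Old, j)) l"
| "sys_of_W (W4 i j l) = Sys (Some (Old, i)) (Some (Old, j)) l"

context queue
begin

lemma finite_advance [simp]: "finite (set_pmf (advance m s))"
  by (simp add: advance_def split: option.split prod.split)

lemma finite_perform [simp]: "finite (set_pmf (perform srv.fresh_phase a))"
  by (cases a) simp_all

lemma finite_phase_step [simp]: "finite (set_pmf (phase_step c z))"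
  by (cases z) simp_all

lemma finite_phase_law [simp]: "finite (set_pmf (phase_law c j))"
  by (induction j) simp_all

lemma expectation_perform [simp]:
  "measure_pmf.expectation (perform srv.fresh_phase (Go z)) f = (f z :: real)"
  "measure_pmf.expectation (perform srv.fresh_phase (Gen m h)) f = (\<Sum>i<N m. \<alpha> m $ i * f (h i) :: real)"
  by (simp_all add: srv.expectation_fresh_phase)

lemma expectation_advance [simp]:
  "measure_pmf.expectation (advance m None) f = (f None :: real)"
  "i < N m \<Longrightarrow> measure_pmf.expectation (advance m (Some (c, i))) f =
     (exit_vec (B m) $ i * f None + (\<Sum>i'<N m. B m $$ (i, i') * f (Some (c, i'))) :: real)"
  by (simp_all add: advance_def srv.expectation_next_phase)

lemma expectation_phase_step:
  "measure_pmf.expectation (phase_step c (Sys s1 s2 l)) f =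
   measure_pmf.expectation (advance S1 s1) (\<lambda>s1'. measure_pmf.expectation (advance S2 s2) (\<lambda>s2'.
     measure_pmf.expectation (perform srv.fresh_phase (settle k pr c s1 s2 s1' s2' l)) f :: real))"
  by (simp add: expectation_bind_finite)

lemmas settle_eval = settle_def target_def put_def srv.expectation_fresh_phase

text \<open>The instantiated swap brings the double sums over phases of both servers into one order,
  so that both sides of a row identity reach a common normal form.\<close>

lemmas sum_normal = sum_distrib_left sum_distrib_right sum.distrib distrib_left mult_ac
  sum.swap[of _ "{..<N S1}" "{..<N S2}"]

lemmas Y_row_eval = Y_to_F_def Y_stay_def frozen_def unfrozen_def

text \<open>The listed transitions are those of the tagged phase system after the reference slot.
  Because \<open>f\<close> vanishes at \<open>Dead\<close>, the absorbing weights drop out on both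
  sides, although the rows merge events that the phase system keeps apart.\<close>

lemma Y_row_expectation:
  assumes y: "y \<in> set (Y_transient N k)" and dead: "f Dead = 0"
  shows "measure_pmf.expectation (phase_step New (sys_of_Y y)) f =
    row_sum (Y_row N \<alpha> B k pr y) (\<lambda>y. f (sys_of_Y y))"
proof (cases y)
  case (Y1 i j l)
  then have "i < N S1" "j < N S2" "l < k" using y by simp_all
  then show ?thesis
    unfolding Y1 sys_of_Y.simps expectation_phase_step
    by (cases "l < k - 1"; cases pr) (auto simp: settle_eval Y_row_eval sum_normal dead min_def not_less)
next
  case (Y2 i j l)
  then have "i < N S1" "j < N S2" "l < k" using y by simp_all
  then show ?thesis
    unfolding Y2 sys_of_Y.simps expectation_phase_step
    by (cases "l < k - 1"; cases pr) (auto simp: settle_eval Y_row_eval sum_normal dead min_def not_less)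
next
  case (Y3 i j l)
  then have "i < N S1" "j < N S2" "l < k" using y by simp_all
  then show ?thesis
    unfolding Y3 sys_of_Y.simps expectation_phase_step
    by (cases "l < k - 1"; cases pr) (auto simp: settle_eval Y_row_eval sum_normal dead min_def not_less)
next
  case (Y4 i j l)
  then have "i < N S1" "j < N S2" "l < k" using y by simp_all
  then show ?thesis
    unfolding Y4 sys_of_Y.simps expectation_phase_step
    by (cases "l < k - 1"; cases pr) (auto simp: settle_eval Y_row_eval sum_normal dead min_def not_less)
next
  case (Y5 i l)
  then have "i < N S1" "l < k" using y by simp_all
  then show ?thesis
    unfolding Y5 sys_of_Y.simps expectation_phase_step
    by (cases "l < k - 1"; cases pr) (auto simp: settle_eval Y_row_eval sum_normal dead min_def not_less)
next
  case (Y6 j l)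
  then have "j < N S2" "l < k" using y by simp_all
  then show ?thesis
    unfolding Y6 sys_of_Y.simps expectation_phase_step
    by (cases "l < k - 1"; cases pr) (auto simp: settle_eval Y_row_eval sum_normal dead min_def not_less)
next
  case (Y7 l)
  then have "l < k" using y by simp
  then show ?thesis
    unfolding Y7 sys_of_Y.simps expectation_phase_step
    by (cases "l < k - 1"; cases pr) (auto simp: settle_eval Y_row_eval sum_normal dead min_def not_less)
next
  case (Y8 i j)
  then have "i < N S1" "j < N S2" using y by simp_all
  then show ?thesis
    unfolding Y8 sys_of_Y.simps expectation_phase_step
    by (auto simp: settle_eval Y_row_eval sum_normal dead)
next
  case (Y9 i l)
  then have "i < N S1" "l < k" using y by simp_all
  then show ?thesis
    unfolding Y9 sys_of_Y.simps expectation_phase_step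
    by (cases "l < k - 1"; cases pr) (auto simp: settle_eval Y_row_eval sum_normal dead min_def not_less)
next
  case (Y10 j l)
  then have "j < N S2" "l < k" using y by simp_all
  then show ?thesis
    unfolding Y10 sys_of_Y.simps expectation_phase_step
    by (cases "l < k - 1"; cases pr) (auto simp: settle_eval Y_row_eval sum_normal dead min_def not_less)
next
  case (Y11 i j l)
  then have "i < N S1" "j < N S2" "l < k" using y by simp_all
  then show ?thesis
    unfolding Y11 sys_of_Y.simps expectation_phase_step
    by (cases "l < k - 1"; cases pr) (auto simp: settle_eval Y_row_eval sum_normal dead min_def not_less)
next
  case (Y12 i j l)
  then have "i < N S1" "j < N S2" "l < k" using y by simp_all
  then show ?thesis
    unfolding Y12 sys_of_Y.simps expectation_phase_step
    by (cases "l < k - 1"; cases pr) (auto simp: settle_eval Y_row_eval sum_normal dead min_def not_less)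
next
  case (Y13 i l)
  then have "i < N S1" "l < k" using y by simp_all
  then show ?thesis
    unfolding Y13 sys_of_Y.simps expectation_phase_step
    by (cases "l < k - 1"; cases pr) (auto simp: settle_eval Y_row_eval sum_normal dead min_def not_less)
next
  case (Y14 j l)
  then have "j < N S2" "l < k" using y by simp_all
  then show ?thesis
    unfolding Y14 sys_of_Y.simps expectation_phase_step
    by (cases "l < k - 1"; cases pr) (auto simp: settle_eval Y_row_eval sum_normal dead min_def not_less)
qed (use y in simp_all)

lemma W_row_expectation:
  assumes w: "w \<in> W_states N k"
  shows "measure_pmf.expectation (phase_step Old (sys_of_W w)) f =
    row_sum (W_row N \<alpha> B k pr w) (\<lambda>w. f (sys_of_W w))"
proof (cases w)
  case (W1 l)
  then have "l < k" using w by simp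
  then show ?thesis
    unfolding W1 sys_of_W.simps expectation_phase_step
    by (cases "l < k - 1"; cases pr) (auto simp: settle_eval W_to_F_def frozen_def unfrozen_def sum_normal min_def not_less)
next
  case (W2 i l)
  then have "i < N S1" "l < k" using w by simp_all
  then show ?thesis
    unfolding W2 sys_of_W.simps expectation_phase_step
    by (cases "l < k - 1"; cases pr) (auto simp: settle_eval W_to_F_def frozen_def unfrozen_def sum_normal min_def not_less)
next
  case (W3 j l)
  then have "j < N S2" "l < k" using w by simp_all
  then show ?thesis
    unfolding W3 sys_of_W.simps expectation_phase_step
    by (cases "l < k - 1"; cases pr) (auto simp: settle_eval W_to_F_def frozen_def unfrozen_def sum_normal min_def not_less)
next
  case (W4 i j l)
  then have "i < N S1" "j < N S2" "l < k" using w by simp_all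
  then show ?thesis
    unfolding W4 sys_of_W.simps expectation_phase_step
    by (cases "l < k - 1"; cases pr) (auto simp: settle_eval W_to_F_def frozen_def unfrozen_def sum_normal min_def not_less)
qed

text \<open>The dual of \<open>q_init\<close>, see \<open>sum_start_value\<close> below.\<close>

definition start_value :: "(ystate \<Rightarrow> real) \<Rightarrow> wstate \<Rightarrow> real" where
  "start_value f w =
     (let b1 = \<lambda>i. exit_vec (B S1) $ i; b2 = \<lambda>j. exit_vec (B S2) $ j;
          F = (case pr of S1 \<Rightarrow> \<Sum>i<N S1. \<alpha> S1 $ i * f (Y5 i 0) | S2 \<Rightarrow> \<Sum>j<N S2. \<alpha> S2 $ j * f (Y6 j 0));
          on1 = \<lambda>j. \<Sum>j'<N S2. \<Sum>i'<N S1. B S2 $$ (j, j') * \<alpha> S1 $ i' * f (Y1 i' j' 0);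
          on2 = \<lambda>i. \<Sum>i'<N S1. \<Sum>j'<N S2. B S1 $$ (i, i') * \<alpha> S2 $ j' * f (Y4 i' j' 0)
      in case w of
          W1 l \<Rightarrow> if l = k - 1 then F else 0
        | W2 i l \<Rightarrow> if l = k - 1 then b1 i * F + on2 i else 0
        | W3 j l \<Rightarrow> if l = k - 1 then b2 j * F + on1 j else 0
        | W4 i j l \<Rightarrow> if l = k - 1 then b1 i * b2 j * F + b1 i * on1 j + b2 j * on2 i else 0)"

text \<open>At the reference slot every outcome without a generation is \<open>Dead\<close> and
  contributes nothing. What survives starts from clock \<open>k - 1\<close> and ends in class 1, 4,
  5 or 6 with clock 0.\<close>

lemma start_expectation:
  assumes w: "w \<in> W_states N k" and dead: "f Dead = 0"
  shows "measure_pmf.expectation (phase_step Star (sys_of_W w)) f = start_value (\<lambda>y. f (sys_of_Y y)) w"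
proof (cases w)
  case (W1 l)
  then have "l < k" using w by simp
  then show ?thesis
    unfolding W1 sys_of_W.simps expectation_phase_step start_value_def Let_def
    by (cases "l < k - 1"; cases pr) (auto simp: settle_eval sum_normal dead not_less)
next
  case (W2 i l)
  then have "i < N S1" "l < k" using w by simp_all
  then show ?thesis
    unfolding W2 sys_of_W.simps expectation_phase_step start_value_def Let_def
    by (cases "l < k - 1"; cases pr) (auto simp: settle_eval sum_normal dead not_less)
next
  case (W3 j l)
  then have "j < N S2" "l < k" using w by simp_all
  then show ?thesis
    unfolding W3 sys_of_W.simps expectation_phase_step start_value_def Let_def
    by (cases "l < k - 1"; cases pr) (auto simp: settle_eval sum_normal dead not_less)
next
  case (W4 i j l)
  then have "i < N S1" "j < N S2" "l < k" using w by simp_all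
  then show ?thesis
    unfolding W4 sys_of_W.simps expectation_phase_step start_value_def Let_def
    by (cases "l < k - 1"; cases pr) (auto simp: settle_eval sum_normal dead not_less)
qed

end

definition row_all :: "('s \<Rightarrow> real \<Rightarrow> bool) \<Rightarrow> ('s \<times> real) list \<Rightarrow> bool" where
  "row_all P xs \<longleftrightarrow> (\<forall>x\<in>set xs. P (fst x) (snd x))"

lemma row_all_simps [simp]:
  "row_all P []" "row_all P ((t, w) # xs) \<longleftrightarrow> P t w \<and> row_all P xs"
  "row_all P (xs @ ys) \<longleftrightarrow> row_all P xs \<and> row_all P ys"
  "row_all P (map (\<lambda>i. (t' i, w' i)) [0..<n]) \<longleftrightarrow> (\<forall>i<n. P (t' i) (w' i))"
  "row_all P (concat (map f [0..<n])) \<longleftrightarrow> (\<forall>i<n. row_all P (f i))"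
  by (auto simp: row_all_def ball_Un)

context queue
begin

subsection \<open>Evolution of the state probabilities\<close>

abbreviation "Y_tr \<equiv> set (Y_transient N k)"
abbreviation "Y_all \<equiv> Y_tr \<union> {Y15, Y16}"
abbreviation "W_all \<equiv> W_states N k"

lemma Y_row_pairs:
  assumes "y \<in> Y_tr"
  shows "row_all (\<lambda>t w. t \<in> Y_all \<and> (t \<in> Y_tr \<longrightarrow> 0 \<le> w)) (Y_row N \<alpha> B k pr y)"
  by (cases y; cases pr; insert assms k_pos)
     (simp_all add: less_diff_conv Y_to_F_def Y_stay_def frozen_def unfrozen_def
        srv.exit_nonneg srv.B_nonneg srv.init_nonneg)

lemma W_row_pairs:
  assumes "w \<in> W_all"
  shows "row_all (\<lambda>t x. t \<in> W_all \<and> 0 \<le> x) (W_row N \<alpha> B k pr w)"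
  by (cases w; cases pr; insert assms k_pos)
     (simp_all add: less_diff_conv W_to_F_def frozen_def unfrozen_def
        srv.exit_nonneg srv.B_nonneg srv.init_nonneg)

lemma Y_row_targets: "y \<in> Y_tr \<Longrightarrow> fst ` set (Y_row N \<alpha> B k pr y) \<subseteq> Y_all"
  using Y_row_pairs unfolding row_all_def by blast

lemma W_row_targets: "w \<in> W_all \<Longrightarrow> fst ` set (W_row N \<alpha> B k pr w) \<subseteq> W_all"
  using W_row_pairs unfolding row_all_def by blast

definition W_list :: "wstate list" where
  "W_list = [W1 l. l \<leftarrow> [0..<k]] @ [W2 i l. i \<leftarrow> [0..<N S1], l \<leftarrow> [0..<k]] @
     [W3 j l. j \<leftarrow> [0..<N S2], l \<leftarrow> [0..<k]] @
     [W4 i j l. i \<leftarrow> [0..<N S1], j \<leftarrow> [0..<N S2], l \<leftarrow> [0..<k]]"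

lemma set_W_list: "set W_list = W_all"
  by (auto simp: W_list_def W_states_def image_iff)

lemma finite_W [simp]: "finite W_all"
  unfolding set_W_list[symmetric] by simp

lemma distinct_W_list: "distinct W_list"
  unfolding W_list_def by (auto simp: distinct_map intro!: distinct_concat_map inj_onI)

lemma sum_list_concat_upt: "sum_list (map f (concat (map g [0..<n]))) = (\<Sum>i<n. sum_list (map f (g i)) :: real)"
proof -
  have "sum_list (map f (concat (map g js))) = (\<Sum>j\<leftarrow>js. sum_list (map f (g j)))" for js :: "nat list"
    by (induction js) simp_all
  then show ?thesis by (simp add: interv_sum_list_conv_sum_set_nat atLeast0LessThan)
qed

lemma sum_list_upt: "sum_list (map f (map g [0..<n])) = (\<Sum>i<n. f (g i) :: real)"
  by (simp add: interv_sum_list_conv_sum_set_nat atLeast0LessThan comp_def)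

lemma sum_W: "(\<Sum>w\<in>W_all. f w) = (\<Sum>l<k. f (W1 l)) + (\<Sum>i<N S1. \<Sum>l<k. f (W2 i l)) +
    (\<Sum>j<N S2. \<Sum>l<k. f (W3 j l)) + (\<Sum>i<N S1. \<Sum>j<N S2. \<Sum>l<k. f (W4 i j l) :: real)"
proof -
  have "(\<Sum>w\<in>W_all. f w) = sum_list (map f W_list)"
    unfolding set_W_list[symmetric] by (rule sum.distinct_set_conv_list[OF distinct_W_list])
  then show ?thesis
    unfolding W_list_def by (simp only: map_append sum_list_append sum_list_concat_upt sum_list_upt add.assoc)
qed

lemma sum_Y_init: "(\<Sum>y\<in>Y_tr. q_init N \<alpha> B k pr p y * f y) =
    (\<Sum>i<N S1. \<Sum>j<N S2. q_init N \<alpha> B k pr p (Y1 i j 0) * f (Y1 i j 0)) +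
    (\<Sum>i<N S1. \<Sum>j<N S2. q_init N \<alpha> B k pr p (Y4 i j 0) * f (Y4 i j 0)) +
    (\<Sum>i<N S1. q_init N \<alpha> B k pr p (Y5 i 0) * f (Y5 i 0)) +
    (\<Sum>j<N S2. q_init N \<alpha> B k pr p (Y6 j 0) * f (Y6 j 0))"
proof -
  have delta: "(\<Sum>l<k. (if l = 0 then x else 0) * g l) = x * g 0"
    "(\<Sum>l<k. (if c \<and> l = 0 then x else 0) * g l) = (if c then x else 0) * g 0"
    for x :: real and g :: "nat \<Rightarrow> real" and c
    using k_pos by (cases k; simp add: sum.lessThan_Suc_shift del: sum.lessThan_Suc)+
  show ?thesis
    unfolding sum.distinct_set_conv_list[OF distinct_Y_transient]
    by (simp only: Y_transient_def map_append sum_list_append sum_list_concat_upt sum_list_upt)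
      (simp only: q_init.simps delta mult_zero_left sum.neutral_const add_0_left add_0_right
        if_True simp_thms add.assoc)
qed

text \<open>Interchange of sums for class 1: on the left the initial states are outermost, on the
  right the recurrent states from which they arise.\<close>

lemma sum_on1:
  fixes D :: "nat \<Rightarrow> nat \<Rightarrow> real"
  shows "(\<Sum>i'<n. \<Sum>j'<m. ((\<Sum>j<m. D j j' * a i' * x j) + (\<Sum>i<n. \<Sum>j<m. b i * D j j' * a i' * z i j)) * f i' j') =
    (\<Sum>j<m. x j * (\<Sum>j'<m. \<Sum>i'<n. D j j' * a i' * f i' j')) +
    (\<Sum>i<n. \<Sum>j<m. z i j * (b i * (\<Sum>j'<m. \<Sum>i'<n. D j j' * a i' * f i' j')))"
proof -
  \<comment> \<open>The total weight of the ways to have \<open>S1\<close> free for a new packet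
    while \<open>S2\<close> was in phase \<open>j\<close>: \<open>S1\<close> was already idle, or it
    finishes in this slot.\<close>
  let ?c = "\<lambda>j. x j + (\<Sum>i<n. b i * z i j)"
  have in_eq: "(\<Sum>j<m. D j j' * a i' * x j) + (\<Sum>i<n. \<Sum>j<m. b i * D j j' * a i' * z i j) =
    (\<Sum>j<m. ?c j * (D j j' * a i'))" for i' j'
    by (subst sum.swap) (simp add: sum_distrib_left sum_distrib_right sum.distrib distrib_left distrib_right mult_ac)
  have "(\<Sum>i'<n. \<Sum>j'<m. (\<Sum>j<m. ?c j * (D j j' * a i')) * f i' j') =
    (\<Sum>j'<m. \<Sum>i'<n. \<Sum>j<m. ?c j * (D j j' * a i' * f i' j'))"
    by (subst sum.swap) (simp add: sum_distrib_right mult.assoc)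
  also have "\<dots> = (\<Sum>j'<m. \<Sum>j<m. \<Sum>i'<n. ?c j * (D j j' * a i' * f i' j'))"
    by (intro sum.cong refl sum.swap)
  also have "\<dots> = (\<Sum>j<m. ?c j * (\<Sum>j'<m. \<Sum>i'<n. D j j' * a i' * f i' j'))"
    by (subst sum.swap) (simp add: sum_distrib_left)
  also have "\<dots> = (\<Sum>j<m. x j * (\<Sum>j'<m. \<Sum>i'<n. D j j' * a i' * f i' j')) +
    (\<Sum>j<m. \<Sum>i<n. z i j * (b i * (\<Sum>j'<m. \<Sum>i'<n. D j j' * a i' * f i' j')))"
    by (simp only: distrib_right sum.distrib sum_distrib_right mult_ac)
  also have "(\<Sum>j<m. \<Sum>i<n. z i j * (b i * (\<Sum>j'<m. \<Sum>i'<n. D j j' * a i' * f i' j'))) =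
    (\<Sum>i<n. \<Sum>j<m. z i j * (b i * (\<Sum>j'<m. \<Sum>i'<n. D j j' * a i' * f i' j')))"
    by (rule sum.swap)
  finally show ?thesis by (simp only: in_eq)
qed

text \<open>The mirror image of \<open>sum_on1\<close>, with the two servers exchanged.\<close>

lemma sum_on2:
  fixes D :: "nat \<Rightarrow> nat \<Rightarrow> real"
  shows "(\<Sum>i'<n. \<Sum>j'<m. ((\<Sum>i<n. D i i' * a j' * x i) + (\<Sum>i<n. \<Sum>j<m. b j * D i i' * a j' * z i j)) * f i' j') =
    (\<Sum>i<n. x i * (\<Sum>i'<n. \<Sum>j'<m. D i i' * a j' * f i' j')) +
    (\<Sum>i<n. \<Sum>j<m. z i j * (b j * (\<Sum>i'<n. \<Sum>j'<m. D i i' * a j' * f i' j')))"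
proof -
  have "(\<Sum>i'<n. \<Sum>j'<m. ((\<Sum>i<n. D i i' * a j' * x i) + (\<Sum>i<n. \<Sum>j<m. b j * D i i' * a j' * z i j)) * f i' j') =
    (\<Sum>j'<m. \<Sum>i'<n. ((\<Sum>i<n. D i i' * a j' * x i) + (\<Sum>j<m. \<Sum>i<n. b j * D i i' * a j' * z i j)) * f i' j')"
    by (subst sum.swap) (intro sum.cong refl arg_cong2[where f = times] arg_cong2[where f = plus] sum.swap)
  also have "\<dots> = (\<Sum>i<n. x i * (\<Sum>i'<n. \<Sum>j'<m. D i i' * a j' * f i' j')) +
    (\<Sum>j<m. \<Sum>i<n. z i j * (b j * (\<Sum>i'<n. \<Sum>j'<m. D i i' * a j' * f i' j')))"
    by (rule sum_on1[where f = "\<lambda>j' i'. f i' j'" and z = "\<lambda>j i. z i j"])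
  finally show ?thesis
    by (simp only: sum.swap[of "\<lambda>j i. z i j * (b j * (\<Sum>i'<n. \<Sum>j'<m. D i i' * a j' * f i' j'))"])
qed

text \<open>Duality: \<open>q\<close> is the image of \<open>p\<close> under the transpose of
  \<open>start_value\<close>. A limit obtained as an average over the recurrent states can thus be
  read as a value of the absorbing chain.\<close>

lemma sum_start_value:
  "(\<Sum>w\<in>W_all. p w * start_value f w) = (\<Sum>y\<in>Y_tr. q_init N \<alpha> B k pr p y * f y)"
proof -
  have delta: "(\<Sum>l<k. g l * (if l = k - 1 then x else 0)) = g (k - 1) * x" for x :: real and g
  proof -
    have "(\<Sum>l<k. g l * (if l = k - 1 then x else 0)) = (\<Sum>l<k. if l = k - 1 then g l * x else 0)"
      by (intro sum.cong) auto
    then show ?thesis using k_pos by simp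
  qed
  let ?F = "case pr of S1 \<Rightarrow> \<Sum>i<N S1. \<alpha> S1 $ i * f (Y5 i 0) | S2 \<Rightarrow> \<Sum>j<N S2. \<alpha> S2 $ j * f (Y6 j 0)"
  have F: "(\<Sum>i<N S1. q_init N \<alpha> B k pr p (Y5 i 0) * f (Y5 i 0)) +
      (\<Sum>j<N S2. q_init N \<alpha> B k pr p (Y6 j 0) * f (Y6 j 0)) = omega N B k p * ?F"
    by (cases pr) (simp_all add: sum_distrib_left mult_ac)
  have omega: "omega N B k p * x = p (W1 (k - 1)) * x + (\<Sum>i<N S1. p (W2 i (k - 1)) * (exit_vec (B S1) $ i * x)) +
    (\<Sum>j<N S2. p (W3 j (k - 1)) * (exit_vec (B S2) $ j * x)) +
    (\<Sum>i<N S1. \<Sum>j<N S2. p (W4 i j (k - 1)) * (exit_vec (B S1) $ i * exit_vec (B S2) $ j * x))" for x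
    by (simp only: omega_def distrib_left distrib_right sum_distrib_left sum_distrib_right mult_ac)
  show ?thesis
    unfolding sum_W sum_Y_init add.assoc[of _ "\<Sum>i<N S1. q_init N \<alpha> B k pr p (Y5 i 0) * f (Y5 i 0)"] F omega
    unfolding start_value_def Let_def q_init.simps simp_thms if_True sum_on1 sum_on2
    by (simp only: wstate.case delta distrib_left sum.distrib)
qed

text \<open>The entry at \<open>y\<close> of \<open>A^h v\<close>, extended by zero to all states
  that are not transient.\<close>

primrec hit :: "nat \<Rightarrow> ystate \<Rightarrow> real" where
  "hit 0 y = (if y \<in> Y_C N k then 1 else 0)"
| "hit (Suc h) y = (if y \<in> Y_tr then row_sum (Y_row N \<alpha> B k pr y) (hit h) else 0)"

lemma hit_absorbed [simp]: "hit h Y15 = 0" "hit h Y16 = 0"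
  by (cases h; simp add: Y_C_def)+

text \<open>The law of the recurrent chain just before slot \<open>g\<close>, started empty with
  expired clock at the fictitious slot -1.\<close>

primrec occupation :: "nat \<Rightarrow> wstate \<Rightarrow> real" where
  "occupation 0 w = (if w = W1 (k - 1) then 1 else 0)"
| "occupation (Suc g) w = (\<Sum>v\<in>W_all. occupation g v * W_trans N \<alpha> B k pr v w)"

lemma row_sum_cong: "(\<And>t. t \<in> fst ` set xs \<Longrightarrow> f t = g t) \<Longrightarrow> row_sum xs f = row_sum xs g"
  unfolding row_sum_def by (intro arg_cong[where f = sum_list] map_cong) force+

lemma W_row_sum: "w \<in> W_all \<Longrightarrow> row_sum (W_row N \<alpha> B k pr w) f = (\<Sum>v\<in>W_all. W_trans N \<alpha> B k pr w v * f v)"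
  unfolding W_trans_def by (rule row_sum_entry[symmetric]) (simp_all add: W_row_targets)

lemma expectation_phase_law_Suc:
  "measure_pmf.expectation (phase_law c (Suc j)) f =
   measure_pmf.expectation (phase_law c j) (\<lambda>z. measure_pmf.expectation (phase_step (c j) z) f :: real)"
  by (simp add: expectation_bind_finite)

text \<open>Before the reference slot no packet is new, so nothing is ever lost and the phase system
  is the recurrent chain.\<close>

lemma expectation_old_phases:
  assumes "\<And>j. j < g \<Longrightarrow> c j = Old"
  shows "measure_pmf.expectation (phase_law c g) f = (\<Sum>w\<in>W_all. occupation g w * f (sys_of_W w))"
  using assms
proof (induction g arbitrary: f)
  case 0
  have "W1 (k - 1) \<in> W_all" using k_pos by simp
  then show ?case by (simp add: if_distrib[where f = "\<lambda>a. a * _"] cong: if_cong)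
next
  case (Suc g)
  have "measure_pmf.expectation (phase_law c (Suc g)) f =
    (\<Sum>v\<in>W_all. occupation g v * measure_pmf.expectation (phase_step Old (sys_of_W v)) f)"
    unfolding expectation_phase_law_Suc using Suc.prems by (subst Suc.IH) auto
  also have "\<dots> = (\<Sum>v\<in>W_all. \<Sum>w\<in>W_all. occupation g v * W_trans N \<alpha> B k pr v w * f (sys_of_W w))"
    by (intro sum.cong refl) (simp add: W_row_expectation W_row_sum sum_distrib_left mult.assoc)
  also have "\<dots> = (\<Sum>w\<in>W_all. occupation (Suc g) w * f (sys_of_W w))"
    by (subst sum.swap) (simp add: sum_distrib_right)
  finally show ?case .
qed

definition new_step :: "(nat sys \<Rightarrow> real) \<Rightarrow> nat sys \<Rightarrow> real" where
  "new_step f z = measure_pmf.expectation (phase_step New z) f"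

lemma expectation_new_phases:
  assumes "\<And>j. s \<le> j \<Longrightarrow> c j = New"
  shows "measure_pmf.expectation (phase_law c (s + h)) f =
    measure_pmf.expectation (phase_law c s) ((new_step ^^ h) f)"
proof (induction h arbitrary: f)
  case (Suc h)
  have "measure_pmf.expectation (phase_law c (s + Suc h)) f =
    measure_pmf.expectation (phase_law c (s + h)) (new_step f)"
    unfolding add_Suc_right expectation_phase_law_Suc using assms by (simp add: new_step_def[abs_def])
  then show ?case by (simp only: Suc.IH funpow_Suc_right comp_apply)
qed simp

abbreviation "deliv \<equiv> (\<lambda>z. if delivered z then 1 else 0 :: real)"

lemma new_step_Dead: "(new_step ^^ h) deliv Dead = 0"
  by (induction h) (simp_all add: new_step_def)

lemma new_step_eq_hit: "y \<in> Y_all \<Longrightarrow> (new_step ^^ h) deliv (sys_of_Y y) = hit h y"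
proof (induction h arbitrary: y)
  case 0
  have "delivered (sys_of_Y y) \<longleftrightarrow> non_P_star y" by (cases y) simp_all
  moreover have "y \<in> Y_C N k \<longleftrightarrow> non_P_star y" using 0 by (auto simp: Y_C_def)
  ultimately show ?case by simp
next
  case (Suc h)
  show ?case
  proof (cases "y \<in> Y_tr")
    case True
    have "(new_step ^^ Suc h) deliv (sys_of_Y y) =
      row_sum (Y_row N \<alpha> B k pr y) (\<lambda>y. (new_step ^^ h) deliv (sys_of_Y y))"
      unfolding funpow.simps comp_def new_step_def[of "(new_step ^^ h) deliv"]
      by (rule Y_row_expectation[OF True, of "(new_step ^^ h) deliv", OF new_step_Dead])
    also have "\<dots> = row_sum (Y_row N \<alpha> B k pr y) (hit h)"
      using Y_row_targets[OF True] by (intro row_sum_cong Suc.IH) blast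
    finally show ?thesis using True by simp
  next
    case False
    then have "y = Y15 \<or> y = Y16" using Suc.prems by auto
    then show ?thesis
      by (elim disjE; simp only: sys_of_Y.simps new_step_Dead hit_absorbed)
  qed
qed

lemma start_value_cong:
  assumes "\<And>y. y \<in> Y_tr \<Longrightarrow> f y = g y"
  shows "start_value f = start_value g"
proof -
  have "(\<Sum>i<N S1. \<alpha> S1 $ i * f (Y5 i 0)) = (\<Sum>i<N S1. \<alpha> S1 $ i * g (Y5 i 0))"
    "(\<Sum>j<N S2. \<alpha> S2 $ j * f (Y6 j 0)) = (\<Sum>j<N S2. \<alpha> S2 $ j * g (Y6 j 0))"
    "(\<Sum>j'<N S2. \<Sum>i'<N S1. B S2 $$ (j, j') * \<alpha> S1 $ i' * f (Y1 i' j' 0)) =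
     (\<Sum>j'<N S2. \<Sum>i'<N S1. B S2 $$ (j, j') * \<alpha> S1 $ i' * g (Y1 i' j' 0))"
    "(\<Sum>i'<N S1. \<Sum>j'<N S2. B S1 $$ (i, i') * \<alpha> S2 $ j' * f (Y4 i' j' 0)) =
     (\<Sum>i'<N S1. \<Sum>j'<N S2. B S1 $$ (i, i') * \<alpha> S2 $ j' * g (Y4 i' j' 0))" for i j
    using k_pos by (intro sum.cong refl; simp add: assms)+
  then show ?thesis unfolding start_value_def[abs_def] Let_def by (simp only:)
qed

lemma integral_measure_pmf_indicator: "measure_pmf.expectation q (indicator A) = measure_pmf.prob q A"
  by simp

text \<open>The tags cut the \<open>Suc (g + h)\<close> steps into \<open>g\<close> old ones,
  treated forwards by \<open>occupation\<close>, a single starred one, treated by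
  \<open>start_value\<close>, and \<open>h\<close> new ones, treated backwards by
  \<open>hit\<close>.\<close>

lemma prob_delivered:
  "measure_pmf.prob (phase_law (slot_tag g) (Suc (g + h))) {z. delivered z} =
   (\<Sum>w\<in>W_all. occupation g w * start_value (hit h) w)"
proof -
  have deliv: "deliv = indicator {z. delivered z}" by (auto simp: indicator_def)
  have "measure_pmf.prob (phase_law (slot_tag g) (Suc (g + h))) {z. delivered z} =
    measure_pmf.expectation (phase_law (slot_tag g) (Suc g + h)) (indicator {z. delivered z})"
    by (simp only: integral_measure_pmf_indicator add_Suc)
  also have "\<dots> = measure_pmf.expectation (phase_law (slot_tag g) (Suc g + h)) deliv"
    by (rule arg_cong[OF deliv[symmetric]])
  also have "\<dots> = measure_pmf.expectation (phase_law (slot_tag g) (Suc g)) ((new_step ^^ h) deliv)"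
    by (rule expectation_new_phases) (simp add: slot_tag_def)
  also have "\<dots> = measure_pmf.expectation (phase_law (slot_tag g) g)
      (\<lambda>z. measure_pmf.expectation (phase_step Star z) ((new_step ^^ h) deliv))"
    unfolding expectation_phase_law_Suc by (simp add: slot_tag_def)
  also have "\<dots> = (\<Sum>w\<in>W_all. occupation g w *
      measure_pmf.expectation (phase_step Star (sys_of_W w)) ((new_step ^^ h) deliv))"
    by (rule expectation_old_phases) (simp add: slot_tag_def)
  also have "\<dots> = (\<Sum>w\<in>W_all. occupation g w * start_value (hit h) w)"
  proof (intro sum.cong refl)
    fix w assume "w \<in> W_all"
    then have "measure_pmf.expectation (phase_step Star (sys_of_W w)) ((new_step ^^ h) deliv) =
      start_value (\<lambda>y. (new_step ^^ h) deliv (sys_of_Y y)) w"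
      by (rule start_expectation) (rule new_step_Dead)
    also have "\<dots> = start_value (hit h) w"
      by (rule fun_cong[OF start_value_cong]) (rule new_step_eq_hit, simp)
    finally show "occupation g w * measure_pmf.expectation (phase_step Star (sys_of_W w)) ((new_step ^^ h) deliv) =
      occupation g w * start_value (hit h) w" by simp
  qed
  finally show ?thesis .
qed

end

subsection \<open>Transience\<close>

context queue
begin

lemma row_sum_mono:
  "row_all (\<lambda>t w. w * f t \<le> w * g t) xs \<Longrightarrow> row_sum xs f \<le> row_sum xs g"
  unfolding row_sum_def row_all_def by (intro sum_list_mono) force

lemma row_all_mono: "row_all P xs \<Longrightarrow> (\<And>t w. P t w \<Longrightarrow> Q t w) \<Longrightarrow> row_all Q xs"
  by (auto simp: row_all_def)

lemma Y_row_sum_mono: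
  assumes "y \<in> Y_tr" "\<And>t. t \<in> Y_tr \<Longrightarrow> f t \<le> g t" "f Y15 = g Y15" "f Y16 = g Y16"
  shows "row_sum (Y_row N \<alpha> B k pr y) f \<le> row_sum (Y_row N \<alpha> B k pr y) g"
  by (rule row_sum_mono, rule row_all_mono[OF Y_row_pairs[OF assms(1)]])
     (use assms in \<open>auto intro: mult_left_mono\<close>)

lemma row_sum_add: "row_sum xs (\<lambda>t. f t + g t) = row_sum xs f + row_sum xs g"
  and row_sum_cmult: "row_sum xs (\<lambda>t. c * f t) = c * row_sum xs f"
  and row_sum_zero: "row_sum xs (\<lambda>_. 0) = 0"
  by (induction xs) (auto simp: algebra_simps)

text \<open>Obtained without adding up any row: the left side is the probability that one step of
  the phase system avoids \<open>Dead\<close>.\<close>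

lemma Y_row_alive_le_1:
  assumes "y \<in> Y_tr"
  shows "row_sum (Y_row N \<alpha> B k pr y) (\<lambda>t. if t \<in> Y_tr then 1 else 0) \<le> 1"
proof -
  let ?f = "\<lambda>z. if z = Dead then 0 else 1 :: real"
  have "row_sum (Y_row N \<alpha> B k pr y) (\<lambda>t. if t \<in> Y_tr then 1 else 0) =
    row_sum (Y_row N \<alpha> B k pr y) (\<lambda>t. ?f (sys_of_Y t))"
  proof (rule row_sum_cong)
    fix t assume "t \<in> fst ` set (Y_row N \<alpha> B k pr y)"
    then have "t \<in> Y_all" using Y_row_targets[OF assms] by blast
    then show "(if t \<in> Y_tr then 1 else 0) = ?f (sys_of_Y t)"
      by (cases t) auto
  qed
  also have "\<dots> = measure_pmf.expectation (phase_step New (sys_of_Y y)) ?f"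
    by (rule Y_row_expectation[OF assms, of ?f, symmetric]) simp
  also have "\<dots> \<le> 1"
    by (intro measure_pmf.integral_le_const integrable_measure_pmf_finite) auto
  finally show ?thesis .
qed

text \<open>The second component strictly decreases whenever the class changes. Within a class the mean
  remaining time (of the packet on \<open>S1\<close> if both servers are busy) drops by at least one per slot;
  weighting ranks with the maximal remaining time gives the Lyapunov function.\<close>

fun class_rank :: "ystate \<Rightarrow> nat \<times> nat" where
  "class_rank (Y1 i j l) = (1, 4)" | "class_rank (Y2 i j l) = (2, 2)"
| "class_rank (Y3 i j l) = (3, 2)" | "class_rank (Y4 i j l) = (4, 4)"
| "class_rank (Y5 i l) = (5, 3)" | "class_rank (Y6 j l) = (6, 3)"
| "class_rank (Y7 l) = (7, 2)" | "class_rank (Y8 i j) = (8, 0)"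
| "class_rank (Y9 i l) = (9, 3)" | "class_rank (Y10 j l) = (10, 3)"
| "class_rank (Y11 i j l) = (11, 2)" | "class_rank (Y12 i j l) = (12, 2)"
| "class_rank (Y13 i l) = (13, 1)" | "class_rank (Y14 j l) = (14, 1)"
| "class_rank Y15 = (15, 0)" | "class_rank Y16 = (16, 0)"

fun remaining :: "ystate \<Rightarrow> real" where
  "remaining (Y1 i j l) = srv.mean_residual S1 i"
| "remaining (Y2 i j l) = srv.mean_residual S1 i"
| "remaining (Y3 i j l) = srv.mean_residual S1 i"
| "remaining (Y4 i j l) = srv.mean_residual S1 i"
| "remaining (Y5 i l) = srv.mean_residual S1 i"
| "remaining (Y6 j l) = srv.mean_residual S2 j"
| "remaining (Y7 l) = real k - real l"
| "remaining (Y8 i j) = srv.mean_residual S1 i"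
| "remaining (Y9 i l) = srv.mean_residual S1 i"
| "remaining (Y10 j l) = srv.mean_residual S2 j"
| "remaining (Y11 i j l) = srv.mean_residual S1 i"
| "remaining (Y12 i j l) = srv.mean_residual S1 i"
| "remaining (Y13 i l) = srv.mean_residual S1 i"
| "remaining (Y14 j l) = srv.mean_residual S2 j"
| "remaining _ = 0"

definition remaining_max :: real where
  "remaining_max = real k + (\<Sum>i<N S1. srv.mean_residual S1 i) + (\<Sum>j<N S2. srv.mean_residual S2 j)"

lemma remaining_ge_1: "y \<in> Y_tr \<Longrightarrow> 1 \<le> remaining y"
  by (cases y) (auto simp: srv.mean_residual_ge_1)

lemma mean_residual_le_max:
  "i < N S1 \<Longrightarrow> srv.mean_residual S1 i \<le> remaining_max"
  "j < N S2 \<Longrightarrow> srv.mean_residual S2 j \<le> remaining_max"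
proof -
  have nonneg: "0 \<le> srv.mean_residual m i" if "i < N m" for m i
    using srv.mean_residual_ge_1[OF that] by simp
  have sums: "0 \<le> (\<Sum>i<N m. srv.mean_residual m i)" for m
    by (intro sum_nonneg nonneg) simp
  have le: "srv.mean_residual m i \<le> (\<Sum>i<N m. srv.mean_residual m i)" if "i < N m" for m i
    using that by (intro member_le_sum nonneg) auto
  show "i < N S1 \<Longrightarrow> srv.mean_residual S1 i \<le> remaining_max"
    using le[of i S1] sums[of S2] by (simp add: remaining_max_def)
  show "j < N S2 \<Longrightarrow> srv.mean_residual S2 j \<le> remaining_max"
    using le[of j S2] sums[of S1] by (simp add: remaining_max_def)
qed

lemma k_le_remaining_max: "real k \<le> remaining_max"
proof -
  have "0 \<le> (\<Sum>i<N m. srv.mean_residual m i)" for m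
    by (intro sum_nonneg order.trans[OF zero_le_one] srv.mean_residual_ge_1) simp
  from this[of S1] this[of S2] show ?thesis by (simp add: remaining_max_def)
qed

lemma remaining_le_max: "y \<in> Y_tr \<Longrightarrow> remaining y \<le> remaining_max"
  using k_le_remaining_max by (cases y) (auto simp: mean_residual_le_max)

text \<open>The graph of class changes is acyclic, and the rank of a transient class is the length
  of the longest path from it to class 8.\<close>

lemma Y_row_rank:
  "y \<in> Y_tr \<Longrightarrow> row_all (\<lambda>t w. t \<in> Y_tr \<longrightarrow> class_rank t = class_rank y \<or> snd (class_rank t) < snd (class_rank y))
     (Y_row N \<alpha> B k pr y)"
  by (cases y; cases pr) (simp_all add: Y_to_F_def Y_stay_def frozen_def unfrozen_def)

text \<open>The mean residual time on \<open>S1\<close> drops by one, and the probability that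
  \<open>S2\<close> stays busy only shrinks the remaining nonnegative quantity.\<close>

lemma both_busy_mean_le:
  assumes "i < N S1" "j < N S2"
  shows "(\<Sum>i'<N S1. \<Sum>j'<N S2. B S1 $$ (i, i') * B S2 $$ (j, j') * srv.mean_residual S1 i') \<le>
    srv.mean_residual S1 i - 1"
proof -
  have "(\<Sum>i'<N S1. \<Sum>j'<N S2. B S1 $$ (i, i') * B S2 $$ (j, j') * srv.mean_residual S1 i') =
    (\<Sum>j'<N S2. B S2 $$ (j, j')) * (\<Sum>i'<N S1. B S1 $$ (i, i') * srv.mean_residual S1 i')"
    by (simp add: sum_product mult_ac) (rule sum.swap)
  also have "\<dots> \<le> 1 * (srv.mean_residual S1 i - 1)"
    unfolding srv.mean_residual_step[OF assms(1)]
    using assms srv.B_row_le[of j S2] srv.mean_residual_ge_1[of i S1] by (intro mult_right_mono) auto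
  finally show ?thesis by simp
qed

text \<open>Where the class must change the left side is 0 and \<open>ge\<close> suffices. In class
  7 the remaining time is the deterministic wait until the clock expires; elsewhere a mean residual
  time decreases.\<close>

lemma Y_row_same_class:
  assumes y: "y \<in> Y_tr"
  shows "row_sum (Y_row N \<alpha> B k pr y) (\<lambda>t. if class_rank t = class_rank y then remaining t else 0) \<le>
    remaining y - 1"
proof -
  have ge: "1 \<le> remaining y" by (rule remaining_ge_1[OF y])
  note eval = Y_to_F_def Y_stay_def frozen_def unfrozen_def both_busy_mean_le srv.mean_residual_step
  show ?thesis
    by (cases y; cases pr; insert y ge; simp add: eval; linarith?)
qed

definition lyapunov :: "ystate \<Rightarrow> real" where
  "lyapunov y = (if y \<in> Y_tr then real (snd (class_rank y)) * remaining_max + remaining y else 0)"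

lemma remaining_max_nonneg: "0 \<le> remaining_max"
  using k_le_remaining_max by simp

lemma lyapunov_ge_1: "y \<in> Y_tr \<Longrightarrow> 1 \<le> lyapunov y"
  using remaining_ge_1 remaining_max_nonneg by (simp add: lyapunov_def add_increasing)

lemma lyapunov_nonneg: "0 \<le> lyapunov y"
  using lyapunov_ge_1[of y] by (cases "y \<in> Y_tr") (simp_all, simp add: lyapunov_def)

lemma row_all_conj: "row_all P xs \<Longrightarrow> row_all Q xs \<Longrightarrow> row_all (\<lambda>t w. P t w \<and> Q t w) xs"
  by (auto simp: row_all_def)

lemma lyapunov_step:
  assumes y: "y \<in> Y_tr"
  shows "row_sum (Y_row N \<alpha> B k pr y) lyapunov \<le> lyapunov y - 1"
proof -
  let ?r = "real (snd (class_rank y))" and ?row = "Y_row N \<alpha> B k pr y"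
  let ?alive = "\<lambda>t. if t \<in> Y_tr then 1 else 0 :: real"
  let ?same = "\<lambda>t. if class_rank t = class_rank y then remaining t else 0"
  have not_absorbed: "class_rank Y15 \<noteq> class_rank y" "class_rank Y16 \<noteq> class_rank y"
    by (cases y; insert y; simp)+
  have "row_sum ?row lyapunov \<le> row_sum ?row (\<lambda>t. ?r * remaining_max * ?alive t + ?same t)"
  proof (rule row_sum_mono, rule row_all_mono[OF row_all_conj[OF Y_row_pairs[OF y] Y_row_rank[OF y]]])
    fix t and w :: real
    assume a: "(t \<in> Y_all \<and> (t \<in> Y_tr \<longrightarrow> 0 \<le> w)) \<and>
      (t \<in> Y_tr \<longrightarrow> class_rank t = class_rank y \<or> snd (class_rank t) < snd (class_rank y))"
    show "w * lyapunov t \<le> w * (?r * remaining_max * ?alive t + ?same t)"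
    proof (cases "t \<in> Y_tr")
      case True
      have "lyapunov t \<le> ?r * remaining_max + ?same t"
      proof (cases "class_rank t = class_rank y")
        case False
        \<comment> \<open>The loss of one rank frees \<open>remaining_max\<close>, which pays for
          whatever remaining time the new class has.\<close>
        then have "real (snd (class_rank t)) + 1 \<le> ?r" using a True by (simp add: of_nat_less_iff[symmetric] del: of_nat_less_iff)
        then have "(real (snd (class_rank t)) + 1) * remaining_max \<le> ?r * remaining_max"
          by (rule mult_right_mono[OF _ remaining_max_nonneg])
        then show ?thesis
          using False True remaining_le_max[OF True] by (simp add: lyapunov_def distrib_right)
      qed (use True in \<open>simp add: lyapunov_def\<close>)
      then show ?thesis using a True by (auto intro: mult_left_mono)
    next
      case False
      then have "t = Y15 \<or> t = Y16" using a by auto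
      then show ?thesis using not_absorbed by (auto simp: lyapunov_def)
    qed
  qed
  also have "\<dots> = ?r * remaining_max * row_sum ?row ?alive + row_sum ?row ?same"
    by (simp only: row_sum_add row_sum_cmult)
  also have "\<dots> \<le> ?r * remaining_max * 1 + (remaining y - 1)"
    using y by (intro add_mono mult_left_mono Y_row_alive_le_1 Y_row_same_class) (auto simp: remaining_max_nonneg)
  finally show ?thesis using y by (simp add: lyapunov_def)
qed

lemma row_sum_nonneg: "row_all (\<lambda>t w. 0 \<le> w * f t) xs \<Longrightarrow> 0 \<le> row_sum xs f"
  unfolding row_sum_def row_all_def by (intro sum_list_nonneg) force

lemma hit_nonneg: "0 \<le> hit h y"
proof (induction h arbitrary: y)
  case (Suc h)
  have "0 \<le> row_sum (Y_row N \<alpha> B k pr y) (hit h)" if y: "y \<in> Y_tr"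
    by (rule row_sum_nonneg, rule row_all_mono[OF Y_row_pairs[OF y]]) (auto simp: Suc.IH)
  then show ?case by simp
qed simp

lemma row_sum_sum: "row_sum xs (\<lambda>t. \<Sum>h<n. f h t) = (\<Sum>h<n. row_sum xs (f h))" for n :: nat
  by (induction n) (simp_all add: row_sum_add row_sum_zero)

text \<open>The expected number of slots spent in the non-starred classes is at most the expected
  lifetime: each step costs \<open>lyapunov\<close> at least 1 and earns at most 1.\<close>

lemma sum_hit_le_lyapunov: "(\<Sum>h<n. hit h y) \<le> lyapunov y"
proof (induction n arbitrary: y)
  case 0
  then show ?case by (simp add: lyapunov_nonneg)
next
  case (Suc n)
  show ?case
  proof (cases "y \<in> Y_tr")
    case True
    have "(\<Sum>h<Suc n. hit h y) = hit 0 y + row_sum (Y_row N \<alpha> B k pr y) (\<lambda>t. \<Sum>h<n. hit h t)"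
      unfolding sum.lessThan_Suc_shift row_sum_sum using True by simp
    also have "row_sum (Y_row N \<alpha> B k pr y) (\<lambda>t. \<Sum>h<n. hit h t) \<le> row_sum (Y_row N \<alpha> B k pr y) lyapunov"
      by (rule Y_row_sum_mono[OF True Suc.IH]) (simp_all add: lyapunov_def)
    also have "\<dots> \<le> lyapunov y - 1" by (rule lyapunov_step[OF True])
    finally show ?thesis by (simp split: if_splits)
  next
    case False
    then have "hit h y = 0" for h by (cases h) (simp_all add: Y_C_def)
    then show ?thesis by (simp add: lyapunov_nonneg)
  qed
qed

lemma summable_hit: "summable (\<lambda>h. hit h y)"
  by (rule summableI_nonneg_bounded[OF hit_nonneg sum_hit_le_lyapunov])

lemma Y_trans_outside:
  assumes "x \<in> Y_all" "y \<notin> Y_all"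
  shows "Y_trans N \<alpha> B k pr x y = 0"
proof -
  have "fst ` set (Y_row N \<alpha> B k pr x) \<subseteq> Y_all"
    using assms(1) Y_row_targets by auto
  then have "y \<notin> fst ` set (Y_row N \<alpha> B k pr x)" using assms(2) by blast
  moreover have "y \<notin> fst ` set xs \<Longrightarrow> entry xs y = 0" for xs :: "(ystate \<times> real) list"
    by (induction xs) (auto simp: entry_def)
  ultimately show ?thesis unfolding Y_trans_def by blast
qed

lemma Y_row_sum:
  assumes "y \<in> Y_tr" "f Y15 = 0" "f Y16 = 0"
  shows "row_sum (Y_row N \<alpha> B k pr y) f = (\<Sum>t\<in>Y_tr. Y_trans N \<alpha> B k pr y t * f t)"
proof -
  have "row_sum (Y_row N \<alpha> B k pr y) f = (\<Sum>t\<in>Y_all. Y_trans N \<alpha> B k pr y t * f t)"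
    unfolding Y_trans_def by (rule row_sum_entry[symmetric, OF _ Y_row_targets[OF assms(1)]]) simp
  also have "\<dots> = (\<Sum>t\<in>Y_tr. Y_trans N \<alpha> B k pr y t * f t)"
    using assms by (intro sum.mono_neutral_right) auto
  finally show ?thesis .
qed

lemma Y_trans_nonneg:
  assumes "x \<in> Y_tr" "y \<in> Y_tr"
  shows "0 \<le> Y_trans N \<alpha> B k pr x y"
proof -
  have "0 \<le> row_sum (Y_row N \<alpha> B k pr x) (\<lambda>t. if t = y then 1 else 0)"
    by (rule row_sum_nonneg, rule row_all_mono[OF Y_row_pairs[OF assms(1)]]) (use assms(2) in auto)
  also have "\<dots> = Y_trans N \<alpha> B k pr x y"
    using assms by (subst Y_row_sum) (auto simp: if_distrib[where f = "\<lambda>a. _ * a"] cong: if_cong)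
  finally show ?thesis .
qed

subsection \<open>The transition matrix\<close>

abbreviation "M_tr \<equiv> num_transient N k"
abbreviation "A_tr \<equiv> A_mat N \<alpha> B k pr"
abbreviation "st \<equiv> (!) (Y_transient N k)"

lemma st_in [simp]: "r < M_tr \<Longrightarrow> st r \<in> Y_tr"
  by (simp add: length_Y_transient)

lemma sum_st: "(\<Sum>r<M_tr. f (st r)) = (\<Sum>y\<in>Y_tr. f y)"
  by (rule sum.reindex_bij_betw, rule bij_betw_nth[OF distinct_Y_transient])
     (auto simp: length_Y_transient)

lemma A_carrier [simp]: "A_tr \<in> carrier_mat M_tr M_tr"
  by (simp add: A_mat_def)

lemma A_dim [simp]: "dim_row A_tr = M_tr" "dim_col A_tr = M_tr"
  by (simp_all add: A_mat_def)

lemma A_entry: "r < M_tr \<Longrightarrow> c < M_tr \<Longrightarrow> A_tr $$ (r, c) = Y_trans N \<alpha> B k pr (st r) (st c)"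
  by (simp add: A_mat_def)

lemma A_mult_vec_index:
  "r < M_tr \<Longrightarrow> x \<in> carrier_vec M_tr \<Longrightarrow> (A_tr *\<^sub>v x) $ r = (\<Sum>c<M_tr. Y_trans N \<alpha> B k pr (st r) (st c) * x $ c)"
  using A_carrier by (auto simp: scalar_prod_def A_entry atLeast0LessThan intro!: sum.cong)

lemma A_mult_vec:
  assumes "f Y15 = 0" "f Y16 = 0"
  shows "A_tr *\<^sub>v Matrix.vec M_tr (\<lambda>r. f (st r)) =
    Matrix.vec M_tr (\<lambda>r. row_sum (Y_row N \<alpha> B k pr (st r)) f)"
proof (rule eq_vecI)
  fix r assume "r < dim_vec (Matrix.vec M_tr (\<lambda>r. row_sum (Y_row N \<alpha> B k pr (st r)) f))"
  then have r: "r < M_tr" by simp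
  have "(A_tr *\<^sub>v Matrix.vec M_tr (\<lambda>r. f (st r))) $ r =
    (\<Sum>c<M_tr. Y_trans N \<alpha> B k pr (st r) (st c) * f (st c))"
    by (subst A_mult_vec_index[OF r]) (auto intro!: sum.cong)
  then show "(A_tr *\<^sub>v Matrix.vec M_tr (\<lambda>r. f (st r))) $ r =
    Matrix.vec M_tr (\<lambda>r. row_sum (Y_row N \<alpha> B k pr (st r)) f) $ r"
    using r assms sum_st[of "\<lambda>y. Y_trans N \<alpha> B k pr (st r) y * f y"] by (simp add: Y_row_sum)
qed (use A_carrier in auto)

lemma v_vec_eq: "v_vec N k = Matrix.vec M_tr (\<lambda>r. hit 0 (st r))"
  by (simp add: v_vec_def)

lemma A_pow_v: "A_tr ^\<^sub>m h *\<^sub>v v_vec N k = Matrix.vec M_tr (\<lambda>r. hit h (st r))"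
proof (induction h)
  case 0
  then show ?case by (simp add: v_vec_eq)
next
  case (Suc h)
  have pow: "A_tr ^\<^sub>m Suc h = A_tr * A_tr ^\<^sub>m h"
    by (induction h) (simp_all add: assoc_mult_mat[of _ M_tr M_tr _ M_tr _ M_tr])
  have "A_tr ^\<^sub>m Suc h *\<^sub>v v_vec N k = A_tr *\<^sub>v (A_tr ^\<^sub>m h *\<^sub>v v_vec N k)"
    unfolding pow by (rule assoc_mult_mat_vec[of _ M_tr M_tr _ M_tr]) (simp_all add: v_vec_def)
  also have "\<dots> = Matrix.vec M_tr (\<lambda>r. hit (Suc h) (st r))"
    unfolding Suc.IH by (subst A_mult_vec) (auto intro!: eq_vecI)
  finally show ?case .
qed

text \<open>Maximum principle: at a position where the ratio of the absolute entry to
  \<open>lyapunov\<close> is largest, the fixed-point equation and the drift of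
  \<open>lyapunov\<close> bound a positive number strictly below itself.\<close>

lemma fixed_vec_zero:
  assumes x: "x \<in> carrier_vec M_tr" and fix_x: "\<And>r. r < M_tr \<Longrightarrow> (\<Sum>c<M_tr. Y_trans N \<alpha> B k pr (st r) (st c) * x $ c) = x $ r"
  shows "x = 0\<^sub>v M_tr"
proof (rule ccontr)
  assume "x \<noteq> 0\<^sub>v M_tr"
  then obtain r0 where r0: "r0 < M_tr" "x $ r0 \<noteq> 0"
    using x by (metis carrier_vecD eq_vecI index_zero_vec)
  define q where "q = (\<lambda>r. \<bar>x $ r\<bar> / lyapunov (st r))"
  have pos: "0 < lyapunov (st r)" if "r < M_tr" for r
    using lyapunov_ge_1[OF st_in[OF that]] by simp
  have "\<exists>r<M_tr. \<forall>c<M_tr. q c \<le> q r"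
  proof -
    have ne: "q ` {..<M_tr} \<noteq> {}" using r0(1) by auto
    have "Max (q ` {..<M_tr}) \<in> q ` {..<M_tr}" by (rule Max_in[OF _ ne]) simp
    then obtain r where r: "r < M_tr" "Max (q ` {..<M_tr}) = q r" by auto
    moreover have "q c \<le> q r" if "c < M_tr" for c
      unfolding r(2)[symmetric] using that by (intro Max_ge) auto
    ultimately show ?thesis by blast
  qed
  then obtain r where r: "r < M_tr" and max: "\<And>c. c < M_tr \<Longrightarrow> q c \<le> q r" by blast
  have "0 < q r0" using r0 pos[OF r0(1)] by (simp add: q_def)
  then have qr: "0 < q r" using max[OF r0(1)] by simp
  have "\<bar>x $ r\<bar> \<le> (\<Sum>c<M_tr. Y_trans N \<alpha> B k pr (st r) (st c) * \<bar>x $ c\<bar>)"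
    unfolding fix_x[OF r, symmetric]
    by (rule order.trans[OF sum_abs]) (auto intro!: sum_mono simp: abs_mult Y_trans_nonneg r)
  also have "\<dots> \<le> (\<Sum>c<M_tr. Y_trans N \<alpha> B k pr (st r) (st c) * (q r * lyapunov (st c)))"
  proof (intro sum_mono mult_left_mono)
    fix c assume "c \<in> {..<M_tr}"
    then have c: "c < M_tr" by simp
    show "\<bar>x $ c\<bar> \<le> q r * lyapunov (st c)"
      using max[OF c] pos[OF c] by (simp add: q_def pos_divide_le_eq)
    show "0 \<le> Y_trans N \<alpha> B k pr (st r) (st c)" using r c by (simp add: Y_trans_nonneg)
  qed
  also have "\<dots> = q r * row_sum (Y_row N \<alpha> B k pr (st r)) lyapunov"
  proof -
    have "(\<Sum>c<M_tr. Y_trans N \<alpha> B k pr (st r) (st c) * (q r * lyapunov (st c))) =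
      q r * (\<Sum>c<M_tr. Y_trans N \<alpha> B k pr (st r) (st c) * lyapunov (st c))"
      by (simp add: sum_distrib_left mult_ac)
    also have "(\<Sum>c<M_tr. Y_trans N \<alpha> B k pr (st r) (st c) * lyapunov (st c)) =
      row_sum (Y_row N \<alpha> B k pr (st r)) lyapunov"
      unfolding sum_st[of "\<lambda>y. Y_trans N \<alpha> B k pr (st r) y * lyapunov y"]
      by (rule Y_row_sum[symmetric]) (use r in \<open>simp_all add: lyapunov_def\<close>)
    finally show ?thesis .
  qed
  also have "\<dots> \<le> q r * (lyapunov (st r) - 1)"
    using qr r by (intro mult_left_mono lyapunov_step) auto
  also have "\<dots> < q r * lyapunov (st r)" using qr by simp
  also have "\<dots> = \<bar>x $ r\<bar>" using pos[OF r] by (simp add: q_def)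
  finally show False by simp
qed

text \<open>\<open>the (mat_inverse X)\<close> has a meaning only if an inverse is found. By
  \<open>fixed_vec_zero\<close> the kernel of \<open>I - A\<close> is trivial, so its determinant is
  nonzero and it is a unit of the matrix ring.\<close>

lemma mat_inverse_ex:
  "\<exists>Z. mat_inverse (1\<^sub>m M_tr - A_tr) = Some Z \<and> Z \<in> carrier_mat M_tr M_tr \<and>
     (1\<^sub>m M_tr - A_tr) * Z = 1\<^sub>m M_tr \<and> Z * (1\<^sub>m M_tr - A_tr) = 1\<^sub>m M_tr"
proof -
  let ?D = "1\<^sub>m M_tr - A_tr"
  have D: "?D \<in> carrier_mat M_tr M_tr" by (simp add: minus_carrier_mat)
  have "det ?D \<noteq> 0"
  proof
    assume "det ?D = 0"
    then obtain x where x: "x \<in> carrier_vec M_tr" "x \<noteq> 0\<^sub>v M_tr" "?D *\<^sub>v x = 0\<^sub>v M_tr"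
      using det_0_iff_vec_prod_zero[OF D] by blast
    have "x - A_tr *\<^sub>v x = 0\<^sub>v M_tr"
      using x(3) minus_mult_distrib_mat_vec[of "1\<^sub>m M_tr" M_tr M_tr A_tr x] x(1) by simp
    then have "(x - A_tr *\<^sub>v x) $ r = 0" if "r < M_tr" for r using that by simp
    then have "(\<Sum>c<M_tr. Y_trans N \<alpha> B k pr (st r) (st c) * x $ c) = x $ r" if "r < M_tr" for r
      using that A_mult_vec_index[OF that x(1)] x(1) A_carrier by fastforce
    then show False using fixed_vec_zero[OF x(1)] x(2) by blast
  qed
  then have "?D \<in> Units (ring_mat TYPE(real) M_tr ())" by (rule det_non_zero_imp_unit[OF D])
  then obtain Z where "mat_inverse ?D = Some Z"
    using mat_inverse(1)[OF D, of "()"] by (cases "mat_inverse ?D") auto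
  then show ?thesis using mat_inverse(2)[OF D] by blast
qed

lemma invertible_I_minus_A: "invertible_mat (1\<^sub>m M_tr - A_tr)"
proof -
  obtain Z where "Z \<in> carrier_mat M_tr M_tr" "(1\<^sub>m M_tr - A_tr) * Z = 1\<^sub>m M_tr"
    "Z * (1\<^sub>m M_tr - A_tr) = 1\<^sub>m M_tr" using mat_inverse_ex by blast
  then show ?thesis
    unfolding invertible_mat_def inverts_mat_def using A_carrier by (auto intro!: exI[of _ Z])
qed

lemma suminf_hit_Suc: "r < M_tr \<Longrightarrow>
    row_sum (Y_row N \<alpha> B k pr (st r)) (\<lambda>y. \<Sum>h. hit h y) = (\<Sum>h. hit (Suc h) (st r))"
proof -
  assume r: "r < M_tr"
  have "row_sum (Y_row N \<alpha> B k pr (st r)) (\<lambda>y. \<Sum>h. hit h y) =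
    (\<Sum>t\<in>Y_tr. \<Sum>h. Y_trans N \<alpha> B k pr (st r) t * hit h t)"
    using r by (subst Y_row_sum) (auto intro!: sum.cong suminf_mult[symmetric] summable_hit)
  also have "\<dots> = (\<Sum>h. \<Sum>t\<in>Y_tr. Y_trans N \<alpha> B k pr (st r) t * hit h t)"
    by (rule suminf_sum[symmetric]) (auto intro: summable_mult summable_hit)
  also have "\<dots> = (\<Sum>h. hit (Suc h) (st r))"
    using r by (simp add: Y_row_sum)
  finally show ?thesis .
qed

text \<open>Applying \<open>I - A\<close> to the vector of the series of \<open>hit\<close>
  telescopes it to \<open>v\<close>, and the left inverse then identifies that vector as
  \<open>(I - A)^-1 v\<close>. The factor \<open>A\<close> removes the term for h = 0.\<close>

lemma A_inverse_v:
  "(A_tr * the (mat_inverse (1\<^sub>m M_tr - A_tr))) *\<^sub>v v_vec N k =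
   Matrix.vec M_tr (\<lambda>r. \<Sum>h. hit (Suc h) (st r))"
proof -
  obtain Z where Z: "mat_inverse (1\<^sub>m M_tr - A_tr) = Some Z" "Z \<in> carrier_mat M_tr M_tr"
    "Z * (1\<^sub>m M_tr - A_tr) = 1\<^sub>m M_tr" using mat_inverse_ex by blast
  let ?S = "Matrix.vec M_tr (\<lambda>r. \<Sum>h. hit h (st r))"
  have AS: "A_tr *\<^sub>v ?S = Matrix.vec M_tr (\<lambda>r. \<Sum>h. hit (Suc h) (st r))"
    by (subst A_mult_vec) (auto simp: suminf_hit_Suc intro!: eq_vecI)
  have "(1\<^sub>m M_tr - A_tr) *\<^sub>v ?S = ?S - A_tr *\<^sub>v ?S"
    by (subst minus_mult_distrib_mat_vec[of _ M_tr M_tr]) simp_all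
  also have "\<dots> = v_vec N k"
    unfolding AS v_vec_eq using suminf_split_head[OF summable_hit] by (intro eq_vecI) auto
  finally have "Z *\<^sub>v v_vec N k = Z *\<^sub>v ((1\<^sub>m M_tr - A_tr) *\<^sub>v ?S)" by simp
  also have "\<dots> = (Z * (1\<^sub>m M_tr - A_tr)) *\<^sub>v ?S"
    by (rule assoc_mult_mat_vec[symmetric, of _ M_tr M_tr _ M_tr]) (simp_all add: Z(2) minus_carrier_mat)
  also have "\<dots> = ?S" unfolding Z(3) by simp
  finally have "Z *\<^sub>v v_vec N k = ?S" .
  moreover have "(A_tr * Z) *\<^sub>v v_vec N k = A_tr *\<^sub>v (Z *\<^sub>v v_vec N k)"
    by (rule assoc_mult_mat_vec[of _ M_tr M_tr _ M_tr]) (simp_all add: Z(2) v_vec_def)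
  ultimately show ?thesis by (simp add: Z(1) AS)
qed

lemma sigma_scalar: "sigma_vec N \<alpha> B k pr p \<bullet> Matrix.vec M_tr (\<lambda>r. f (st r)) =
    (\<Sum>y\<in>Y_tr. Y_init N \<alpha> B k pr p y * f y)"
  unfolding sum_st[symmetric] by (auto simp: sigma_vec_def scalar_prod_def atLeast0LessThan intro!: sum.cong)

end

section \<open>The law of the absorbing chain\<close>

instance ystate :: countable by countable_datatype

context queue
begin

text \<open>The event is a cylinder constrained at time \<open>h\<close> only, so its weight obeys
  the recursion of \<open>hit\<close>.\<close>

lemma Y_chain_prob:
  assumes mc: "markov_chain Q Y (Y_init N \<alpha> B k pr p) (Y_trans N \<alpha> B k pr)"
  shows "measure Q {\<omega> \<in> space Q. Y h \<omega> \<in> Y_C N k} = (\<Sum>y\<in>Y_tr. Y_init N \<alpha> B k pr p y * hit h y)"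
proof -
  let ?V = "\<lambda>h i. if i = h then Y_C N k else UNIV"
  have shift: "(\<lambda>i. ?V (Suc h) (Suc i)) = ?V h" for h by auto
  have weight: "cylinder_weight (Y_trans N \<alpha> B k pr) Y_all h (?V h) y = hit h y" if "y \<in> Y_all" for y
    using that
  proof (induction h arbitrary: y)
    case 0
    then show ?case by (simp add: indicator_def)
  next
    case (Suc h)
    have "cylinder_weight (Y_trans N \<alpha> B k pr) Y_all (Suc h) (?V (Suc h)) y =
      (\<Sum>t\<in>Y_all. Y_trans N \<alpha> B k pr y t * hit h t)"
      unfolding cylinder_weight.simps shift
      by (simp del: sum.insert Un_insert_right add: Suc.IH)
    also have "\<dots> = hit (Suc h) y"
    proof (cases "y \<in> Y_tr")
      case True
      then show ?thesis unfolding Y_trans_def by (subst row_sum_entry[OF _ Y_row_targets]) simp_all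
    next
      case False
      then have "y = Y15 \<or> y = Y16" using Suc.prems by auto
      then have "row_sum (Y_row N \<alpha> B k pr y) (hit h) = 0" "fst ` set (Y_row N \<alpha> B k pr y) \<subseteq> Y_all"
        by auto
      then show ?thesis using False unfolding Y_trans_def by (subst row_sum_entry) auto
    qed
    finally show ?case .
  qed
  have "{\<omega> \<in> space Q. Y h \<omega> \<in> Y_C N k} = {\<omega> \<in> space Q. \<forall>i\<le>h. Y i \<omega> \<in> ?V h i}" by auto
  then have "measure Q {\<omega> \<in> space Q. Y h \<omega> \<in> Y_C N k} =
    measure Q {\<omega> \<in> space Q. \<forall>i\<le>h. Y i \<omega> \<in> ?V h i}" by (simp only:)
  also have "\<dots> = (\<Sum>y\<in>Y_all. Y_init N \<alpha> B k pr p y * cylinder_weight (Y_trans N \<alpha> B k pr) Y_all h (?V h) y)"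
    by (rule markov_chain_cylinder[OF mc]) (simp_all add: Y_trans_outside Y_init_def)
  also have "\<dots> = (\<Sum>y\<in>Y_all. Y_init N \<alpha> B k pr p y * hit h y)"
    by (intro sum.cong refl) (simp only: weight)
  also have "\<dots> = (\<Sum>y\<in>Y_tr. Y_init N \<alpha> B k pr p y * hit h y)"
    by (intro sum.mono_neutral_right) auto
  finally show ?thesis .
qed

end

subsection \<open>Limits of averages\<close>

text \<open>The window starts at \<open>n\<close>, so all of its terms are late ones and no initial
  segment has to be split off as in a Cesaro mean.\<close>

lemma window_mean_tendsto:
  fixes a :: "nat \<Rightarrow> real"
  assumes "a \<longlonglongrightarrow> l"
  shows "(\<lambda>n. (\<Sum>g<Suc n. a (n + g)) / real (Suc n)) \<longlonglongrightarrow> l"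
proof (rule LIMSEQ_I)
  fix e :: real assume "0 < e"
  then obtain N where N: "\<And>m. m \<ge> N \<Longrightarrow> norm (a m - l) < e / 2"
    using LIMSEQ_D[OF assms, of "e / 2"] by auto
  have "norm ((\<Sum>g<Suc n. a (n + g)) / real (Suc n) - l) < e" if n: "n \<ge> N" for n
  proof -
    have "(\<Sum>g<Suc n. a (n + g)) / real (Suc n) - l = (\<Sum>g<Suc n. a (n + g) - l) / real (Suc n)"
      by (simp add: sum_subtractf diff_divide_distrib del: sum.lessThan_Suc)
    then have "norm ((\<Sum>g<Suc n. a (n + g)) / real (Suc n) - l) = norm (\<Sum>g<Suc n. a (n + g) - l) / real (Suc n)"
      by simp
    also have "norm (\<Sum>g<Suc n. a (n + g) - l) \<le> (\<Sum>g<Suc n. e / 2)"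
      using n by (intro sum_norm_le less_imp_le[OF N]) simp
    also have "(\<Sum>g<Suc n. e / 2) / real (Suc n) = e / 2"
      by (simp del: of_nat_Suc sum.lessThan_Suc)
    finally show ?thesis using \<open>0 < e\<close> by (simp add: divide_right_mono)
  qed
  then show "\<exists>no. \<forall>n\<ge>no. norm ((\<Sum>g<Suc n. a (n + g)) / real (Suc n) - l) < e" by blast
qed

lemma finite_bounded_subsequence:
  fixes f :: "nat \<Rightarrow> 's \<Rightarrow> real"
  assumes "finite S" "\<And>n s. s \<in> S \<Longrightarrow> \<bar>f n s\<bar> \<le> C"
  shows "\<exists>r p. strict_mono r \<and> (\<forall>s\<in>S. (\<lambda>n. f (r n) s) \<longlonglongrightarrow> p s)"
  using assms
proof (induction S rule: finite_induct)
  case empty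
  show ?case by (intro exI[of _ id]) (simp add: strict_mono_id)
next
  case (insert x S)
  then obtain r p where r: "strict_mono (r :: nat \<Rightarrow> nat)" and p: "\<forall>s\<in>S. (\<lambda>n. f (r n) s) \<longlonglongrightarrow> p s"
    by (metis insert_iff)
  have "bounded (range (\<lambda>n. f (r n) x))"
    using insert.prems by (intro boundedI[where B = C]) auto
  then obtain l r' where r': "strict_mono (r' :: nat \<Rightarrow> nat)" and l: "((\<lambda>n. f (r n) x) \<circ> r') \<longlonglongrightarrow> l"
    using bounded_imp_convergent_subsequence by blast
  have "(\<lambda>n. f ((r \<circ> r') n) s) \<longlonglongrightarrow> (p(x := l)) s" if "s \<in> insert x S" for s
  proof (cases "s = x")
    case True
    then show ?thesis using l by (simp add: comp_def)
  next
    case False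
    then have "(\<lambda>n. f (r n) s) \<longlonglongrightarrow> p s" using that p by simp
    then show ?thesis using LIMSEQ_subseq_LIMSEQ[OF _ r'] False by (simp add: comp_def)
  qed
  then show ?case using strict_mono_o[OF r r'] by blast
qed

lemma stationary_limit:
  fixes \<nu> :: "nat \<Rightarrow> 's \<Rightarrow> real"
  assumes fin: "finite S"
    and nonneg: "\<And>g s. s \<in> S \<Longrightarrow> 0 \<le> \<nu> g s" and total: "\<And>g. (\<Sum>s\<in>S. \<nu> g s) = 1"
    and step: "\<And>g s. s \<in> S \<Longrightarrow> \<nu> (Suc g) s = (\<Sum>r\<in>S. \<nu> g r * P r s)"
    and uniq: "\<And>p'. stationary S P p' \<Longrightarrow> \<forall>s\<in>S. p' s = p s"
    and lim: "(\<lambda>g. \<Sum>s\<in>S. \<nu> g s * c s) \<longlonglongrightarrow> l"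
  shows "l = (\<Sum>s\<in>S. p s * c s)"
proof -
  have le1: "\<nu> g s \<le> 1" if "s \<in> S" for g s
    unfolding total[of g, symmetric] using that fin nonneg by (intro member_le_sum) auto
  define avg where "avg = (\<lambda>n s. (\<Sum>g<Suc n. \<nu> (n + g) s) / real (Suc n))"
  have avg_nonneg: "0 \<le> avg n s" if "s \<in> S" for n s
    unfolding avg_def using that nonneg by (intro divide_nonneg_nonneg sum_nonneg) auto
  have avg_total: "(\<Sum>s\<in>S. avg n s) = 1" for n
  proof -
    have "(\<Sum>s\<in>S. avg n s) = (\<Sum>g<Suc n. \<Sum>s\<in>S. \<nu> (n + g) s) / real (Suc n)"
      unfolding avg_def sum_divide_distrib[symmetric] by (subst sum.swap) (rule refl)
    then show ?thesis unfolding total by simp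
  qed
  have avg_le: "\<bar>avg n s\<bar> \<le> 1" if "s \<in> S" for n s
    using member_le_sum[of s S "avg n"] that fin avg_nonneg[of _ n] avg_total[of n] by auto
  obtain r p' where r: "strict_mono r" and p': "\<And>s. s \<in> S \<Longrightarrow> (\<lambda>n. avg (r n) s) \<longlonglongrightarrow> p' s"
    using finite_bounded_subsequence[where f = avg and C = 1, OF fin avg_le] by blast
  have "stationary S P p'"
    unfolding stationary_def
  proof (intro conjI ballI)
    fix s assume s: "s \<in> S"
    show "0 \<le> p' s"
      by (rule LIMSEQ_le_const[OF p'[OF s]]) (use avg_nonneg[OF s] in auto)
    have "(\<lambda>n. \<Sum>t\<in>S. avg (r n) t * P t s) \<longlonglongrightarrow> (\<Sum>t\<in>S. p' t * P t s)"
      by (intro tendsto_sum tendsto_mult p' tendsto_const)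
    moreover have "(\<lambda>n. (\<Sum>t\<in>S. avg (r n) t * P t s) - avg (r n) s) \<longlonglongrightarrow> 0"
    proof (rule Lim_null_comparison)
      \<comment> \<open>One application of \<open>P\<close> shifts the window by one slot; after
        cancellation only its two end terms differ.\<close>
      have diff: "\<bar>(\<Sum>t\<in>S. avg n t * P t s) - avg n s\<bar> \<le> 1 / real (Suc n)" for n
      proof -
        have "(\<Sum>t\<in>S. avg n t * P t s) = (\<Sum>g<Suc n. \<Sum>t\<in>S. \<nu> (n + g) t * P t s) / real (Suc n)"
          unfolding avg_def times_divide_eq_left sum_divide_distrib[symmetric] sum_distrib_right
          by (subst sum.swap) (rule refl)
        also have "(\<Sum>g<Suc n. \<Sum>t\<in>S. \<nu> (n + g) t * P t s) = (\<Sum>g<Suc n. \<nu> (Suc (n + g)) s)"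
          using step[OF s] by simp
        finally have "(\<Sum>t\<in>S. avg n t * P t s) - avg n s =
            (\<Sum>g<Suc n. \<nu> (Suc (n + g)) s - \<nu> (n + g) s) / real (Suc n)"
          by (simp add: avg_def sum_subtractf diff_divide_distrib del: sum.lessThan_Suc)
        also have "(\<Sum>g<Suc n. \<nu> (Suc (n + g)) s - \<nu> (n + g) s) = \<nu> (n + Suc n) s - \<nu> n s"
          using sum_lessThan_telescope[of "\<lambda>g. \<nu> (n + g) s" "Suc n"] by simp
        also have "\<bar>(\<nu> (n + Suc n) s - \<nu> n s) / real (Suc n)\<bar> \<le> 1 / real (Suc n)"
          using nonneg[OF s, of n] nonneg[OF s, of "n + Suc n"] le1[OF s, of n] le1[OF s, of "n + Suc n"]
          unfolding abs_divide abs_of_nat by (intro divide_right_mono) auto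
        finally show ?thesis .
      qed
      have le: "1 / real (Suc (r n)) \<le> 1 / real (Suc n)" for n
        using strict_mono_imp_increasing[OF r, of n] by (intro divide_left_mono) auto
      show "\<forall>\<^sub>F n in sequentially. norm ((\<Sum>t\<in>S. avg (r n) t * P t s) - avg (r n) s) \<le> 1 / real (Suc n)"
        unfolding real_norm_def by (intro always_eventually allI order.trans[OF diff le])
      show "(\<lambda>n. 1 / real (Suc n)) \<longlonglongrightarrow> 0" by (rule LIMSEQ_Suc[OF lim_1_over_n])
    qed
    ultimately have "(\<lambda>n. (\<Sum>t\<in>S. avg (r n) t * P t s) - ((\<Sum>t\<in>S. avg (r n) t * P t s) - avg (r n) s))
      \<longlonglongrightarrow> (\<Sum>t\<in>S. p' t * P t s) - 0" by (rule tendsto_diff)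
    then have "(\<lambda>n. avg (r n) s) \<longlonglongrightarrow> (\<Sum>t\<in>S. p' t * P t s)" by simp
    then show "p' s = (\<Sum>t\<in>S. p' t * P t s)" by (rule LIMSEQ_unique[OF p'[OF s]])
  next
    have "(\<lambda>n. \<Sum>s\<in>S. avg (r n) s) \<longlonglongrightarrow> (\<Sum>s\<in>S. p' s)" by (intro tendsto_sum p')
    then show "(\<Sum>s\<in>S. p' s) = 1" unfolding avg_total by (simp add: LIMSEQ_const_iff)
  qed
  then have p_eq: "\<forall>s\<in>S. p' s = p s" by (rule uniq)
  have "(\<lambda>n. \<Sum>s\<in>S. avg (r n) s * c s) \<longlonglongrightarrow> (\<Sum>s\<in>S. p' s * c s)"
    by (intro tendsto_sum tendsto_mult p' tendsto_const)
  moreover have "(\<lambda>n. \<Sum>s\<in>S. avg (r n) s * c s) \<longlonglongrightarrow> l"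
  proof -
    have "(\<Sum>s\<in>S. avg n s * c s) = (\<Sum>g<Suc n. \<Sum>s\<in>S. \<nu> (n + g) s * c s) / real (Suc n)" for n
      unfolding avg_def times_divide_eq_left sum_divide_distrib[symmetric] sum_distrib_right
      by (subst sum.swap) (rule refl)
    then have "(\<lambda>n. \<Sum>s\<in>S. avg n s * c s) \<longlonglongrightarrow> l"
      using window_mean_tendsto[OF lim] by simp
    from LIMSEQ_subseq_LIMSEQ[OF this r] show ?thesis by (simp add: comp_def)
  qed
  ultimately have "l = (\<Sum>s\<in>S. p' s * c s)" by (rule LIMSEQ_unique[rotated])
  then show ?thesis using p_eq by simp
qed

section \<open>The law of the age at a slot and its limit\<close>

context queue
begin

lemma occupation_nonneg: "0 \<le> occupation g w"
proof (induction g arbitrary: w)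
  case (Suc g)
  have "0 \<le> W_trans N \<alpha> B k pr v w" if v: "v \<in> W_all" for v
  proof (cases "w \<in> W_all")
    case True
    have "0 \<le> row_sum (W_row N \<alpha> B k pr v) (\<lambda>t. if t = w then 1 else 0)"
      by (rule row_sum_nonneg, rule row_all_mono[OF W_row_pairs[OF v]]) auto
    then show ?thesis
      using True v by (simp add: W_row_sum if_distrib[where f = "\<lambda>a. _ * a"] cong: if_cong)
  next
    case False
    then have "w \<notin> fst ` set (W_row N \<alpha> B k pr v)" using W_row_targets[OF v] by blast
    moreover have "w \<notin> fst ` set xs \<Longrightarrow> entry xs w = 0" for xs :: "(wstate \<times> real) list"
      by (induction xs) (auto simp: entry_def)
    ultimately show ?thesis unfolding W_trans_def by simp
  qed
  then show ?case using Suc.IH by (auto intro!: sum_nonneg)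
qed simp

lemma occupation_total: "(\<Sum>w\<in>W_all. occupation g w) = 1"
  using expectation_old_phases[of g "\<lambda>_. Old" "\<lambda>_. 1"] by simp

lemma start_value_nonneg:
  assumes w: "w \<in> W_all" and f: "\<And>y. 0 \<le> f y"
  shows "0 \<le> start_value f w"
proof -
  note nn = srv.exit_nonneg srv.B_nonneg srv.init_nonneg f
  show ?thesis
    unfolding start_value_def Let_def
    by (cases w; cases pr; insert w; simp;
        intro impI add_nonneg_nonneg mult_nonneg_nonneg sum_nonneg nn; simp)
qed

text \<open>Testing the duality with the indicator of one state isolates one entry of
  \<open>q\<close>.\<close>

lemma q_init_nonneg:
  assumes p: "\<And>w. w \<in> W_all \<Longrightarrow> 0 \<le> p w" and y: "y \<in> Y_tr"
  shows "0 \<le> q_init N \<alpha> B k pr p y"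
proof -
  have "(\<Sum>t\<in>Y_tr. q_init N \<alpha> B k pr p t * (if t = y then 1 else 0)) \<ge> 0"
    unfolding sum_start_value[symmetric] using p
    by (intro sum_nonneg mult_nonneg_nonneg start_value_nonneg) auto
  then show ?thesis using y by (simp add: if_distrib[where f = "\<lambda>a. _ * a"] cong: if_cong)
qed

end

locale status_update = queue + prob_space M for M :: "'a measure" +
  fixes T :: "server \<Rightarrow> nat \<Rightarrow> 'a \<Rightarrow> nat"
  assumes service_law: "\<And>m n. DPH_distributed M (T m n) (N m) (\<alpha> m) (B m)"
    and service_indep: "indep_vars (\<lambda>_. count_space UNIV) (\<lambda>(m, n). T m n) UNIV"
begin

lemma T_measurable [measurable]: "T m n \<in> measurable M (count_space UNIV)"
  using service_law[of m n] by (simp add: DPH_distributed_def)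

lemma T_prob: "prob {\<omega> \<in> space M. T m n \<omega> = t} = pmf (srv.service m) t"
  by (rule srv.DPH_distributed_prob[OF service_law])

lemma AE_T_pos: "AE \<omega> in M. \<forall>m n. 1 \<le> T m n \<omega>"
proof -
  have "AE \<omega> in M. 1 \<le> T m n \<omega>" for m n
  proof (rule AE_I')
    show "{\<omega> \<in> space M. T m n \<omega> = 0} \<in> null_sets M"
      using T_prob[of m n 0] by (intro null_setsI) (auto simp: emeasure_eq_measure srv.pmf_service)
  qed auto
  then have "AE \<omega> in M. \<forall>n. 1 \<le> T S1 n \<omega> \<and> 1 \<le> T S2 n \<omega>" by (simp add: AE_all_countable)
  then show ?thesis
  proof (rule AE_mp, intro AE_I2 impI allI)
    fix \<omega> m n assume "\<forall>n. 1 \<le> T S1 n \<omega> \<and> 1 \<le> T S2 n \<omega>"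
    then show "1 \<le> T m n \<omega>" by (cases m) auto
  qed
qed

text \<open>Equal to \<open>T\<close> almost surely; positivity everywhere allows the pathwise analysis.\<close>

definition T' :: "server \<Rightarrow> nat \<Rightarrow> 'a \<Rightarrow> nat" where
  "T' m n \<omega> = max 1 (T m n \<omega>)"

lemma service_family_T': "service_family M T' srv.service"
proof
  have "indep_vars (\<lambda>_. count_space UNIV) (\<lambda>i \<omega>. max 1 ((\<lambda>(m, n). T m n) i \<omega>)) UNIV"
    by (rule indep_vars_compose2[OF service_indep]) simp
  moreover have "(\<lambda>i \<omega>. max 1 ((\<lambda>(m, n). T m n) i \<omega>)) = (\<lambda>(m, n). T' m n)"
    by (auto simp: fun_eq_iff T'_def)
  ultimately show "indep_vars (\<lambda>_. count_space UNIV) (\<lambda>(m, n). T' m n) UNIV" by simp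
  have [measurable]: "T' m n \<in> measurable M (count_space UNIV)" for m n
    unfolding T'_def[abs_def] by measurable
  fix m n t
  have "prob {\<omega> \<in> space M. T' m n \<omega> = t} = prob {\<omega> \<in> space M. T m n \<omega> = t}"
  proof (rule finite_measure_eq_AE)
    show "AE \<omega> in M. (\<omega> \<in> {\<omega> \<in> space M. T' m n \<omega> = t}) = (\<omega> \<in> {\<omega> \<in> space M. T m n \<omega> = t})"
      using AE_T_pos
    proof (rule AE_mp, intro AE_I2 impI)
      fix \<omega> assume "\<forall>m n. 1 \<le> T m n \<omega>"
      then have "T' m n \<omega> = T m n \<omega>" by (simp add: T'_def max_def le_antisym)
      then show "(\<omega> \<in> {\<omega> \<in> space M. T' m n \<omega> = t}) = (\<omega> \<in> {\<omega> \<in> space M. T m n \<omega> = t})" by simp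
    qed
  qed auto
  then show "prob {\<omega> \<in> space M. T' m n \<omega> = t} = pmf (srv.service m) t" by (simp add: T_prob)
qed

end

text \<open>Makes the function type of availability slots countable, so that the values of
  \<open>dispatch\<close> form a discrete space.\<close>

instance server :: finite
  by standard (simp add: UNIV_server)

instance server :: countable by countable_datatype

context status_update
begin

text \<open>Which service time is read next depends on the current random value; composition over a
  countable type reduces this to fixed values.\<close>

lemma dispatch_measurable [measurable]:
  "(\<lambda>\<omega>. dispatch k pr (\<lambda>m n. T m n \<omega>) n) \<in> measurable M (count_space UNIV)"
proof (induction n)
  case 0
  have "(\<lambda>\<omega>. (0 :: nat, pr, (\<lambda>_. 0)(pr := T pr 0 \<omega>))) \<in> measurable M (count_space UNIV)"
    by (rule measurable_compose[OF T_measurable[of pr 0], of "\<lambda>r. (0, pr, (\<lambda>_. 0)(pr := r))"]) simp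
  then show ?case by simp
next
  case (Suc n)
  define g where "g = (\<lambda>d :: nat \<times> server \<times> (server \<Rightarrow> nat).
    LEAST t. fst d + k \<le> t \<and> (\<exists>m. snd (snd d) m \<le> t))"
  define m where "m = (\<lambda>d. if \<forall>m. snd (snd d) m \<le> g d then pr
    else if snd (snd d) S1 \<le> g d then S1 else S2)"
  define F where "F = (\<lambda>d r. (g d, m d, (snd (snd d))(m d := g d + r)))"
  have step: "dispatch k pr T' (Suc n) = F (dispatch k pr T' n) (T' (m (dispatch k pr T' n)) (Suc n))" for T'
    by (simp add: Let_def case_prod_beta F_def m_def g_def)
  have "(\<lambda>\<omega>. F d (T (m d) (Suc n) \<omega>)) \<in> measurable M (count_space UNIV)" for d
    by (rule measurable_compose[OF T_measurable[of "m d" "Suc n"], of "F d"]) simp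
  then have "(\<lambda>\<omega>. F (dispatch k pr (\<lambda>m n. T m n \<omega>) n)
      (T (m (dispatch k pr (\<lambda>m n. T m n \<omega>) n)) (Suc n) \<omega>)) \<in> measurable M (count_space UNIV)"
    by (rule measurable_compose_countable[where f = "\<lambda>d \<omega>. F d (T (m d) (Suc n) \<omega>)", OF _ Suc])
  then show ?case by (simp only: step)
qed

lemma gen_measurable: "(\<lambda>\<omega>. gen_slot k pr (\<lambda>m n. T m n \<omega>) n) \<in> measurable M (count_space UNIV)"
  unfolding gen_slot_def by (rule measurable_compose[OF dispatch_measurable[of n], of fst]) simp

lemma reception_measurable:
  "(\<lambda>\<omega>. reception_slot k pr (\<lambda>m n. T m n \<omega>) n) \<in> measurable M (count_space UNIV)"
proof -
  have "(\<lambda>\<omega>. fst d + T (fst (snd d)) n \<omega>) \<in> measurable M (count_space UNIV)"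
    for d :: "nat \<times> server \<times> (server \<Rightarrow> nat)"
    by (rule measurable_compose[OF T_measurable[of "fst (snd d)" n], of "\<lambda>r. fst d + r"]) simp
  then show ?thesis
    unfolding reception_slot_def gen_slot_def server_of_def
    by (rule measurable_compose_countable[where f = "\<lambda>d \<omega>. fst d + T (fst (snd d)) n \<omega>",
          OF _ dispatch_measurable[of n]])
qed

lemma AoI_sets: "{\<omega> \<in> space M. AoI k pr (\<lambda>m n. T m n \<omega>) t = Some h} \<in> sets M"
proof -
  let ?gen = "\<lambda>\<omega>. gen_slot k pr (\<lambda>m n. T m n \<omega>)" and ?rec = "\<lambda>\<omega>. reception_slot k pr (\<lambda>m n. T m n \<omega>)"
  have [measurable]: "(\<lambda>\<omega>. ?gen \<omega> n) \<in> borel_measurable M" "(\<lambda>\<omega>. ?rec \<omega> n) \<in> borel_measurable M"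
    "Measurable.pred M (\<lambda>\<omega>. t - ?gen \<omega> n = h)" for n
    using measurable_compose[OF gen_measurable[of n], where g = "\<lambda>x. x" and L = borel]
      measurable_compose[OF reception_measurable[of n], where g = "\<lambda>x. x" and L = borel]
      measurable_compose[OF gen_measurable[of n], where g = "\<lambda>x. t - x = h" and L = "count_space UNIV"]
    by simp_all
  have char: "AoI k pr (\<lambda>m n. T m n \<omega>) t = Some h \<longleftrightarrow>
      (\<exists>n. reception_slot k pr (\<lambda>m n. T m n \<omega>) n \<le> t \<and>
        (\<forall>m. reception_slot k pr (\<lambda>m n. T m n \<omega>) m \<le> t \<longrightarrow>
          gen_slot k pr (\<lambda>m n. T m n \<omega>) m \<le> gen_slot k pr (\<lambda>m n. T m n \<omega>) n) \<and>
        t - gen_slot k pr (\<lambda>m n. T m n \<omega>) n = h)" for \<omega>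
    by (rule dispatch_process.AoI_eq_Some_ex) (unfold_locales, rule k_pos)
  show ?thesis unfolding char by measurable
qed

lemma AoI_prob:
  "prob {\<omega> \<in> space M. AoI k pr (\<lambda>m n. T m n \<omega>) (g + h) = Some h} =
   (\<Sum>w\<in>W_all. occupation g w * start_value (hit h) w)"
proof -
  interpret sf: service_family M T' srv.service k pr by (rule service_family_T')
  have disp: "dispatching k (\<lambda>m n. T' m n \<omega>)" for \<omega>
    using k_pos by unfold_locales (auto simp: T'_def)
  let ?run = "\<lambda>\<omega>. fst (run k pr (slot_tag g) (\<lambda>m n. T' m n \<omega>) (Suc (g + h)))"
  have "prob {\<omega> \<in> space M. AoI k pr (\<lambda>m n. T m n \<omega>) (g + h) = Some h} =
    prob {\<omega> \<in> space M. ?run \<omega> \<in> {z. delivered z}}"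
  proof (rule finite_measure_eq_AE)
    show "AE \<omega> in M. (\<omega> \<in> {\<omega> \<in> space M. AoI k pr (\<lambda>m n. T m n \<omega>) (g + h) = Some h}) =
        (\<omega> \<in> {\<omega> \<in> space M. ?run \<omega> \<in> {z. delivered z}})"
      using AE_T_pos
    proof (rule AE_mp, intro AE_I2 impI)
      fix \<omega> assume "\<forall>m n. 1 \<le> T m n \<omega>"
      then have "(\<lambda>m n. T' m n \<omega>) = (\<lambda>m n. T m n \<omega>)" by (auto simp: fun_eq_iff T'_def max_def le_antisym)
      then show "(\<omega> \<in> {\<omega> \<in> space M. AoI k pr (\<lambda>m n. T m n \<omega>) (g + h) = Some h}) =
        (\<omega> \<in> {\<omega> \<in> space M. ?run \<omega> \<in> {z. delivered z}})"
        using dispatching.delivered_iff_AoI[OF disp[of \<omega>], where g = g and h = h and pr = pr] by (simp only: mem_Collect_eq)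
    qed
    show "{\<omega> \<in> space M. ?run \<omega> \<in> {z. delivered z}} \<in> sets M"
      using sf.run_sets[of "slot_tag g" "Suc (g + h)" "{x. fst x \<in> {z. delivered z}}"]
      by (simp del: run.simps)
  qed (rule AoI_sets)
  also have "\<dots> = measure_pmf.prob (residual_law k pr srv.service (slot_tag g) (Suc (g + h))) {z. delivered z}"
    by (rule sf.prob_run)
  finally show ?thesis by (simp only: prob_residual_law_delivered prob_delivered)
qed

lemma AoI_le: "AoI k pr (\<lambda>m n. T m n \<omega>) t = Some h \<Longrightarrow> h \<le> t"
  by (auto simp: AoI_def Let_def split: if_splits)

text \<open>The right side of \<open>AoI_prob\<close> with every occupation probability replaced by
  1: a majorant in h that does not depend on the slot.\<close>

definition age_bound :: "nat \<Rightarrow> real" where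
  "age_bound h = (\<Sum>w\<in>W_all. start_value (hit h) w)"

text \<open>The duality with constant weight 1 turns the majorant into a finite combination of the
  summable sequences \<open>hit h y\<close>.\<close>

lemma summable_age_bound: "summable age_bound"
proof -
  have "age_bound h = (\<Sum>y\<in>Y_tr. q_init N \<alpha> B k pr (\<lambda>_. 1) y * hit h y)" for h
    using sum_start_value[of "\<lambda>_. 1" "hit h"] by (simp add: age_bound_def)
  then have "age_bound = (\<lambda>h. \<Sum>y\<in>Y_tr. q_init N \<alpha> B k pr (\<lambda>_. 1) y * hit h y)"
    by (rule ext)
  then show ?thesis by (simp add: summable_sum summable_mult summable_hit)
qed

lemma AoI_prob_le: "prob {\<omega> \<in> space M. AoI k pr (\<lambda>m n. T m n \<omega>) t = Some h} \<le> age_bound h"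
proof (cases "h \<le> t")
  case True
  have "occupation g w * x \<le> x" if "w \<in> W_all" "0 \<le> x" for g w x
  proof -
    have "occupation g w \<le> 1"
      unfolding occupation_total[of g, symmetric] using that(1) by (intro member_le_sum occupation_nonneg) auto
    then show ?thesis using mult_right_mono[of "occupation g w" 1 x] that(2) by simp
  qed
  then have "(\<Sum>w\<in>W_all. occupation (t - h) w * start_value (hit h) w) \<le> age_bound h"
    unfolding age_bound_def by (intro sum_mono) (simp add: start_value_nonneg hit_nonneg)
  then show ?thesis using AoI_prob[of "t - h" h] True by simp
next
  case False
  then have "{\<omega> \<in> space M. AoI k pr (\<lambda>m n. T m n \<omega>) t = Some h} = {}" using AoI_le by blast
  moreover have "0 \<le> age_bound h"
    unfolding age_bound_def by (intro sum_nonneg start_value_nonneg hit_nonneg)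
  ultimately show ?thesis by (simp only: measure_empty)
qed

text \<open>The sum is the probability that something has been received by slot \<open>t\<close>,
  which is at least the probability that packet 0 has; the latter tends to 1 because service times
  are finite.\<close>

lemma AoI_defined_tendsto:
  "(\<lambda>t. \<Sum>h. prob {\<omega> \<in> space M. AoI k pr (\<lambda>m n. T m n \<omega>) t = Some h}) \<longlonglongrightarrow> 1"
proof (rule tendsto_sandwich)
  let ?A = "\<lambda>t h. {\<omega> \<in> space M. AoI k pr (\<lambda>m n. T m n \<omega>) t = Some h}"
  have sums: "(\<lambda>h. prob (?A t h)) sums prob (\<Union>h. ?A t h)" for t
    using AoI_sets by (intro finite_measure_UNION) (auto simp: disjoint_family_on_def)
  then have eq: "(\<Sum>h. prob (?A t h)) = prob (\<Union>h. ?A t h)" for t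
    by (rule sums_unique[symmetric])
  show "\<forall>\<^sub>F t in sequentially. (\<Sum>h. prob (?A t h)) \<le> 1" by (simp add: eq)
  have "{\<omega> \<in> space M. T pr 0 \<omega> \<le> t} \<subseteq> (\<Union>h. ?A t h)" for t
  proof
    fix \<omega> assume w: "\<omega> \<in> {\<omega> \<in> space M. T pr 0 \<omega> \<le> t}"
    have "dispatch_process k" by unfold_locales (rule k_pos)
    then have "AoI k pr (\<lambda>m n. T m n \<omega>) t \<noteq> None"
      using w dispatch_process.AoI_eq_None_imp[of k pr "\<lambda>m n. T m n \<omega>" t] by auto
    then show "\<omega> \<in> (\<Union>h. ?A t h)" using w by auto
  qed
  then show "\<forall>\<^sub>F t in sequentially. prob {\<omega> \<in> space M. T pr 0 \<omega> \<le> t} \<le> (\<Sum>h. prob (?A t h))"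
    unfolding eq using AoI_sets by (intro always_eventually allI finite_measure_mono) auto
  have "(\<lambda>t. prob {\<omega> \<in> space M. T pr 0 \<omega> \<le> t}) \<longlonglongrightarrow> prob (\<Union>t. {\<omega> \<in> space M. T pr 0 \<omega> \<le> t})"
    by (rule finite_Lim_measure_incseq) (auto simp: incseq_def)
  moreover have "(\<Union>t. {\<omega> \<in> space M. T pr 0 \<omega> \<le> t}) = space M" by auto
  ultimately show "(\<lambda>t. prob {\<omega> \<in> space M. T pr 0 \<omega> \<le> t}) \<longlonglongrightarrow> 1" by (simp add: prob_space)
qed simp

lemma limiting_age:
  assumes "stationary W_all (W_trans N \<alpha> B k pr) p"
    and uniq: "\<And>p'. stationary W_all (W_trans N \<alpha> B k pr) p' \<Longrightarrow> \<forall>s\<in>W_all. p' s = p s"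
    and lim: "\<And>h. (\<lambda>t. prob {\<omega> \<in> space M. AoI k pr (\<lambda>m n. T m n \<omega>) t = Some h}) \<longlonglongrightarrow> u h"
  shows "u h = (\<Sum>y\<in>Y_tr. q_init N \<alpha> B k pr p y * hit h y)" and "u sums 1"
proof -
  \<comment> \<open>For fixed h the slot is written as \<open>g + h\<close>, and the generation slot
    \<open>g\<close> tends to infinity.\<close>
  have conv: "(\<lambda>g. \<Sum>w\<in>W_all. occupation g w * start_value (hit h) w) \<longlonglongrightarrow> u h" for h
    using LIMSEQ_ignore_initial_segment[OF lim[of h], of h] by (simp only: AoI_prob)
  have "u h = (\<Sum>w\<in>W_all. p w * start_value (hit h) w)"
  proof (rule stationary_limit[where \<nu> = occupation and P = "W_trans N \<alpha> B k pr"])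
    show "(\<lambda>g. \<Sum>w\<in>W_all. occupation g w * start_value (hit h) w) \<longlonglongrightarrow> u h" by (rule conv)
    show "\<forall>s\<in>W_all. p' s = p s" if "stationary W_all (W_trans N \<alpha> B k pr) p'" for p'
      by (rule uniq[OF that])
  qed (simp_all add: occupation_nonneg occupation_total)
  then show "u h = (\<Sum>y\<in>Y_tr. q_init N \<alpha> B k pr p y * hit h y)" by (simp only: sum_start_value)
  let ?a = "\<lambda>h t. prob {\<omega> \<in> space M. AoI k pr (\<lambda>m n. T m n \<omega>) t = Some h}"
  have "\<forall>\<^sub>F (h, t) in at_top \<times>\<^sub>F sequentially. norm (?a h t) \<le> age_bound h"
    by (intro always_eventually) (simp add: AoI_prob_le split_beta)
  \<comment> \<open>The majorant is uniform in t, so the limit in t may be taken under the sum over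
    h.\<close>
  note tannery = tannerys_theorem[where a = ?a and b = u and F = sequentially, OF lim this summable_age_bound
      sequentially_bot]
  have "summable (\<lambda>h. norm (u h))"
    using tannery by (rule conjunct2[THEN conjunct1])
  then have "summable u" by (rule summable_norm_cancel)
  have "(\<lambda>t. \<Sum>h. ?a h t) \<longlonglongrightarrow> suminf u"
    using tannery by (rule conjunct2[THEN conjunct2])
  then have "suminf u = 1" by (rule LIMSEQ_unique[OF _ AoI_defined_tendsto])
  then show "u sums 1" using \<open>summable u\<close> by (simp add: sums_iff)
qed

end

theorem theorem1:
  fixes N :: "server \<Rightarrow> nat"
    and \<alpha> :: "server \<Rightarrow> real Matrix.vec"
    and B :: "server \<Rightarrow> real mat"
    and k :: nat
    and pr :: server
    and M :: "'a measure"
    and T :: "server \<Rightarrow> nat \<Rightarrow> 'a \<Rightarrow> nat"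
    and p :: "wstate \<Rightarrow> real"
    and u :: "nat \<Rightarrow> real"
    and Q :: "'b measure"
    and Y :: "nat \<Rightarrow> 'b \<Rightarrow> ystate"
  assumes freezing: "k \<ge> 1"
    and representation: "\<And>m. DPH_rep (N m) (\<alpha> m) (B m)"
    and probability_space: "prob_space M"
    and service_law: "\<And>m n. DPH_distributed M (T m n) (N m) (\<alpha> m) (B m)"
    and service_indep:
      "prob_space.indep_vars M (\<lambda>_. count_space UNIV) (\<lambda>(m, n). T m n) UNIV"
    and W_stationary: "stationary (W_states N k) (W_trans N \<alpha> B k pr) p"
    and W_unique:
      "\<And>p'. stationary (W_states N k) (W_trans N \<alpha> B k pr) p' \<Longrightarrow>
              \<forall>s\<in>W_states N k. p' s = p s"
    and steady_state:
      "\<And>h. (\<lambda>t. measure M {\<omega> \<in> space M. AoI k pr (\<lambda>m n. T m n \<omega>) t = Some h}) \<longlonglongrightarrow> u h"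
    and Y_chain: "markov_chain Q Y (Y_init N \<alpha> B k pr p) (Y_trans N \<alpha> B k pr)"
  shows "(\<exists>\<kappa>\<^sub>1>0. \<forall>h\<ge>1. u h = \<kappa>\<^sub>1 * measure Q {\<omega> \<in> space Q. Y h \<omega> \<in> Y_C N k}) \<and>
    invertible_mat (1\<^sub>m (num_transient N k) - A_mat N \<alpha> B k pr) \<and>
    (\<forall>h\<ge>1. u h =
       (sigma_vec N \<alpha> B k pr p \<bullet> (A_mat N \<alpha> B k pr ^\<^sub>m h *\<^sub>v v_vec N k)) /
       (sigma_vec N \<alpha> B k pr p \<bullet>
         ((A_mat N \<alpha> B k pr *
            the (mat_inverse (1\<^sub>m (num_transient N k) - A_mat N \<alpha> B k pr))) *\<^sub>v v_vec N k)))"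
proof -
  interpret prob_space M by (rule probability_space)
  interpret status_update N \<alpha> B k pr M T
    using freezing representation service_law service_indep by unfold_locales auto
  let ?q = "q_init N \<alpha> B k pr p"
  have u_eq: "u h = (\<Sum>y\<in>Y_tr. ?q y * hit h y)" for h
    by (rule limiting_age(1)[OF W_stationary W_unique steady_state])
  have u_sums: "u sums 1"
    by (rule limiting_age(2)[OF W_stationary W_unique steady_state])
  \<comment> \<open>This normaliser of \<open>q\<close> is the constant
    \<open>\<kappa>\<^sub>1\<close>.\<close>
  define c where "c = (\<Sum>y\<in>Y_tr. ?q y)"
  \<comment> \<open>The initial classes 1, 4, 5 and 6 all still contain the starred packet, so age 0
    has no mass and the sum may start at h = 1.\<close>
  have u0: "u 0 = 0" unfolding u_eq sum_Y_init by (simp add: Y_C_def)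
  have sums: "(\<lambda>h. u (Suc h)) sums 1" using u_sums u0 by (simp add: sums_Suc_iff)
  have q_nonneg: "0 \<le> ?q y" if "y \<in> Y_tr" for y
    using q_init_nonneg[OF _ that] W_stationary by (auto simp: stationary_def)
  \<comment> \<open>If \<open>c\<close> were 0, all entries of \<open>q\<close> and hence all of
    \<open>u\<close> would vanish, although \<open>u\<close> sums to 1.\<close>
  have c_pos: "0 < c"
  proof (rule ccontr)
    assume "\<not> 0 < c"
    moreover have "0 \<le> c" unfolding c_def by (intro sum_nonneg q_nonneg)
    ultimately have "(\<Sum>y\<in>Y_tr. ?q y) = 0" unfolding c_def by simp
    then have "\<forall>y\<in>Y_tr. ?q y = 0" by (subst (asm) sum_nonneg_eq_0_iff) (auto simp: q_nonneg)
    then have "u = (\<lambda>_. 0)" by (simp add: u_eq fun_eq_iff)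
    then show False using sums_unique[OF u_sums] by simp
  qed
  have init: "(\<Sum>y\<in>Y_tr. Y_init N \<alpha> B k pr p y * f y) = (\<Sum>y\<in>Y_tr. ?q y * f y) / c" for f
    by (simp add: Y_init_def c_def sum_divide_distrib)
  have hit_prob: "(\<Sum>y\<in>Y_tr. Y_init N \<alpha> B k pr p y * hit h y) = u h / c" for h
    unfolding init u_eq ..
  have summable_hit_Suc: "summable (\<lambda>h. hit (Suc h) y)" for y
    using summable_hit[of y] by (simp only: summable_Suc_iff[of "\<lambda>h. hit h y"])
  have "(\<Sum>y\<in>Y_tr. ?q y * (\<Sum>h. hit (Suc h) y)) = (\<Sum>h. \<Sum>y\<in>Y_tr. ?q y * hit (Suc h) y)"
    by (subst suminf_sum) (auto intro!: sum.cong suminf_mult[symmetric] summable_mult summable_hit_Suc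
        simp del: hit.simps)
  also have "\<dots> = 1" unfolding u_eq[symmetric] using sums by (rule sums_unique[symmetric])
  \<comment> \<open>By \<open>A_inverse_v\<close> this is the denominator of the explicit
    formula.\<close>
  finally have total: "(\<Sum>y\<in>Y_tr. Y_init N \<alpha> B k pr p y * (\<Sum>h. hit (Suc h) y)) = 1 / c"
    unfolding init by simp
  have "u h = c * measure Q {\<omega> \<in> space Q. Y h \<omega> \<in> Y_C N k}" for h
    unfolding Y_chain_prob[OF Y_chain] hit_prob using c_pos by simp
  moreover have "u h = (sigma_vec N \<alpha> B k pr p \<bullet> (A_mat N \<alpha> B k pr ^\<^sub>m h *\<^sub>v v_vec N k)) /
       (sigma_vec N \<alpha> B k pr p \<bullet>
         ((A_mat N \<alpha> B k pr *
            the (mat_inverse (1\<^sub>m (num_transient N k) - A_mat N \<alpha> B k pr))) *\<^sub>v v_vec N k))" for h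
    unfolding A_pow_v A_inverse_v sigma_scalar[of p "hit h"] sigma_scalar[of p "\<lambda>y. \<Sum>h. hit (Suc h) y"]
      hit_prob total using c_pos by simp
  ultimately show ?thesis using c_pos invertible_I_minus_A by blast
qed

end
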